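(* Every infinite minimal abelian group contains a non-trivial convergent sequence. That is, if $G$ is an infinite abelian group and $\mathscr{T}$ is a minimal Hausdorff group topology on $G$, then the topological group $(G,\mathscr{T})$ contains a non-trivial convergent sequence (with limit in $G$).
   Context: A Hausdorff group topology $\mathscr{T}$ on a group $G$ is called minimal if every Hausdorff group topology $\mathscr{T}'$ on $G$ such that $\mathscr{T}'\subseteq\mathscr{T}$ satisfies $\mathscr{T}'=\mathscr{T}$; in this case the pair $(G,\mathscr{T})$ is called a minimal group. (Equivalently, a Hausdorff topological group $G$ is minimal if every continuous isomorphism $f:G\to H$ onto a Hausdorff topological group $H$ is open.) Let $X$ be a topological space. A convergent sequence in $X$ is a sequence $S=\{x_n:n\in\mathbb{N}\}$ of points of $X$ such that there exists a point $x\in X$ (the limit of $S$) such that $S\setminus U$ is finite for every open subset $U$ of $X$ containing $x$. A sequence $S$ is non-trivial if the set $S=\{x_n:n\in\mathbb{N}\}$ is infinite. *)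

theory Defs
  imports "HOL-Analysis.Abstract_Topology" "HOL-Analysis.T1_Spaces" "HOL-Analysis.Product_Topology" "HOL-Algebra.Group"
begin

definition group_topology :: "('a, 'b) monoid_scheme \<Rightarrow> 'a topology \<Rightarrow> bool" where
  "group_topology G T \<longleftrightarrow>
     group G \<and> topspace T = carrier G \<and>
     continuous_map (prod_topology T T) T (\<lambda>(x, y). x \<otimes>\<^bsub>G\<^esub> y) \<and>
     continuous_map T T (\<lambda>x. inv\<^bsub>G\<^esub> x)"

definition Hausdorff_group_topology :: "('a, 'b) monoid_scheme \<Rightarrow> 'a topology \<Rightarrow> bool" where
  "Hausdorff_group_topology G T \<longleftrightarrow> group_topology G T \<and> Hausdorff_space T"

definition minimal_group_topology :: "('a, 'b) monoid_scheme \<Rightarrow> 'a topology \<Rightarrow> bool" where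
  "minimal_group_topology G T \<longleftrightarrow>
     Hausdorff_group_topology G T \<and>
     (\<forall>T'. Hausdorff_group_topology G T' \<and> {U. openin T' U} \<subseteq> {U. openin T U} \<longrightarrow> T' = T)"

(* Convergence is required of the set of terms, not of the enumeration: all but finitely many
   elements of that set lie in each open neighbourhood of the limit.  A single value may therefore
   be repeated infinitely often, and this is weaker than limitin for the enumeration s. *)
definition convergent_sequence_in :: "'a topology \<Rightarrow> (nat \<Rightarrow> 'a) \<Rightarrow> bool" where
  "convergent_sequence_in X s \<longleftrightarrow>
     range s \<subseteq> topspace X \<and>
     (\<exists>x\<in>topspace X. \<forall>U. openin X U \<and> x \<in> U \<longrightarrow> finite (range s - U))"

definition nontrivial_sequence :: "(nat \<Rightarrow> 'a) \<Rightarrow> bool" where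
  "nontrivial_sequence s \<longleftrightarrow> infinite (range s)"

end

theory Submission
  imports Defs "HOL-Analysis.Analysis" "HOL-Algebra.FiniteProduct"
    "HOL-Computational_Algebra.Polynomial" "HOL-Computational_Algebra.Primes"
    "HOL-Library.Function_Algebras"
begin

text \<open>
Minimality enters through one principle. Let \<iota> be a homomorphism from an abelian group H into
the minimal group G, and let \<S> be a family of subsets of H that behaves like a neighbourhood base
of 0. The products of \<iota>(S) with neighbourhoods U of the identity are the neighbourhoods of the
identity for a group topology on G that is coarser than the given one. Either this topology is not
Hausdorff, and then some g \<noteq> 1 lies in the closure of \<iota>(S) for every S in \<S>, or it
is the given topology, and then every neighbourhood of the identity contains some \<iota>(S). This
is the lemma minimality, and everything else consists in choosing \<S> well. The group H is always
the free abelian group of countable rank, realised as the additive group of integer polynomials.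

The first choice makes the image of a sequence converge to 1 in the new topology. If no nonzero
multiple c \<iota>(H) is covered by finitely many translates of a neighbourhood U, one finds a
sequence in H whose integer combinations with slowly growing coefficients stay away from any given
point of H once finitely many terms have been discarded. The sets of such combinations form a family
\<S> for which the new topology is Hausdorff. By minimality the image of the sequence then converges
to 1 in the old topology, although its terms were chosen outside a fixed neighbourhood of 1, a
contradiction. So some nonzero multiple of \<iota>(H) is totally bounded with respect to U
(multiple_precompact). If \<iota>(H) has prime exponent or is infinite cyclic, \<iota>(H) itself is
then totally bounded.

Suppose that \<iota>(H) is infinite and totally bounded. It has enough continuous characters
(separating_character): a neighbourhood gives a bounded pseudonorm on H, the group of n-tuples of
residues modulo a suitable N maps almost homomorphically into H, a differenced pseudonorm has a
large Fourier coefficient there, and a subsequence of the corresponding characters converges. Taking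
for \<S> the sets on which finitely many continuous characters are close to 1, one sees that the
group \<Gamma> of all continuous characters determines the topology of \<iota>(H). If finitely many
of them suffice, \<iota>(H) has a countable neighbourhood base and a sequence is found directly.
Otherwise \<Gamma> is the union of an increasing sequence of proper subgroups \<Lambda> n
(extend_chain_of_subgroups). None of them determines the topology, because a character that is
continuous for the topology of a group of characters belongs to that group (character_in_subgroup).
Hence, by minimality, there is y n \<noteq> 1 in the closure of every set on which finitely many
members of \<Lambda> n are close to 1. Finitely many members of \<Gamma> all lie in \<Lambda> n for
large n, and therefore y n tends to 1.

It remains to consider a torsion group in which every equation n x = 0 has finitely many solutions.
Such a group is countable. Taking for \<S> a decreasing sequence of neighbourhoods that avoids the
nontrivial elements one after another shows that it is first countable, and it is not discrete by
multiple_precompact, so a sequence of nontrivial elements tending to 1 exists here too.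
\<close>

section \<open>Fourier coefficients on finite abelian groups\<close>

text \<open>
A finite abelian group A with its characters E t, reduced to what Fourier analysis needs:
orthogonality, multiplicativity, and the fact that translations permute A.
\<close>

locale finite_dual_pair =
  fixes A :: "'i set" and T :: "'t set" and E :: "'t \<Rightarrow> 'i \<Rightarrow> complex"
    and add :: "'i \<Rightarrow> 'i \<Rightarrow> 'i"
  assumes finA: "finite A" and finT: "finite T" and A_ne: "A \<noteq> {}"
    and orth: "\<And>a b. \<lbrakk>a \<in> A; b \<in> A\<rbrakk> \<Longrightarrow>
      (\<Sum>t\<in>T. E t a * cnj (E t b)) = (if a = b then of_nat (card A) else 0)"
    and char_add: "\<And>t a b. \<lbrakk>t \<in> T; a \<in> A; b \<in> A\<rbrakk> \<Longrightarrow> E t (add a b) = E t a * E t b"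
    and char_norm: "\<And>t a. \<lbrakk>t \<in> T; a \<in> A\<rbrakk> \<Longrightarrow> norm (E t a) = 1"
    and translation_bij: "\<And>a. a \<in> A \<Longrightarrow> bij_betw (add a) A A"
    and add_commute: "\<And>a b. \<lbrakk>a \<in> A; b \<in> A\<rbrakk> \<Longrightarrow> add a b = add b a"
begin

lemma parseval:
  fixes u :: "'i \<Rightarrow> complex"
  shows "(\<Sum>t\<in>T. (norm (\<Sum>a\<in>A. u a * E t a))\<^sup>2) = card A * (\<Sum>a\<in>A. (norm (u a))\<^sup>2)"
proof -
  have "of_real (\<Sum>t\<in>T. (norm (\<Sum>a\<in>A. u a * E t a))\<^sup>2)
      = (\<Sum>t\<in>T. (\<Sum>a\<in>A. u a * E t a) * cnj (\<Sum>b\<in>A. u b * E t b))"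
    by (simp only: of_real_sum complex_norm_square)
  also have "\<dots> = (\<Sum>t\<in>T. \<Sum>a\<in>A. \<Sum>b\<in>A. u a * cnj (u b) * (E t a * cnj (E t b)))"
    by (simp add: sum_product algebra_simps)
  also have "\<dots> = (\<Sum>a\<in>A. \<Sum>b\<in>A. \<Sum>t\<in>T. u a * cnj (u b) * (E t a * cnj (E t b)))"
    by (subst sum.swap, rule sum.cong[OF refl], subst sum.swap, rule refl)
  also have "\<dots> = (\<Sum>a\<in>A. \<Sum>b\<in>A. u a * cnj (u b) * (if a = b then of_nat (card A) else 0))"
    by (simp add: sum_distrib_left[symmetric] orth)
  also have "\<dots> = (\<Sum>a\<in>A. u a * cnj (u a) * of_nat (card A))"
    by (simp add: if_distrib[where f="\<lambda>x. _ * x"] finA cong: if_cong)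
  also have "\<dots> = of_real (card A * (\<Sum>a\<in>A. (norm (u a))\<^sup>2))"
    by (simp add: complex_norm_square sum_distrib_left mult.commute del: of_real_power)
  finally show ?thesis by (simp only: of_real_eq_iff)
qed

text \<open>
The autocorrelation of F has the Fourier transform |F^|^2, so by Parseval the fourth moment
of F^ is the energy of the autocorrelation, which is large by assumption, while the second
moment is at most that of a function bounded by 1. The fourth moment is at most the second
moment times the maximum of |F^|^2.
\<close>

lemma large_fourier_coefficient:
  fixes F :: "'i \<Rightarrow> real" and \<beta> \<gamma> :: real
  assumes F1: "\<And>a. a \<in> A \<Longrightarrow> \<bar>F a\<bar> \<le> 1"
    and B: "B \<subseteq> A" "\<beta> * card A \<le> card B" "0 \<le> \<gamma>"
    and corr: "\<And>b. b \<in> B \<Longrightarrow> \<gamma> * card A \<le> (\<Sum>a\<in>A. F (add a b) * F a)"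
  shows "\<exists>t\<in>T. \<beta> * \<gamma>\<^sup>2 * (card A)\<^sup>2 \<le> (norm (\<Sum>a\<in>A. of_real (F a) * E t a))\<^sup>2"
proof -
  define f where "f t = (\<Sum>a\<in>A. of_real (F a) * E t a)" for t
  define C where "C b = (\<Sum>a\<in>A. F (add a b) * F a)" for b
  have cA: "card A > 0" using finA A_ne by (simp add: card_gt_0_iff)
  have sq: "of_real ((norm (f t))\<^sup>2) = (\<Sum>b\<in>A. of_real (C b) * E t b)" if t: "t \<in> T" for t
  proof -
    have "of_real ((norm (f t))\<^sup>2) = f t * cnj (f t)"
      by (simp only: complex_norm_square)
    also have "\<dots> = (\<Sum>a\<in>A. f t * (of_real (F a) * cnj (E t a)))"
      unfolding f_def by (simp add: sum_distrib_left)
    also have "\<dots> = (\<Sum>a\<in>A. \<Sum>b\<in>A. of_real (F (add a b) * F a) * E t b)"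
    proof (rule sum.cong[OF refl])
      fix a assume a: "a \<in> A"
      have "f t = (\<Sum>b\<in>A. of_real (F (add a b)) * E t (add a b))"
        unfolding f_def using sum.reindex_bij_betw[OF translation_bij[OF a],
            of "\<lambda>x. of_real (F x) * E t x"] by simp
      also have "\<dots> = (\<Sum>b\<in>A. of_real (F (add a b)) * E t b) * E t a"
        unfolding sum_distrib_right
        by (rule sum.cong[OF refl]) (simp add: char_add[OF t a])
      finally have "f t * (of_real (F a) * cnj (E t a))
          = (\<Sum>b\<in>A. of_real (F (add a b)) * E t b) * of_real (F a) * (E t a * cnj (E t a))"
        by (simp add: algebra_simps)
      also have "E t a * cnj (E t a) = 1"
        using char_norm[OF t a] by (metis complex_norm_square of_real_1 one_power2)
      finally show "f t * (of_real (F a) * cnj (E t a))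
          = (\<Sum>b\<in>A. of_real (F (add a b) * F a) * E t b)"
        unfolding sum_distrib_right by (simp add: mult_ac sum_distrib_right)
    qed
    also have "\<dots> = (\<Sum>b\<in>A. of_real (C b) * E t b)"
      by (subst sum.swap) (simp add: C_def sum_distrib_right)
    finally show ?thesis .
  qed
  have fourth: "(\<Sum>t\<in>T. (norm (f t))^4) = card A * (\<Sum>b\<in>A. (C b)\<^sup>2)"
  proof -
    have "(norm (f t))^4 = (norm (\<Sum>b\<in>A. of_real (C b) * E t b))\<^sup>2" if "t \<in> T" for t
      unfolding sq[OF that, symmetric] by (simp add: power_mult[symmetric] norm_power)
    then show ?thesis using parseval[of "\<lambda>b. of_real (C b)"] by simp
  qed
  have second: "(\<Sum>t\<in>T. (norm (f t))\<^sup>2) \<le> (card A)\<^sup>2"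
  proof -
    have "(\<Sum>a\<in>A. (F a)\<^sup>2) \<le> (\<Sum>a\<in>A. 1)"
      by (intro sum_mono) (use F1 in \<open>simp add: abs_square_le_1\<close>)
    then have "card A * (\<Sum>a\<in>A. (F a)\<^sup>2) \<le> card A * real (card A)"
      by (intro mult_left_mono) auto
    then show ?thesis using parseval[of "\<lambda>b. of_real (F b)"]
      by (simp add: f_def power2_eq_square)
  qed
  have low: "\<beta> * \<gamma>\<^sup>2 * real (card A)^4 \<le> (\<Sum>t\<in>T. (norm (f t))^4)"
  proof -
    have "(\<beta> * card A) * (\<gamma> * card A)\<^sup>2 \<le> card B * (\<gamma> * card A)\<^sup>2"
      by (intro mult_right_mono B) auto
    also have "\<dots> = (\<Sum>b\<in>B. (\<gamma> * card A)\<^sup>2)" by simp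
    also have "\<dots> \<le> (\<Sum>b\<in>B. (C b)\<^sup>2)"
      by (intro sum_mono power_mono) (use corr B(3) in \<open>auto simp: C_def\<close>)
    also have "\<dots> \<le> (\<Sum>b\<in>A. (C b)\<^sup>2)"
      by (rule sum_mono2) (use B(1) finA in auto)
    finally have "card A * ((\<beta> * card A) * (\<gamma> * card A)\<^sup>2) \<le> card A * (\<Sum>b\<in>A. (C b)\<^sup>2)"
      by (intro mult_left_mono) auto
    then show ?thesis unfolding fourth
      by (simp add: power_mult_distrib power2_eq_square power4_eq_xxxx algebra_simps)
  qed
  obtain a0 where a0: "a0 \<in> A" using A_ne by auto
  have "T \<noteq> {}" using orth[OF a0 a0] cA by auto
  define M where "M = Max ((\<lambda>t. (norm (f t))\<^sup>2) ` T)"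
  have "M \<in> (\<lambda>t. (norm (f t))\<^sup>2) ` T" unfolding M_def
    by (rule Max_in) (use finT \<open>T \<noteq> {}\<close> in auto)
  then obtain t where t: "t \<in> T" "M = (norm (f t))\<^sup>2" by auto
  have "(\<Sum>t\<in>T. (norm (f t))^4) \<le> (\<Sum>s\<in>T. M * (norm (f s))\<^sup>2)"
  proof (rule sum_mono)
    fix s assume "s \<in> T"
    then have "(norm (f s))\<^sup>2 \<le> M" unfolding M_def using finT by auto
    then have "(norm (f s))\<^sup>2 * (norm (f s))\<^sup>2 \<le> M * (norm (f s))\<^sup>2"
      by (intro mult_right_mono) auto
    then show "(norm (f s))^4 \<le> M * (norm (f s))\<^sup>2"
      by (simp add: power2_eq_square power4_eq_xxxx algebra_simps)
  qed
  also have "\<dots> \<le> M * (card A)\<^sup>2"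
    unfolding sum_distrib_left[symmetric] by (intro mult_left_mono second) (simp add: t)
  finally have "\<beta> * \<gamma>\<^sup>2 * real (card A)^4 \<le> M * (card A)\<^sup>2" using low by simp
  then have "(\<beta> * \<gamma>\<^sup>2 * (card A)\<^sup>2) * (card A)\<^sup>2 \<le> M * (card A)\<^sup>2"
    by (simp add: power2_eq_square power4_eq_xxxx algebra_simps)
  then have "\<beta> * \<gamma>\<^sup>2 * (card A)\<^sup>2 \<le> M" using cA by (auto simp: mult_le_cancel_right)
  then show ?thesis using t unfolding f_def by auto
qed

end

section \<open>Almost homomorphisms into a pseudonormed group\<close>

locale bounded_pseudonorm =
  fixes \<rho> :: "'h::ab_group_add \<Rightarrow> real"
  assumes rho_zero [simp]: "\<rho> 0 = 0" and rho_minus: "\<rho> (- x) = \<rho> x"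
    and rho_triangle: "\<rho> (x + y) \<le> \<rho> x + \<rho> y" and rho_le_1: "\<rho> x \<le> 1"
begin

lemma rho_nonneg: "0 \<le> \<rho> x"
  using rho_triangle[of x "-x"] by (simp add: rho_minus)

lemma rho_diff: "\<rho> (x - y) \<le> \<rho> x + \<rho> y"
  using rho_triangle[of x "-y"] by (simp add: rho_minus)

lemma rho_minus_commute: "\<rho> (x - y) = \<rho> (y - x)"
  using rho_minus[of "x - y"] by simp

lemma rho_lipschitz: "\<bar>\<rho> x - \<rho> y\<bar> \<le> \<rho> (x - y)"
  using rho_triangle[of "x - y" y] rho_triangle[of "y - x" x] rho_minus_commute[of x y] by simp

lemma rho_sum: "\<rho> (sum f I) \<le> (\<Sum>i\<in>I. \<rho> (f i))"
proof (induction I rule: infinite_finite_induct)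
  case (insert i I)
  then show ?case using rho_triangle[of "f i" "sum f I"] by simp
qed auto

end

text \<open>
Homomorphisms from finite groups into H may all be trivial. A map that is additive up to a small
error is a sufficient substitute, since only the values of the pseudonorm matter.
\<close>

locale almost_hom = finite_dual_pair A T E add + bounded_pseudonorm \<rho>
  for A :: "'i set" and T :: "'t set" and E :: "'t \<Rightarrow> 'i \<Rightarrow> complex"
    and add :: "'i \<Rightarrow> 'i \<Rightarrow> 'i" and \<rho> :: "'h::ab_group_add \<Rightarrow> real" +
  fixes \<phi> :: "'i \<Rightarrow> 'h" and \<tau> :: real
  assumes almost_add: "\<And>a b. \<lbrakk>a \<in> A; b \<in> A\<rbrakk> \<Longrightarrow> \<rho> (\<phi> (add a b) - \<phi> a - \<phi> b) \<le> \<tau>"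
begin

text \<open>
By the pigeonhole principle one ball around a point of the net X contains the images of a
proportion 1 / card X of A, and translating back by one of these elements moves them close to 0.
The lower bound for the density does not depend on A, which makes it possible to pass to a limit.
\<close>

lemma many_small:
  assumes X: "finite X" "\<And>f. \<exists>x\<in>X. \<rho> (f - x) \<le> \<eta>"
  shows "\<exists>D\<subseteq>A. card A \<le> card X * card D \<and> (\<forall>b\<in>D. \<rho> (\<phi> b) \<le> 2 * \<eta> + \<tau>)"
proof -
  obtain c where c: "\<And>a. c a \<in> X \<and> \<rho> (\<phi> a - c a) \<le> \<eta>"
    using X(2)[of "\<phi> _"] by metis
  have "X \<noteq> {}" using X(2) by auto
  have "\<exists>x\<in>X. card A \<le> card X * card {a\<in>A. c a = x}"
  proof (rule ccontr)
    assume "\<not> ?thesis"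
    then have lt: "card X * card {a\<in>A. c a = x} < card A" if "x \<in> X" for x
      using that by auto
    have "card A = (\<Sum>x\<in>X. card {a\<in>A. c a = x})"
      using sum_card_image[of A] card_UN_disjoint[of X "\<lambda>x. {a\<in>A. c a = x}"] X finA c
      by (subst card_UN_disjoint[symmetric]) (auto intro!: arg_cong[where f=card])
    then have "card X * card A = (\<Sum>x\<in>X. card X * card {a\<in>A. c a = x})"
      by (simp add: sum_distrib_left)
    also have "\<dots> < (\<Sum>x\<in>X. card A)"
      by (rule sum_strict_mono) (use lt X \<open>X \<noteq> {}\<close> in auto)
    finally show False by simp
  qed
  then obtain x where x: "x \<in> X" "card A \<le> card X * card {a\<in>A. c a = x}" by auto
  define P where "P = {a\<in>A. c a = x}"
  have "card A > 0" using finA A_ne by (simp add: card_gt_0_iff)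
  then have "P \<noteq> {}" using x(2) unfolding P_def[symmetric] by (cases "P = {}") auto
  then obtain a0 where a0: "a0 \<in> P" by auto
  then have a0A: "a0 \<in> A" by (simp add: P_def)
  define D where "D = {b\<in>A. add a0 b \<in> P}"
  have "bij_betw (add a0) D P"
    unfolding D_def
    using translation_bij[OF a0A]
    by (auto simp: bij_betw_def inj_on_def P_def image_iff)
  then have "card D = card P" by (rule bij_betw_same_card)
  moreover have "\<rho> (\<phi> b) \<le> 2 * \<eta> + \<tau>" if b: "b \<in> D" for b
  proof -
    let ?a = "add a0 b"
    have bA: "b \<in> A" and aP: "?a \<in> P" using b by (auto simp: D_def)
    have 1: "\<rho> (\<phi> ?a - x) \<le> \<eta>" "\<rho> (\<phi> a0 - x) \<le> \<eta>"
      using aP a0 c[of ?a] c[of a0] by (auto simp: P_def)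
    have "\<phi> b = (\<phi> ?a - x) - (\<phi> a0 - x) - (\<phi> ?a - \<phi> a0 - \<phi> b)" by simp
    then have "\<rho> (\<phi> b) \<le> \<rho> (\<phi> ?a - x) + \<rho> (\<phi> a0 - x) + \<rho> (\<phi> ?a - \<phi> a0 - \<phi> b)"
      using rho_diff[of "(\<phi> ?a - x) - (\<phi> a0 - x)" "\<phi> ?a - \<phi> a0 - \<phi> b"]
        rho_diff[of "\<phi> ?a - x" "\<phi> a0 - x"] by simp
    then show ?thesis using 1 almost_add[OF a0A bA] by simp
  qed
  ultimately show ?thesis using x(2) unfolding P_def[symmetric]
    by (intro exI[of _ D]) (auto simp: D_def)
qed

lemma rho_almost_add:
  assumes "a \<in> A" "b \<in> A" shows "\<rho> (\<phi> (add a b) - \<phi> a) \<le> \<rho> (\<phi> b) + \<tau>"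
  using rho_triangle[of "\<phi> (add a b) - \<phi> a - \<phi> b" "\<phi> b"] almost_add[OF assms] by simp

lemma difference_translate:
  assumes "a \<in> A" "b \<in> A"
  shows "\<bar>(\<rho> (\<phi> (add a b)) - \<rho> (\<phi> (add a b) + h)) - (\<rho> (\<phi> a) - \<rho> (\<phi> a + h))\<bar> \<le> 2 * (\<rho> (\<phi> b) + \<tau>)"
  using rho_lipschitz[of "\<phi> (add a b)" "\<phi> a"] rho_lipschitz[of "\<phi> (add a b) + h" "\<phi> a + h"]
    rho_almost_add[OF assms] by simp

text \<open>
The function whose Fourier coefficients are studied is the difference of the pseudonorm and its
translate by h. Near 0 it is close to -1, so its square has mean at least d / 2. It changes
little under translation by the elements b for which \<phi> b is small, so there its autocorrelation is at
least d / 4, and these b have density at least 1 / card Y.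
\<close>

lemma large_coefficient:
  assumes X: "finite X" "\<And>f. \<exists>x\<in>X. \<rho> (f - x) \<le> 1/32"
    and d: "d = 1 / card X"
    and Y: "finite Y" "\<And>f. \<exists>x\<in>Y. \<rho> (f - x) \<le> d/64"
    and tau: "\<tau> \<le> d/64" and h: "\<rho> h = 1"
  shows "\<exists>t\<in>T. (d/4)\<^sup>2 / card Y * (card A)\<^sup>2
      \<le> (norm (\<Sum>a\<in>A. of_real (\<rho> (\<phi> a) - \<rho> (\<phi> a + h)) * E t a))\<^sup>2"
proof -
  define F where "F a = \<rho> (\<phi> a) - \<rho> (\<phi> a + h)" for a
  have "X \<noteq> {}" "Y \<noteq> {}" using X(2) Y(2) by auto
  then have cX: "card X > 0" and cY: "card Y > 0" using X Y by (auto simp: card_gt_0_iff)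
  have d0: "0 < d" "d \<le> 1" using cX by (auto simp: d)
  have F1: "\<bar>F a\<bar> \<le> 1" for a
    using rho_nonneg[of "\<phi> a"] rho_nonneg[of "\<phi> a + h"] rho_le_1[of "\<phi> a"] rho_le_1[of "\<phi> a + h"]
    by (simp add: F_def abs_le_iff)
  obtain D where D: "D \<subseteq> A" "card A \<le> card X * card D" "\<And>b. b \<in> D \<Longrightarrow> \<rho> (\<phi> b) \<le> 2 * (1/32) + \<tau>"
    using many_small[OF X] by auto
  obtain B where B: "B \<subseteq> A" "card A \<le> card Y * card B" "\<And>b. b \<in> B \<Longrightarrow> \<rho> (\<phi> b) \<le> 2 * (d/64) + \<tau>"
    using many_small[OF Y] by auto
  have FD: "1/2 \<le> (F a)\<^sup>2" if "a \<in> D" for a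
  proof -
    have "\<rho> (\<phi> a) \<le> 1/8" using D(3)[OF that] tau d0 by simp
    moreover have "\<rho> h \<le> \<rho> (\<phi> a + h) + \<rho> (\<phi> a)" using rho_diff[of "\<phi> a + h" "\<phi> a"] by simp
    ultimately have "3/4 \<le> - F a" using h by (simp add: F_def)
    then have "(3/4)\<^sup>2 \<le> (- F a)\<^sup>2" by (intro power_mono) auto
    then show ?thesis by (simp add: power2_eq_square)
  qed
  have "real (card A) \<le> real (card X) * real (card D)"
    using D(2) by (metis of_nat_le_iff of_nat_mult)
  then have "d * card A \<le> card D" using cX by (simp add: d field_simps)
  then have "d / 2 * card A \<le> (\<Sum>a\<in>D. 1/2)" by simp
  also have "\<dots> \<le> (\<Sum>a\<in>D. (F a)\<^sup>2)" by (intro sum_mono FD)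
  also have "\<dots> \<le> (\<Sum>a\<in>A. (F a)\<^sup>2)" by (rule sum_mono2) (use D(1) finA in auto)
  finally have energy: "d / 2 * card A \<le> (\<Sum>a\<in>A. (F a)\<^sup>2)" .
  have corr: "d / 4 * card A \<le> (\<Sum>a\<in>A. F (add a b) * F a)" if b: "b \<in> B" for b
  proof -
    have bA: "b \<in> A" using b B by auto
    have "(F a)\<^sup>2 - d / 4 \<le> F (add a b) * F a" if a: "a \<in> A" for a
    proof -
      have "2 * (\<rho> (\<phi> b) + \<tau>) \<le> d/4" using B(3)[OF b] tau d0(1) by simp
      then have "\<bar>F (add a b) - F a\<bar> \<le> d/4"
        using difference_translate[OF a bA, of h] unfolding F_def by simp
      then have "\<bar>(F (add a b) - F a) * F a\<bar> \<le> d/4 * 1"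
        unfolding abs_mult by (intro mult_mono) (use F1 d0 in auto)
      then have "- (d/4) \<le> (F (add a b) - F a) * F a" by linarith
      then show ?thesis by (simp add: power2_eq_square left_diff_distrib)
    qed
    then have "(\<Sum>a\<in>A. (F a)\<^sup>2 - d / 4) \<le> (\<Sum>a\<in>A. F (add a b) * F a)" by (rule sum_mono)
    then show ?thesis using energy by (simp add: sum_subtractf mult.commute)
  qed
  have "real (card A) \<le> real (card Y) * real (card B)"
    using B(2) by (metis of_nat_le_iff of_nat_mult)
  then have "1 / card Y * card A \<le> card B" using cY by (simp add: field_simps)
  from large_fourier_coefficient[of F, OF F1 B(1) this _ corr] d0
  show ?thesis by (simp add: F_def)
qed

text \<open>
Translating the summation variable by b multiplies the Fourier coefficient by E t b but changes
the function little if \<phi> b is small. Hence a character with a large coefficient is close to 1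
wherever the pseudonorm is small: this is where continuity of the limit characters comes from.
\<close>

lemma character_small:
  assumes t: "t \<in> T" and b: "b \<in> A"
  shows "norm (\<Sum>a\<in>A. of_real (\<rho> (\<phi> a) - \<rho> (\<phi> a + h)) * E t a) * norm (E t b - 1)
    \<le> 2 * (\<rho> (\<phi> b) + \<tau>) * card A"
proof -
  define F where "F a = \<rho> (\<phi> a) - \<rho> (\<phi> a + h)" for a
  let ?S = "\<Sum>a\<in>A. of_real (F a) * E t a"
  have "?S = (\<Sum>a\<in>A. of_real (F (add b a)) * E t (add b a))"
    using sum.reindex_bij_betw[OF translation_bij[OF b], of "\<lambda>x. of_real (F x) * E t x"] by simp
  also have "\<dots> = E t b * (\<Sum>a\<in>A. of_real (F (add b a)) * E t a)"
    using char_add[OF t b] by (simp add: sum_distrib_left algebra_simps)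
  finally have eq: "?S = E t b * (\<Sum>a\<in>A. of_real (F (add b a)) * E t a)" .
  have "?S * (E t b - 1) = E t b * ?S - E t b * (\<Sum>a\<in>A. of_real (F (add b a)) * E t a)"
    using eq by (simp add: algebra_simps)
  also have "\<dots> = - (E t b * (\<Sum>a\<in>A. of_real (F (add a b) - F a) * E t a))"
    using add_commute[OF b] by (simp add: sum_subtractf algebra_simps)
  finally have "norm (?S * (E t b - 1)) = norm (\<Sum>a\<in>A. of_real (F (add a b) - F a) * E t a)"
    by (simp add: norm_mult char_norm[OF t b])
  also have "\<dots> \<le> (\<Sum>a\<in>A. 2 * (\<rho> (\<phi> b) + \<tau>))"
  proof (rule sum_norm_le)
    fix a assume a: "a \<in> A"
    show "norm (of_real (F (add a b) - F a) * E t a) \<le> 2 * (\<rho> (\<phi> b) + \<tau>)"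
      using difference_translate[OF a b, of h] char_norm[OF t a]
      unfolding norm_mult norm_of_real by (simp add: F_def)
  qed
  finally show ?thesis unfolding norm_mult F_def by (simp add: mult.commute)
qed

text \<open>
Up to the error made by \<phi>, translation by h is translation by b, so the coefficient of the
difference is E t b - 1 times a Fourier coefficient of a function bounded by 1. A large coefficient
therefore forces E t b away from 1: the character separates h from 0.
\<close>

lemma coefficient_bound:
  assumes t: "t \<in> T" and b: "b \<in> A" and err: "\<rho> (h - \<phi> b) \<le> \<sigma>"
  shows "norm (\<Sum>a\<in>A. of_real (\<rho> (\<phi> a) - \<rho> (\<phi> a + h)) * E t a)
    \<le> (norm (E t b - 1) + \<sigma> + \<tau>) * card A"
proof -
  let ?R = "\<Sum>a\<in>A. of_real (\<rho> (\<phi> a)) * E t a"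
  let ?Q = "\<Sum>a\<in>A. of_real (\<rho> (\<phi> (add b a))) * E t a"
  have R: "norm ?R \<le> card A"
  proof -
    have "norm ?R \<le> (\<Sum>a\<in>A. 1)"
      by (rule sum_norm_le) (use rho_le_1 rho_nonneg char_norm[OF t] in \<open>auto simp: norm_mult\<close>)
    then show ?thesis by simp
  qed
  have Q1: "norm ?Q \<le> card A"
  proof -
    have "norm ?Q \<le> (\<Sum>a\<in>A. 1)"
      by (rule sum_norm_le) (use rho_le_1 rho_nonneg char_norm[OF t] in \<open>auto simp: norm_mult\<close>)
    then show ?thesis by simp
  qed
  have eq: "?R = E t b * ?Q"
    using sum.reindex_bij_betw[OF translation_bij[OF b], of "\<lambda>x. of_real (\<rho> (\<phi> x)) * E t x"]
      char_add[OF t b] by (simp add: sum_distrib_left algebra_simps)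
  have "(\<Sum>a\<in>A. of_real (\<rho> (\<phi> a) - \<rho> (\<phi> a + h)) * E t a)
     = (E t b - 1) * ?Q + (\<Sum>a\<in>A. of_real (\<rho> (\<phi> (add b a)) - \<rho> (\<phi> a + h)) * E t a)"
    using eq by (simp add: sum_subtractf algebra_simps)
  also have "norm \<dots> \<le> norm ((E t b - 1) * ?Q) + norm (\<Sum>a\<in>A. of_real (\<rho> (\<phi> (add b a)) - \<rho> (\<phi> a + h)) * E t a)"
    by (rule norm_triangle_ineq)
  also have "norm ((E t b - 1) * ?Q) \<le> norm (E t b - 1) * card A"
    unfolding norm_mult by (intro mult_left_mono Q1) auto
  also have "norm (\<Sum>a\<in>A. of_real (\<rho> (\<phi> (add b a)) - \<rho> (\<phi> a + h)) * E t a) \<le> (\<Sum>a\<in>A. \<sigma> + \<tau>)"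
  proof (rule sum_norm_le)
    fix a assume a: "a \<in> A"
    have "\<phi> (add b a) - (\<phi> a + h) = (\<phi> (add b a) - \<phi> b - \<phi> a) - (h - \<phi> b)" by simp
    then have "\<rho> (\<phi> (add b a) - (\<phi> a + h)) \<le> \<sigma> + \<tau>"
      using rho_diff[of "\<phi> (add b a) - \<phi> b - \<phi> a" "h - \<phi> b"] almost_add[OF b a] err
      by (simp add: diff_diff_eq)
    then show "norm (of_real (\<rho> (\<phi> (add b a)) - \<rho> (\<phi> a + h)) * E t a) \<le> \<sigma> + \<tau>"
      using rho_lipschitz[of "\<phi> (add b a)" "\<phi> a + h"] char_norm[OF t a]
      unfolding norm_mult norm_of_real by simp
  qed
  finally show ?thesis by (simp add: algebra_simps)
qed

end

section \<open>The circle and the groups of tuples of residues\<close>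

text \<open>
The real numbers modulo 1 are represented by the unit circle.
\<close>

definition ec :: "real \<Rightarrow> complex" where "ec t = cis (2 * pi * t)"

lemma ec_0 [simp]: "ec 0 = 1" by (simp add: ec_def)
lemma ec_add: "ec (s + t) = ec s * ec t" by (simp add: ec_def cis_mult distrib_left)
lemma norm_ec [simp]: "norm (ec t) = 1" by (simp add: ec_def)
lemma cnj_ec: "cnj (ec t) = ec (- t)" by (simp add: ec_def cis_cnj)
lemma ec_eq_1_iff: "ec t = 1 \<longleftrightarrow> t \<in> \<int>"
proof -
  have "ec t = 1 \<longleftrightarrow> (\<exists>n::int. 2 * pi * t = of_int (2 * n) * pi)"
    by (simp add: ec_def cis_conv_exp exp_eq_1)
  also have "\<dots> \<longleftrightarrow> (\<exists>n::int. t = of_int n)" by (simp add: mult.commute)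
  finally show ?thesis by (auto simp: Ints_def)
qed
lemma ec_sum: "ec (sum f I) = (\<Prod>i\<in>I. ec (f i))"
  by (induction I rule: infinite_finite_induct) (auto simp: ec_add)
lemma ec_power: "ec t ^ n = ec (of_nat n * t)"
  by (simp add: ec_def Complex.DeMoivre mult_ac)
lemma ec_eq_if: "s - t \<in> \<int> \<Longrightarrow> ec s = ec t"
  using ec_add[of "s - t" t] ec_eq_1_iff[of "s - t"] by simp
lemma norm_ec_diff: "norm (ec (s - t) - 1) \<le> norm (ec s - 1) + norm (ec t - 1)"
proof -
  have "ec (s - t) - 1 = ec (-t) * (ec s - 1) - ec (-t) * (ec t - 1)"
    by (simp add: ec_add[symmetric] algebra_simps)
  also have "norm \<dots> \<le> norm (ec (-t) * (ec s - 1)) + norm (ec (-t) * (ec t - 1))"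
    by (rule norm_triangle_ineq4)
  finally show ?thesis by (simp add: norm_mult)
qed
lemma continuous_ec: "isCont ec t"
  unfolding ec_def cis_conv_exp by (intro continuous_intros)

lemma root_of_unity_sum:
  fixes d :: int
  assumes "\<bar>d\<bar> < int N"
  shows "(\<Sum>k<N. ec (of_nat k * (of_int d / of_nat N))) = (if d = 0 then of_nat N else 0)"
proof (cases "d = 0")
  case False
  have N: "N > 0" using assms by (cases N) auto
  have "of_int d / of_nat N \<notin> (\<int> :: real set)"
  proof
    assume "of_int d / of_nat N \<in> (\<int> :: real set)"
    then obtain m :: int where "of_int d / of_nat N = (of_int m :: real)" by (auto elim: Ints_cases)
    then have "of_int d = (of_int (m * int N) :: real)" using N by (simp add: field_simps)
    then have "d = m * int N" by (simp only: of_int_eq_iff)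
    then have "int N dvd d" by simp
    then show False using assms False zdvd_not_zless[of "\<bar>d\<bar>" "int N"] by simp
  qed
  then have "ec (of_int d / of_nat N) \<noteq> 1" by (simp add: ec_eq_1_iff)
  moreover have "ec (of_int d / of_nat N) ^ N = 1"
    using N by (simp add: ec_power ec_eq_1_iff)
  ultimately show ?thesis
    using False unfolding ec_power[symmetric] by (simp add: geometric_sum)
qed simp

text \<open>
Tuples of n residues modulo N, added componentwise. The tuples index their own characters.
\<close>

definition cyc :: "nat \<Rightarrow> nat \<Rightarrow> (nat \<Rightarrow> nat) set" where
  "cyc n N = (\<Pi>\<^sub>E i\<in>{..<n}. {..<N})"
definition cyc_add :: "nat \<Rightarrow> nat \<Rightarrow> (nat \<Rightarrow> nat) \<Rightarrow> (nat \<Rightarrow> nat) \<Rightarrow> nat \<Rightarrow> nat" where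
  "cyc_add n N a b = (\<lambda>i\<in>{..<n}. (a i + b i) mod N)"
definition cyc_char :: "nat \<Rightarrow> nat \<Rightarrow> (nat \<Rightarrow> nat) \<Rightarrow> (nat \<Rightarrow> nat) \<Rightarrow> complex" where
  "cyc_char n N t a = ec (\<Sum>i<n. of_nat (t i) * of_nat (a i) / of_nat N)"

lemma cyc_dual_pair:
  assumes N: "N > 0"
  shows "finite_dual_pair (cyc n N) (cyc n N) (cyc_char n N) (cyc_add n N)"
proof
  show "finite (cyc n N)" by (auto simp: cyc_def intro!: finite_PiE)
  show "cyc n N \<noteq> {}" using N by (auto simp: cyc_def PiE_eq_empty_iff)
  fix a b assume a: "a \<in> cyc n N" and b: "b \<in> cyc n N"
  show "(\<Sum>t\<in>cyc n N. cyc_char n N t a * cnj (cyc_char n N t b))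
      = (if a = b then of_nat (card (cyc n N)) else 0)"
  proof -
    define d where "d i = int (a i) - int (b i)" for i
    have "cyc_char n N t a * cnj (cyc_char n N t b)
        = (\<Prod>i<n. ec (of_nat (t i) * (of_int (d i) / of_nat N)))" for t
      unfolding cyc_char_def cnj_ec ec_add[symmetric] ec_sum[symmetric]
      by (simp add: d_def sum_subtractf[symmetric] algebra_simps diff_divide_distrib)
    then have "(\<Sum>t\<in>cyc n N. cyc_char n N t a * cnj (cyc_char n N t b))
       = (\<Prod>i<n. \<Sum>k<N. ec (of_nat k * (of_int (d i) / of_nat N)))"
      unfolding cyc_def by (subst prod_sum_PiE) auto
    also have "\<dots> = (\<Prod>i<n. if d i = 0 then of_nat N else 0)"
    proof (intro prod.cong refl root_of_unity_sum)
      fix i assume "i \<in> {..<n}"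
      then have "a i < N" "b i < N" using a b by (auto simp: cyc_def PiE_iff)
      then show "\<bar>d i\<bar> < int N" by (simp add: d_def abs_less_iff)
    qed
    also have "\<dots> = (if a = b then of_nat (card (cyc n N)) else 0)"
    proof (cases "a = b")
      case True
      then show ?thesis by (simp add: d_def cyc_def card_PiE)
    next
      case False
      then have "\<exists>i\<in>{..<n}. a i \<noteq> b i"
        using a b unfolding cyc_def by (metis PiE_ext)
      then have "\<exists>i\<in>{..<n}. d i \<noteq> 0" by (auto simp: d_def)
      then have "(\<Prod>i<n. if d i = 0 then of_nat N else 0) = (0::complex)"
        by (auto intro!: prod_zero)
      then show ?thesis using False by simp
    qed
    finally show ?thesis .
  qed
  show "cyc_add n N a b = cyc_add n N b a" by (simp add: cyc_add_def add.commute)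
  fix t assume t: "t \<in> cyc n N"
  show "cyc_char n N t (cyc_add n N a b) = cyc_char n N t a * cyc_char n N t b"
    unfolding cyc_char_def ec_add[symmetric] sum.distrib[symmetric]
  proof (rule ec_eq_if)
    have "of_nat (t i) * of_nat (cyc_add n N a b i) / of_nat N
        - (of_nat (t i) * of_nat (a i) / of_nat N + of_nat (t i) * of_nat (b i) / of_nat N)
      \<in> (\<int> :: real set)" if "i < n" for i
    proof -
      have "real (a i + b i) = real (N * ((a i + b i) div N) + (a i + b i) mod N)" by simp
      then have "real ((a i + b i) mod N) = real (a i) + real (b i) - real N * real ((a i + b i) div N)"
        by (simp only: of_nat_add of_nat_mult)
      then have *: "real (cyc_add n N a b i) = real (a i) + real (b i) - real N * real ((a i + b i) div N)"
        using that by (simp add: cyc_add_def)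
      have "of_nat (t i) * of_nat (cyc_add n N a b i) / of_nat N
        - (of_nat (t i) * of_nat (a i) / of_nat N + of_nat (t i) * of_nat (b i) / of_nat N)
        = - (real (t i) * real ((a i + b i) div N))"
        unfolding * using N by (simp add: diff_divide_distrib add_divide_distrib algebra_simps)
      also have "\<dots> \<in> \<int>" by simp
      finally show ?thesis .
    qed
    then show "(\<Sum>i<n. of_nat (t i) * of_nat (cyc_add n N a b i) / of_nat N) -
      (\<Sum>i<n. of_nat (t i) * of_nat (a i) / of_nat N + of_nat (t i) * of_nat (b i) / of_nat N)
      \<in> (\<int> :: real set)"
      unfolding sum_subtractf[symmetric] by (intro Ints_sum) auto
  qed
next
  fix t a show "norm (cyc_char n N t a) = 1" by (simp add: cyc_char_def)
next
  fix a assume a: "a \<in> cyc n N"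
  have inj: "inj_on (cyc_add n N a) (cyc n N)"
  proof (rule inj_onI)
    fix b c assume b: "b \<in> cyc n N" and c: "c \<in> cyc n N"
      and eq: "cyc_add n N a b = cyc_add n N a c"
    have "b i = c i" if i: "i < n" for i
    proof -
      have "(a i + b i) mod N = (a i + c i) mod N"
        using fun_cong[OF eq, of i] i by (simp add: cyc_add_def)
      then have "int (a i + b i) mod int N = int (a i + c i) mod int N"
        by (simp only: zmod_int[symmetric])
      then have "int N dvd int (b i) - int (c i)" by (simp add: mod_eq_dvd_iff)
      then have "int N dvd \<bar>int (b i) - int (c i)\<bar>" by simp
      moreover have "b i < N" "c i < N" using b c i by (auto simp: cyc_def PiE_iff)
      then have "\<bar>int (b i) - int (c i)\<bar> < int N" by linarith
      ultimately show ?thesis using zdvd_not_zless[of "\<bar>int (b i) - int (c i)\<bar>" "int N"] by auto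
    qed
    then show "b = c" using b c unfolding cyc_def by (intro PiE_ext) auto
  qed
  have "cyc_add n N a b \<in> cyc n N" for b
    using N by (simp add: cyc_add_def cyc_def PiE_iff)
  then have "cyc_add n N a ` cyc n N \<subseteq> cyc n N" by blast
  moreover have "finite (cyc n N)" unfolding cyc_def by (rule finite_PiE) auto
  ultimately have "cyc_add n N a ` cyc n N = cyc n N"
    using inj by (intro endo_inj_surj)
  then show "bij_betw (cyc_add n N a) (cyc n N) (cyc n N)"
    using inj by (simp add: bij_betw_def)
qed

section \<open>Totally bounded pseudonorms have characters\<close>

text \<open>
Every homomorphism from the free abelian group of integer polynomials to the circle lifts to an
additive real function, so characters are given by the sequence of their values at the monomials.
\<close>

definition lin :: "(nat \<Rightarrow> real) \<Rightarrow> int poly \<Rightarrow> real" where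
  "lin \<theta> f = (\<Sum>i\<le>degree f. of_int (coeff f i) * \<theta> i)"

lemma lin_eq: "degree f \<le> n \<Longrightarrow> lin \<theta> f = (\<Sum>i\<le>n. of_int (coeff f i) * \<theta> i)"
  unfolding lin_def by (rule sum.mono_neutral_left) (auto simp: coeff_eq_0)

lemma lin_add: "lin \<theta> (f + g) = lin \<theta> f + lin \<theta> g"
  by (simp add: lin_eq[of _ "max (degree f) (degree g)"] degree_add_le
      sum.distrib[symmetric] algebra_simps)

locale poly_pseudonorm = bounded_pseudonorm \<rho> for \<rho> :: "int poly \<Rightarrow> real" +
  assumes totally_bounded: "\<And>\<eta>. 0 < \<eta> \<Longrightarrow> \<exists>X. finite X \<and> (\<forall>f. \<exists>x\<in>X. \<rho> (f - x) \<le> \<eta>)"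
begin

lemma rho_smult: "\<rho> (smult k f) \<le> \<bar>of_int k\<bar> * \<rho> f"
proof -
  have *: "\<rho> (smult (int m) f) \<le> real m * \<rho> f" for m
  proof (induction m)
    case (Suc m)
    have "smult (int (Suc m)) f = smult (int m) f + f"
      by (simp add: smult_add_left)
    then show ?case using rho_triangle[of "smult (int m) f" f] Suc by (simp add: algebra_simps)
  qed simp
  show ?thesis
  proof (cases "k \<ge> 0")
    case True then show ?thesis using *[of "nat k"] by simp
  next
    case False
    then have "\<rho> (smult k f) = \<rho> (smult (int (nat (-k))) f)" using rho_minus[of "smult k f"] by simp
    then show ?thesis using *[of "nat (-k)"] False by simp
  qed
qed

text \<open>
By the pigeonhole principle there are two integers such that, for every i < n, the corresponding
multiples of the i-th monomial lie in the same ball of a finite net. Their difference is N.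
\<close>

lemma ex_small_multiple:
  assumes "0 < \<eta>"
  shows "\<exists>N>0. \<forall>i<n. \<rho> (monom (int N) i) \<le> \<eta>"
proof -
  obtain X where X: "finite X" "\<And>f. \<exists>x\<in>X. \<rho> (f - x) \<le> \<eta>/2"
    using totally_bounded[of "\<eta>/2"] assms by auto
  obtain c where c: "\<And>f. c f \<in> X" "\<And>f. \<rho> (f - c f) \<le> \<eta>/2" using X(2) by metis
  define \<Phi> where "\<Phi> k = (\<lambda>i\<in>{..<n}. c (monom (int k) i))" for k
  have "\<Phi> ` UNIV \<subseteq> (\<Pi>\<^sub>E i\<in>{..<n}. X)" using c by (auto simp: \<Phi>_def PiE_iff extensional_def split: if_splits)
  moreover have "finite (\<Pi>\<^sub>E i\<in>{..<n}. X)" using X by (intro finite_PiE) auto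
  ultimately have "finite (range \<Phi>)" by (rule finite_subset)
  then have "\<not> inj \<Phi>" using finite_imageD by blast
  then obtain k l where "k \<noteq> l" "\<Phi> k = \<Phi> l" by (auto simp: inj_def)
  then obtain k l where kl: "k < l" "\<Phi> k = \<Phi> l" by (metis nat_neq_iff)
  have "\<rho> (monom (int (l - k)) i) \<le> \<eta>" if i: "i < n" for i
  proof -
    define x where "x = c (monom (int k) i)"
    have x: "x = c (monom (int l) i)"
      using fun_cong[OF kl(2), of i] i by (simp add: \<Phi>_def x_def)
    have "monom (int (l - k)) i = (monom (int l) i - x) - (monom (int k) i - x)"
      using kl(1) by (simp add: diff_monom of_nat_diff)
    then show ?thesis
      using rho_diff[of "monom (int l) i - x" "monom (int k) i - x"]
        c(2)[of "monom (int l) i"] c(2)[of "monom (int k) i"]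
      unfolding x[symmetric] x_def[symmetric] by simp
  qed
  then show ?thesis using kl(1) by (intro exI[of _ "l - k"]) auto
qed

definition combo :: "nat \<Rightarrow> (nat \<Rightarrow> nat) \<Rightarrow> int poly" where
  "combo n a = (\<Sum>i<n. monom (int (a i)) i)"

text \<open>
Addition modulo N differs from addition of integers by multiples of N in some components, and
these are small in the pseudonorm by the choice of N.
\<close>

lemma combo_almost_hom:
  assumes N: "N > 0" and small: "\<And>i. i < n \<Longrightarrow> \<rho> (monom (int N) i) \<le> \<eta>" "real n * \<eta> \<le> \<tau>"
  shows "almost_hom (cyc n N) (cyc n N) (cyc_char n N) (cyc_add n N) \<rho> (combo n) \<tau>"
proof -
  interpret finite_dual_pair "cyc n N" "cyc n N" "cyc_char n N" "cyc_add n N"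
    by (rule cyc_dual_pair[OF N])
  show ?thesis
  proof
    fix a b assume a: "a \<in> cyc n N" and b: "b \<in> cyc n N"
    have "combo n (cyc_add n N a b) - combo n a - combo n b
      = (\<Sum>i<n. monom (int ((a i + b i) mod N) - int (a i) - int (b i)) i)"
      by (simp add: combo_def sum_subtractf[symmetric] diff_monom cyc_add_def)
    also have "\<rho> \<dots> \<le> (\<Sum>i<n. \<rho> (monom (int ((a i + b i) mod N) - int (a i) - int (b i)) i))"
      by (rule rho_sum)
    also have "\<dots> \<le> (\<Sum>i<n. \<eta>)"
    proof (rule sum_mono)
      fix i assume "i \<in> {..<n}"
      then have i: "i < n" "a i < N" "b i < N" using a b by (auto simp: cyc_def PiE_iff)
      consider "a i + b i < N" | "N \<le> a i + b i" by linarith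
      then show "\<rho> (monom (int ((a i + b i) mod N) - int (a i) - int (b i)) i) \<le> \<eta>"
      proof cases
        case 1
        then have "int ((a i + b i) mod N) - int (a i) - int (b i) = 0" by simp
        then show ?thesis using small(1)[OF i(1)] rho_nonneg[of "monom (int N) i"] by simp
      next
        case 2
        then have "(a i + b i) mod N = a i + b i - N"
          using i by (simp add: mod_if)
        then have "monom (int ((a i + b i) mod N) - int (a i) - int (b i)) i = - monom (int N) i"
          using 2 by (simp add: of_nat_diff minus_monom)
        then show ?thesis using small(1)[OF i(1)] by (simp add: rho_minus)
      qed
    qed
    finally show "\<rho> (combo n (cyc_add n N a b) - combo n a - combo n b) \<le> \<tau>"
      using small(2) by simp
  qed
qed

end

lemma ex_convergent_subsequence_unit_interval:
  fixes \<theta> :: "nat \<Rightarrow> nat \<Rightarrow> real"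
  assumes "\<And>j i. 0 \<le> \<theta> j i \<and> \<theta> j i \<le> 1"
  shows "\<exists>l r. strict_mono r \<and> (\<forall>i. (\<lambda>j. \<theta> (r j) i) \<longlonglongrightarrow> l i)"
proof -
  have "compactin (product_topology (\<lambda>i. euclidean) UNIV) (PiE (UNIV::nat set) (\<lambda>_. {0..1::real}))"
    by (subst compactin_PiE) auto
  then have "compact (PiE (UNIV::nat set) (\<lambda>_. {0..1::real}))"
    by (simp add: euclidean_product_topology)
  then have "seq_compact (PiE (UNIV::nat set) (\<lambda>_. {0..1::real}))"
    by (rule compact_imp_seq_compact)
  moreover have "\<forall>j. \<theta> j \<in> PiE (UNIV::nat set) (\<lambda>_. {0..1::real})"
    using assms by auto
  ultimately obtain l r where lr: "strict_mono r" "(\<theta> \<circ> r) \<longlonglongrightarrow> l"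
    unfolding seq_compact_def by blast
  have "(\<lambda>j. (\<theta> \<circ> r) j i) \<longlonglongrightarrow> l i" for i
  proof -
    have "isCont (\<lambda>x::nat \<Rightarrow> real. x i) l"
    proof -
      have "continuous_on UNIV (\<lambda>x::nat \<Rightarrow> real. x i)" by (rule continuous_on_product_coordinates)
      then show ?thesis using continuous_on_eq_continuous_at[OF open_UNIV] by blast
    qed
    from isCont_tendsto_compose[OF this lr(2)] show ?thesis .
  qed
  then show ?thesis using lr(1) by (auto simp: o_def)
qed

context poly_pseudonorm
begin

definition coeff_norm :: "int poly \<Rightarrow> real" where
  "coeff_norm f = (\<Sum>i\<le>degree f. \<bar>of_int (coeff f i)\<bar>)"

text \<open>
The residues of the coefficients of f: the element of the finite group that stands for f.
\<close>

definition reduce :: "nat \<Rightarrow> nat \<Rightarrow> int poly \<Rightarrow> nat \<Rightarrow> nat" where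
  "reduce n N f = (\<lambda>i\<in>{..<n}. nat (coeff f i mod int N))"

lemma reduce_in: "N > 0 \<Longrightarrow> reduce n N f \<in> cyc n N"
  by (auto simp: reduce_def cyc_def nat_less_iff)

text \<open>
A character of the finite group is a character of all integer polynomials with frequencies
t i / N. This exact identity makes the limit of such characters additive.
\<close>

lemma cyc_char_reduce:
  assumes N: "N > 0" and f: "degree f < n"
  shows "cyc_char n N t (reduce n N f)
    = ec (lin (\<lambda>i. if i < n then of_nat (t i) / of_nat N else 0) f)"
proof -
  let ?\<theta> = "\<lambda>i. if i < n then of_nat (t i) / of_nat N else (0::real)"
  have "lin ?\<theta> f = (\<Sum>i\<le>n. of_int (coeff f i) * ?\<theta> i)" by (rule lin_eq) (use f in auto)
  also have "\<dots> = (\<Sum>i<n. of_int (coeff f i) * (of_nat (t i) / of_nat N))"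
    by (simp add: lessThan_Suc_atMost[symmetric])
  finally have lin: "lin ?\<theta> f = \<dots>" .
  show ?thesis
    unfolding cyc_char_def lin
  proof (rule ec_eq_if)
    have "of_nat (t i) * of_nat (reduce n N f i) / of_nat N - of_int (coeff f i) * (of_nat (t i) / of_nat N)
       \<in> (\<int>::real set)" if "i < n" for i
    proof -
      have "real (reduce n N f i) = of_int (coeff f i mod int N)"
        using that N by (simp add: reduce_def)
      also have "\<dots> = of_int (coeff f i) - real N * of_int (coeff f i div int N)"
        by (simp add: minus_mult_div_eq_mod[symmetric])
      finally have "of_nat (t i) * of_nat (reduce n N f i) / of_nat N - of_int (coeff f i) * (of_nat (t i) / of_nat N)
        = - (real (t i) * of_int (coeff f i div int N))"
        using N by (simp add: diff_divide_distrib right_diff_distrib)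
      also have "\<dots> \<in> \<int>" by simp
      finally show ?thesis .
    qed
    then show "(\<Sum>i<n. of_nat (t i) * of_nat (reduce n N f i) / of_nat N) -
      (\<Sum>i<n. of_int (coeff f i) * (of_nat (t i) / of_nat N)) \<in> (\<int>::real set)"
      unfolding sum_subtractf[symmetric] by (intro Ints_sum) auto
  qed
qed

lemma rho_reduce:
  assumes N: "N > 0" and f: "degree f < n" and small: "\<And>i. i < n \<Longrightarrow> \<rho> (monom (int N) i) \<le> \<eta>"
    and "0 \<le> \<eta>"
  shows "\<rho> (f - combo n (reduce n N f)) \<le> coeff_norm f * \<eta>"
proof -
  obtain m where m: "n = Suc m" using f by (cases n) auto
  have "f = (\<Sum>i\<le>m. monom (coeff f i) i)"
    using poly_as_sum_of_monoms'[of f m] f m by simp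
  then have feq: "f = (\<Sum>i<n. monom (coeff f i) i)" by (simp add: m lessThan_Suc_atMost)
  have "f - combo n (reduce n N f) = (\<Sum>i<n. monom (coeff f i) i - monom (int (reduce n N f i)) i)"
    unfolding combo_def sum_subtractf using feq by simp
  also have "\<dots> = (\<Sum>i<n. smult (coeff f i div int N) (monom (int N) i))"
    using N by (intro sum.cong) (auto simp: reduce_def diff_monom smult_monom minus_mod_eq_div_mult)
  also have "\<rho> \<dots> \<le> (\<Sum>i<n. \<rho> (smult (coeff f i div int N) (monom (int N) i)))"
    by (rule rho_sum)
  also have "\<dots> \<le> (\<Sum>i<n. \<bar>of_int (coeff f i)\<bar> * \<eta>)"
  proof (rule sum_mono)
    fix i assume "i \<in> {..<n}"
    have "\<rho> (smult (coeff f i div int N) (monom (int N) i))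
      \<le> \<bar>of_int (coeff f i div int N)\<bar> * \<rho> (monom (int N) i)" by (rule rho_smult)
    also have "\<dots> \<le> \<bar>of_int (coeff f i)\<bar> * \<eta>"
    proof (intro mult_mono)
      have "\<bar>coeff f i div int N\<bar> \<le> \<bar>coeff f i\<bar>" 
      proof (cases "coeff f i \<ge> 0")
        case True
        then show ?thesis using N zdiv_mono2[of "coeff f i" 1 "int N"] by (simp add: pos_imp_zdiv_nonneg_iff)
      next
        case False
        then show ?thesis using N zdiv_mono2_neg[of "coeff f i" 1 "int N"]
          div_neg_pos_less0[of "coeff f i" "int N"] by simp
      qed
      then show "\<bar>of_int (coeff f i div int N)\<bar> \<le> \<bar>of_int (coeff f i) :: real\<bar>"
        by (simp only: of_int_abs[symmetric] of_int_le_iff)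
    qed (use small \<open>i \<in> {..<n}\<close> rho_nonneg in auto)
    finally show "\<rho> (smult (coeff f i div int N) (monom (int N) i)) \<le> \<bar>of_int (coeff f i)\<bar> * \<eta>" .
  qed
  also have "\<dots> = (\<Sum>i<n. \<bar>of_int (coeff f i)\<bar>) * \<eta>" by (simp add: sum_distrib_right)
  also have "(\<Sum>i<n. \<bar>of_int (coeff f i)\<bar>) = coeff_norm f"
    unfolding coeff_norm_def using f
    by (intro sum.mono_neutral_right) (auto simp: coeff_eq_0)
  finally show ?thesis .
qed

text \<open>
The constant \<kappa> depends only on the sizes of finite nets, so one value serves all h and all
finite approximations. Characters with frequencies in [0, 1] have a pointwise convergent
subsequence, and both estimates survive in the limit.
\<close>

theorem separating_character:
  shows "\<exists>\<kappa>>0. \<forall>h. \<rho> h = 1 \<longrightarrow>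
    (\<exists>\<theta>. (\<forall>f. \<kappa> * norm (ec (lin \<theta> f) - 1) \<le> 2 * \<rho> f) \<and> \<kappa> \<le> norm (ec (lin \<theta> h) - 1))"
proof -
  obtain X where X: "finite X" "\<And>f. \<exists>x\<in>X. \<rho> (f - x) \<le> 1/32"
    using totally_bounded[of "1/32"] by auto
  define d :: real where "d = 1 / card X"
  have "X \<noteq> {}" using X(2) by auto
  then have d0: "0 < d" using X by (simp add: d_def card_gt_0_iff)
  obtain Y where Y: "finite Y" "\<And>f. \<exists>x\<in>Y. \<rho> (f - x) \<le> d/64"
    using totally_bounded[of "d/64"] d0 by auto
  have "Y \<noteq> {}" using Y(2) by auto
  then have cY: "card Y > 0" using Y by (simp add: card_gt_0_iff)
  define \<kappa> where "\<kappa> = sqrt ((d/4)\<^sup>2 / card Y)"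
  have k0: "\<kappa> > 0" using d0 cY by (simp add: \<kappa>_def)
  show ?thesis
  proof (intro exI[of _ \<kappa>] conjI k0 allI impI)
    fix h assume h: "\<rho> h = 1"
    \<comment> \<open>In the j-th approximation, with j components, \<eta> j bounds the multiples by N of single monomials
      and \<tau> j bounds the total error.\<close>
    define \<tau> where "\<tau> j = 1 / (real j + 1)" for j
    define \<eta> where "\<eta> j = \<tau> j * \<tau> j" for j
    have eta: "\<eta> j > 0" "real j * \<eta> j \<le> \<tau> j" "\<eta> j \<le> \<tau> j" for j
    proof -
      have t: "0 < \<tau> j" "\<tau> j \<le> 1" "real j * \<tau> j \<le> 1" by (auto simp: \<tau>_def field_simps)
      show "\<eta> j > 0" using t by (simp add: \<eta>_def)
      show "real j * \<eta> j \<le> \<tau> j" using mult_right_mono[OF t(3), of "\<tau> j"] t by (simp add: \<eta>_def)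
      show "\<eta> j \<le> \<tau> j" using mult_right_mono[OF t(2), of "\<tau> j"] t by (simp add: \<eta>_def)
    qed
    have tau_lim: "\<tau> \<longlonglongrightarrow> 0"
      unfolding \<tau>_def using LIMSEQ_inverse_real_of_nat by (simp add: inverse_eq_divide add.commute)
    have "\<forall>j. \<exists>N. N > 0 \<and> (\<forall>i<j. \<rho> (monom (int N) i) \<le> \<eta> j)"
      using ex_small_multiple[OF eta(1)] by blast
    then obtain N where N: "\<And>j. N j > 0" "\<And>j i. i < j \<Longrightarrow> \<rho> (monom (int (N j)) i) \<le> \<eta> j"
      by metis
    interpret H: almost_hom "cyc j (N j)" "cyc j (N j)" "cyc_char j (N j)" "cyc_add j (N j)"
      \<rho> "combo j" "\<tau> j" for j
      by (rule combo_almost_hom[OF N(1) N(2) eta(2)])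
    define S where "S j t = (\<Sum>a\<in>cyc j (N j). complex_of_real (\<rho> (combo j a) - \<rho> (combo j a + h)) * cyc_char j (N j) t a)" for j t
    define c where "c j = real (card (cyc j (N j)))" for j
    have c0: "c j > 0" for j unfolding c_def using H.finA[of j] H.A_ne[of j] by (simp add: card_gt_0_iff)
    have "\<exists>t\<in>cyc j (N j). \<tau> j \<le> d/64 \<longrightarrow> \<kappa> * c j \<le> norm (S j t)" for j
    proof (cases "\<tau> j \<le> d/64")
      case True
      from H.large_coefficient[OF X d_def Y True h]
      obtain t where t: "t \<in> cyc j (N j)" "(d/4)\<^sup>2 / card Y * (c j)\<^sup>2 \<le> (norm (S j t))\<^sup>2"
        unfolding S_def c_def by auto
      have "(\<kappa> * c j)\<^sup>2 \<le> (norm (S j t))\<^sup>2"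
        using t(2) unfolding power_mult_distrib \<kappa>_def by simp
      then have "\<kappa> * c j \<le> norm (S j t)" by (rule power2_le_imp_le) simp
      then show ?thesis using t(1) by auto
    next
      case False
      then show ?thesis using H.A_ne[of j] by auto
    qed
    then obtain t where t: "\<And>j. t j \<in> cyc j (N j)" "\<And>j. \<tau> j \<le> d/64 \<Longrightarrow> \<kappa> * c j \<le> norm (S j (t j))"
      by metis
    define \<theta> where "\<theta> j i = (if i < j then of_nat (t j i) / of_nat (N j) else (0::real))" for j i
    have unit: "0 \<le> \<theta> j i \<and> \<theta> j i \<le> 1" for j i
    proof -
      have "i < j \<Longrightarrow> t j i < N j" using t(1)[of j] by (auto simp: cyc_def PiE_iff)
      then show ?thesis by (auto simp: \<theta>_def)
    qed
    have ev_tau: "\<forall>\<^sub>F j in sequentially. \<tau> j \<le> d/64"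
      using order_tendstoD(2)[OF tau_lim, of "d/64"] d0 by (auto elim: eventually_mono)
    have err: "\<rho> (f - combo j (reduce j (N j) f)) \<le> coeff_norm f * \<tau> j" if "degree f < j" for f j
    proof -
      have "\<rho> (f - combo j (reduce j (N j) f)) \<le> coeff_norm f * \<eta> j"
        by (rule rho_reduce[OF N(1) that N(2)]) (use eta(1)[of j] in auto)
      also have "\<dots> \<le> coeff_norm f * \<tau> j"
        by (intro mult_left_mono eta) (simp add: coeff_norm_def sum_nonneg)
      finally show ?thesis .
    qed
    have small: "\<forall>\<^sub>F j in sequentially. \<kappa> * norm (ec (lin (\<theta> j) f) - 1)
      \<le> 2 * (\<rho> f + (coeff_norm f + 1) * \<tau> j)" for f
      using ev_tau eventually_gt_at_top[of "degree f"]
    proof eventually_elim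
      case (elim j)
      let ?b = "reduce j (N j) f"
      have b: "?b \<in> cyc j (N j)" by (rule reduce_in[OF N(1)])
      have E: "cyc_char j (N j) (t j) ?b = ec (lin (\<theta> j) f)"
        unfolding \<theta>_def by (rule cyc_char_reduce[OF N(1) elim(2)])
      have "\<rho> (combo j ?b) \<le> \<rho> f + coeff_norm f * \<tau> j"
        using rho_diff[of f "f - combo j ?b"] err[OF elim(2)] by simp
      then have "(\<rho> (combo j ?b) + \<tau> j) \<le> \<rho> f + (coeff_norm f + 1) * \<tau> j"
        by (simp add: algebra_simps)
      then have le: "2 * (\<rho> (combo j ?b) + \<tau> j) * c j \<le> 2 * (\<rho> f + (coeff_norm f + 1) * \<tau> j) * c j"
        using c0[of j] by (intro mult_right_mono) auto
      have "\<kappa> * norm (ec (lin (\<theta> j) f) - 1) * c j = \<kappa> * c j * norm (ec (lin (\<theta> j) f) - 1)" by simp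
      also have "\<dots> \<le> norm (S j (t j)) * norm (ec (lin (\<theta> j) f) - 1)"
        by (intro mult_right_mono t elim) auto
      also have "\<dots> \<le> 2 * (\<rho> (combo j ?b) + \<tau> j) * c j"
        using H.character_small[OF t(1) b, of h] unfolding S_def c_def E .
      also note le
      finally show ?case using c0[of j] by (simp add: mult_le_cancel_right)
    qed
    have big: "\<forall>\<^sub>F j in sequentially. \<kappa> \<le> norm (ec (lin (\<theta> j) h) - 1) + (coeff_norm h + 1) * \<tau> j"
      using ev_tau eventually_gt_at_top[of "degree h"]
    proof eventually_elim
      case (elim j)
      let ?b = "reduce j (N j) h"
      have b: "?b \<in> cyc j (N j)" by (rule reduce_in[OF N(1)])
      have E: "cyc_char j (N j) (t j) ?b = ec (lin (\<theta> j) h)"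
        unfolding \<theta>_def by (rule cyc_char_reduce[OF N(1) elim(2)])
      have "\<kappa> * c j \<le> norm (S j (t j))" by (rule t(2)[OF elim(1)])
      also have "\<dots> \<le> (norm (ec (lin (\<theta> j) h) - 1) + coeff_norm h * \<tau> j + \<tau> j) * c j"
        using H.coefficient_bound[OF t(1) b err[OF elim(2)]] unfolding S_def c_def E .
      finally have "\<kappa> \<le> norm (ec (lin (\<theta> j) h) - 1) + coeff_norm h * \<tau> j + \<tau> j"
        using c0[of j] by (simp add: mult_le_cancel_right)
      then show ?case by (simp add: algebra_simps)
    qed
    obtain l r where lr: "strict_mono r" "\<And>i. (\<lambda>j. \<theta> (r j) i) \<longlonglongrightarrow> l i"
      using ex_convergent_subsequence_unit_interval[of \<theta>] unit by blast
    have lin_lim: "(\<lambda>j. norm (ec (lin (\<theta> (r j)) f) - 1)) \<longlonglongrightarrow> norm (ec (lin l f) - 1)" for f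
    proof -
      have "(\<lambda>j. lin (\<theta> (r j)) f) \<longlonglongrightarrow> lin l f"
        unfolding lin_def by (intro tendsto_intros lr)
      from isCont_tendsto_compose[OF continuous_ec this]
      show ?thesis by (intro tendsto_intros)
    qed
    have tau_r: "(\<lambda>j. \<tau> (r j)) \<longlonglongrightarrow> 0"
      using LIMSEQ_subseq_LIMSEQ[OF tau_lim lr(1)] by (simp add: o_def)
    show "\<exists>\<theta>. (\<forall>f. \<kappa> * norm (ec (lin \<theta> f) - 1) \<le> 2 * \<rho> f) \<and> \<kappa> \<le> norm (ec (lin \<theta> h) - 1)"
    proof (intro exI[of _ l] conjI allI)
      fix f
      have "(\<lambda>j. 2 * (\<rho> f + (coeff_norm f + 1) * \<tau> (r j))) \<longlonglongrightarrow> 2 * (\<rho> f + (coeff_norm f + 1) * 0)"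
        by (intro tendsto_intros tau_r)
      moreover have "(\<lambda>j. \<kappa> * norm (ec (lin (\<theta> (r j)) f) - 1)) \<longlonglongrightarrow> \<kappa> * norm (ec (lin l f) - 1)"
        by (intro tendsto_intros lin_lim)
      moreover have "\<forall>\<^sub>F j in sequentially. \<kappa> * norm (ec (lin (\<theta> (r j)) f) - 1)
          \<le> 2 * (\<rho> f + (coeff_norm f + 1) * \<tau> (r j))"
        using eventually_subseq[OF lr(1) small[of f]] .
      ultimately have "\<kappa> * norm (ec (lin l f) - 1) \<le> 2 * (\<rho> f + (coeff_norm f + 1) * 0)"
        by (rule tendsto_le[OF sequentially_bot])
      then show "\<kappa> * norm (ec (lin l f) - 1) \<le> 2 * \<rho> f" by simp
    next
      have "(\<lambda>j. norm (ec (lin (\<theta> (r j)) h) - 1) + (coeff_norm h + 1) * \<tau> (r j))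
          \<longlonglongrightarrow> norm (ec (lin l h) - 1) + (coeff_norm h + 1) * 0"
        by (intro tendsto_intros tau_r lin_lim)
      moreover have "\<forall>\<^sub>F j in sequentially. \<kappa> \<le> norm (ec (lin (\<theta> (r j)) h) - 1) + (coeff_norm h + 1) * \<tau> (r j)"
        using eventually_subseq[OF lr(1) big] .
      ultimately have "\<kappa> \<le> norm (ec (lin l h) - 1) + (coeff_norm h + 1) * 0"
        by (intro tendsto_le[OF sequentially_bot _ tendsto_const])
      then show "\<kappa> \<le> norm (ec (lin l h) - 1)" by simp
    qed
  qed
qed

end

section \<open>Pseudonorms from neighbourhoods\<close>

text \<open>
The cut is made at the entry where the partial sums first exceed half of the total.
\<close>

lemma prefix_half_weight:
  fixes w :: "'b \<Rightarrow> real"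
  assumes pos: "\<And>x. x \<in> set L \<Longrightarrow> 0 < w x" and ne: "L \<noteq> []"
  shows "\<exists>L1 p L2. L = L1 @ p # L2 \<and> 2 * sum_list (map w L1) \<le> sum_list (map w L)
    \<and> 2 * sum_list (map w L2) \<le> sum_list (map w L)"
proof -
  let ?s = "\<lambda>M. sum_list (map w M)"
  have "0 \<le> ?s (tl L)" by (rule sum_list_nonneg) (use pos ne in \<open>auto dest!: list.set_sel(2)[OF ne] intro: less_imp_le\<close>)
  moreover have "0 < w (hd L)" using pos ne by simp
  ultimately have "0 < ?s L" using ne by (cases L) auto
  then have ex: "?s L < 2 * ?s (take (length L) L)" by simp
  define m where "m = (LEAST m. ?s L < 2 * ?s (take m L))"
  have m: "?s L < 2 * ?s (take m L)" unfolding m_def by (rule LeastI[of _ "length L"]) (use ex in simp)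
  have m0: "m > 0" using m \<open>0 < ?s L\<close> by (cases m) auto
  have mlen: "m \<le> length L" unfolding m_def by (rule Least_le) (use ex in simp)
  obtain j where j: "m = Suc j" using m0 by (cases m) auto
  have "\<not> ?s L < 2 * ?s (take j L)"
    using not_less_Least[of j "\<lambda>m. ?s L < 2 * ?s (take m L)"] j unfolding m_def by simp
  moreover have "L = take j L @ L ! j # drop m L" using j mlen by (simp add: id_take_nth_drop)
  moreover have "?s L = ?s (take m L) + ?s (drop m L)"
    by (metis append_take_drop_id map_append sum_list_append)
  ultimately show ?thesis using m by (intro exI[of _ "take j L"] exI[of _ "L ! j"] exI[of _ "drop m L"]) auto
qed

text \<open>
The metrization argument of Birkhoff and Kakutani: the value at x is the least total weight of a
representation of x as a sum, where an element of v n is charged 2^(-n). A sum of total weight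
less than 2^(-k) lies in v k, because it can be cut into two parts of at most half the weight
and one further summand, each of which lies in v (k + 1) by induction.
\<close>

lemma birkhoff_kakutani_pseudonorm:
  fixes v :: "nat \<Rightarrow> 'h::ab_group_add set"
  assumes zero: "\<And>n. 0 \<in> v n" and sym: "\<And>n x. x \<in> v n \<Longrightarrow> - x \<in> v n"
    and sum3: "\<And>n x y z. \<lbrakk>x \<in> v (Suc n); y \<in> v (Suc n); z \<in> v (Suc n)\<rbrakk> \<Longrightarrow> x + y + z \<in> v n"
  shows "\<exists>\<rho>. bounded_pseudonorm \<rho> \<and> (\<forall>n. \<forall>x\<in>v n. \<rho> x \<le> (1/2) ^ n) \<and> (\<forall>x. \<rho> x < 1 \<longrightarrow> x \<in> v 0)"
proof -
  define wt :: "(nat \<times> 'h) list \<Rightarrow> real" where "wt L = sum_list (map (\<lambda>p. (1/2) ^ fst p) L)" for L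
  define tot :: "(nat \<times> 'h) list \<Rightarrow> 'h" where "tot L = sum_list (map snd L)" for L
  define ok where "ok L \<longleftrightarrow> (\<forall>p\<in>set L. snd p \<in> v (fst p))" for L
  have app: "wt (L @ M) = wt L + wt M" "tot (L @ M) = tot L + tot M" "ok (L @ M) \<longleftrightarrow> ok L \<and> ok M" for L M
    by (auto simp: wt_def tot_def ok_def)
  have wt0: "0 \<le> wt L" for L unfolding wt_def by (rule sum_list_nonneg) auto
  have dec1: "v (Suc n) \<subseteq> v n" for n using sum3[of _ n 0 0] zero by auto
  have dec: "v n \<subseteq> v m" if "m \<le> n" for m n using dec1 that by (rule lift_Suc_antimono_le[of v])
  have key: "wt L < (1/2) ^ k \<Longrightarrow> ok L \<Longrightarrow> tot L \<in> v k" for L k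
  proof (induction "length L" arbitrary: L k rule: less_induct)
    case less
    show ?case
    proof (cases "L = []")
      case True
      then show ?thesis using zero by (simp add: tot_def)
    next
      case False
      have "\<exists>L1 p L2. L = L1 @ p # L2 \<and> 2 * wt L1 \<le> wt L \<and> 2 * wt L2 \<le> wt L"
        unfolding wt_def by (rule prefix_half_weight[OF _ False]) simp
      then obtain L1 p L2 where L: "L = L1 @ p # L2" "2 * wt L1 \<le> wt L" "2 * wt L2 \<le> wt L" by blast
      have okL: "ok L1" "ok L2" "snd p \<in> v (fst p)" using less.prems(2) unfolding L(1) by (auto simp: ok_def)
      have wtL: "wt L = wt L1 + (1/2) ^ fst p + wt L2" unfolding L(1) by (simp add: wt_def)
      have "tot L1 \<in> v (Suc k)" by (rule less.hyps) (use L less.prems okL in auto)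
      moreover have "tot L2 \<in> v (Suc k)" by (rule less.hyps) (use L less.prems okL in auto)
      moreover have "snd p \<in> v (Suc k)"
      proof -
        have "(1/2::real) ^ fst p < (1/2) ^ k" using wtL wt0[of L1] wt0[of L2] less.prems(1) by linarith
        then have "k < fst p" using power_decreasing_iff[of "1/2::real" k "fst p"]
          power_decreasing_iff[of "1/2::real" "fst p" k] by linarith
        then show ?thesis using okL(3) dec[of "Suc k" "fst p"] by auto
      qed
      ultimately have "tot L1 + snd p + tot L2 \<in> v k" by (intro sum3)
      then show ?thesis unfolding L(1) by (simp add: tot_def add.assoc)
    qed
  qed
  define S where "S x = insert 1 {wt L | L. ok L \<and> tot L = x}" for x
  define \<rho> where "\<rho> x = Inf (S x)" for x
  have bdd: "bdd_below (S x)" for x by (rule bdd_belowI[of _ 0]) (auto simp: S_def wt0)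
  have ne: "S x \<noteq> {}" for x by (auto simp: S_def)
  have le: "\<rho> x \<le> wt L" if "ok L" "tot L = x" for x L
    unfolding \<rho>_def by (rule cInf_lower[OF _ bdd]) (use that in \<open>auto simp: S_def\<close>)
  have le1: "\<rho> x \<le> 1" for x
    unfolding \<rho>_def by (rule cInf_lower[OF _ bdd]) (auto simp: S_def)
  have ge0: "0 \<le> \<rho> x" for x
    unfolding \<rho>_def by (rule cInf_greatest[OF ne]) (auto simp: S_def wt0)
  have approx: "\<exists>L. ok L \<and> tot L = x \<and> wt L < c" if lt: "\<rho> x < c" "c \<le> 1" for x c
  proof -
    obtain s where "s \<in> S x" "s < c" using cInf_lessD[OF ne, of x c] lt(1) unfolding \<rho>_def by blast
    then show ?thesis using lt by (auto simp: S_def)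
  qed
  have minus_le: "\<rho> (- x) \<le> \<rho> x" for x
  proof (rule ccontr)
    assume "\<not> ?thesis"
    then obtain L where L: "ok L" "tot L = x" "wt L < \<rho> (- x)" using approx[of x "\<rho> (-x)"] le1 by auto
    let ?M = "map (\<lambda>p. (fst p, - snd p)) L"
    have "ok ?M" using L(1) sym by (auto simp: ok_def)
    moreover have "tot ?M = - tot L" by (induction L) (auto simp: tot_def)
    moreover have "wt ?M = wt L" by (simp add: wt_def o_def)
    ultimately show False using le[of ?M "- x"] L by simp
  qed
  have "bounded_pseudonorm \<rho>"
  proof
    show "\<rho> 0 = 0" using le[of "[]" 0] ge0[of 0] by (simp add: ok_def tot_def wt_def)
    fix x y
    show "\<rho> (- x) = \<rho> x" using minus_le[of x] minus_le[of "- x"] by simp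
    show "\<rho> x \<le> 1" by (rule le1)
    show "\<rho> (x + y) \<le> \<rho> x + \<rho> y"
    proof (rule ccontr)
      assume n: "\<not> ?thesis"
      define e where "e = (\<rho> (x + y) - \<rho> x - \<rho> y) / 2"
      have e: "0 < e" "\<rho> x + e + (\<rho> y + e) = \<rho> (x + y)" using n by (auto simp: e_def field_simps)
      have "\<rho> x + e \<le> 1" "\<rho> y + e \<le> 1" using e le1[of "x + y"] ge0[of x] ge0[of y] by linarith+
      then obtain L M where LM: "ok L" "tot L = x" "wt L < \<rho> x + e" "ok M" "tot M = y" "wt M < \<rho> y + e"
        using approx[of x "\<rho> x + e"] approx[of y "\<rho> y + e"] e by auto
      then have "\<rho> (x + y) \<le> wt (L @ M)" by (intro le) (auto simp: app)
      then show False using LM e by (simp add: app)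
    qed
  qed
  moreover have "\<rho> x \<le> (1/2) ^ n" if "x \<in> v n" for n x
    using le[of "[(n, x)]" x] that by (simp add: ok_def tot_def wt_def)
  moreover have "x \<in> v 0" if "\<rho> x < 1" for x
    using approx[OF that] key[of _ 0] by auto
  ultimately show ?thesis by auto
qed

section \<open>Increasing sequences of subgroups\<close>

definition subgrp :: "'a::ab_group_add set \<Rightarrow> bool" where
  "subgrp S \<longleftrightarrow> 0 \<in> S \<and> (\<forall>a\<in>S. \<forall>b\<in>S. a - b \<in> S)"

lemma subgrp_zero: "subgrp S \<Longrightarrow> 0 \<in> S" by (simp add: subgrp_def)
lemma subgrp_diff: "subgrp S \<Longrightarrow> a \<in> S \<Longrightarrow> b \<in> S \<Longrightarrow> a - b \<in> S" by (simp add: subgrp_def)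
lemma subgrp_minus: "subgrp S \<Longrightarrow> a \<in> S \<Longrightarrow> - a \<in> S"
  using subgrp_diff[of S 0 a] by (simp add: subgrp_zero)
lemma subgrp_add: "subgrp S \<Longrightarrow> a \<in> S \<Longrightarrow> b \<in> S \<Longrightarrow> a + b \<in> S"
  using subgrp_diff[of S a "-b"] by (simp add: subgrp_minus)
lemma subgrp_of_nat: "subgrp S \<Longrightarrow> a \<in> S \<Longrightarrow> of_nat k * a \<in> S" for a :: "'a::comm_ring_1"
  by (induction k) (auto simp: subgrp_zero subgrp_add algebra_simps)
lemma subgrp_of_int: "subgrp S \<Longrightarrow> a \<in> S \<Longrightarrow> of_int k * a \<in> S" for a :: "'a::comm_ring_1"
  by (cases k) (auto simp: subgrp_of_nat subgrp_minus simp del: of_nat_Suc of_int_minus 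
      simp: of_int_minus[of "int _"] mult_minus_left)

text \<open>
Zorn's lemma gives a maximal increasing sequence of subgroups \<Lambda> n that adds no elements of the
union of the C m to C n. If some \<psi> were outside the union of the \<Lambda> n, the multiples of
\<psi> inside this union would all lie in one \<Lambda> m, since they are multiples of a single one of
them. Then \<psi> could be added to \<Lambda> n for all n \<ge> m without new elements of the C m
appearing, contrary to maximality. If the C n increase strictly, all \<Lambda> n are proper subgroups
of \<Gamma>. The elements live in a ring so that integer multiples are products.
\<close>

lemma extend_chain_of_subgroups:
  fixes \<Gamma> :: "'a::comm_ring_1 set"
  assumes \<Gamma>: "subgrp \<Gamma>" and C: "\<And>n. subgrp (C n)" "\<And>n. C n \<subseteq> \<Gamma>" "\<And>n. C n \<subseteq> C (Suc n)"
  shows "\<exists>\<Lambda>. (\<forall>n::nat. subgrp (\<Lambda> n) \<and> C n \<subseteq> \<Lambda> n \<and> \<Lambda> n \<subseteq> \<Lambda> (Suc n) \<and> \<Lambda> n \<inter> (\<Union>m. C m) \<subseteq> C n)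
      \<and> (\<Union>n. \<Lambda> n) = \<Gamma>"
proof -
  \<comment> \<open>A sequence of sets is encoded as one set of pairs, so that sequences are ordered by inclusion.\<close>
  define sec where "sec R n = {a. (a, n) \<in> R}" for R :: "('a \<times> nat) set" and n
  define good where "good R \<longleftrightarrow> (\<forall>n. subgrp (sec R n) \<and> sec R n \<subseteq> \<Gamma> \<and> C n \<subseteq> sec R n
      \<and> sec R n \<subseteq> sec R (Suc n) \<and> sec R n \<inter> (\<Union>m. C m) \<subseteq> C n)" for R
  define R0 where "R0 = {(a, n). a \<in> C n}"
  have "sec R0 n = C n" for n by (auto simp: R0_def sec_def)
  then have "good R0" using C by (auto simp: good_def)
  have "\<exists>M\<in>Collect good. \<forall>X\<in>Collect good. M \<subseteq> X \<longrightarrow> X = M"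
  proof (rule subset_Zorn_nonempty)
    show "Collect good \<noteq> {}" using \<open>good R0\<close> by auto
    fix \<C> assume ne: "\<C> \<noteq> {}" and ch: "subset.chain (Collect good) \<C>"
    then have g: "good R" if "R \<in> \<C>" for R using that by (auto simp: subset_chain_def)
    have sec: "sec (\<Union>\<C>) n = (\<Union>R\<in>\<C>. sec R n)" for n by (auto simp: sec_def)
    have "good (\<Union>\<C>)" unfolding good_def
    proof (intro allI conjI)
      fix n
      show "subgrp (sec (\<Union>\<C>) n)" unfolding subgrp_def
      proof (intro conjI ballI)
        show "0 \<in> sec (\<Union>\<C>) n" using ne g unfolding sec good_def by (auto simp: subgrp_zero)
        fix a b assume "a \<in> sec (\<Union>\<C>) n" "b \<in> sec (\<Union>\<C>) n"
        then obtain R R' where R: "R \<in> \<C>" "a \<in> sec R n" "R' \<in> \<C>" "b \<in> sec R' n" unfolding sec by auto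
        then have "R \<subseteq> R' \<or> R' \<subseteq> R" using ch by (auto simp: subset_chain_def)
        then obtain Q where "Q \<in> \<C>" "a \<in> sec Q n" "b \<in> sec Q n" using R by (auto simp: sec_def)
        then show "a - b \<in> sec (\<Union>\<C>) n" using g unfolding sec good_def by (auto intro: subgrp_diff)
      qed
      have gn: "sec R n \<subseteq> \<Gamma>" "C n \<subseteq> sec R n" "sec R n \<subseteq> sec R (Suc n)"
        "sec R n \<inter> (\<Union>m. C m) \<subseteq> C n" if "R \<in> \<C>" for R
        using g[OF that] unfolding good_def by auto
      show "sec (\<Union>\<C>) n \<subseteq> \<Gamma>" unfolding sec by (rule UN_least) (rule gn(1))
      obtain R where "R \<in> \<C>" using ne by auto
      then show "C n \<subseteq> sec (\<Union>\<C>) n" using gn(2) unfolding sec by auto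
      show "sec (\<Union>\<C>) n \<subseteq> sec (\<Union>\<C>) (Suc n)" unfolding sec by (rule UN_mono) (use gn in auto)
      show "sec (\<Union>\<C>) n \<inter> (\<Union>m. C m) \<subseteq> C n" unfolding sec Int_UN_distrib2
        using gn(4) by (auto simp del: UN_iff)
    qed
    then show "\<Union>\<C> \<in> Collect good" by simp
  qed
  then obtain M where M: "good M" and max: "\<And>X. good X \<Longrightarrow> M \<subseteq> X \<Longrightarrow> X = M" by auto
  have sub: "subgrp (sec M n)" and Ms: "sec M n \<subseteq> \<Gamma>" "C n \<subseteq> sec M n" "sec M n \<subseteq> sec M (Suc n)"
    "sec M n \<inter> (\<Union>m. C m) \<subseteq> C n" for n
    using M unfolding good_def by auto
  have mono: "sec M m \<subseteq> sec M n" if "m \<le> n" for m n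
    using Ms(3) that by (rule lift_Suc_mono_le[of "sec M"])
  let ?P = "\<Union>n. sec M n"
  have P: "subgrp ?P" unfolding subgrp_def
  proof (intro conjI ballI)
    show "0 \<in> ?P" using sub by (auto simp: subgrp_zero)
    fix a b assume "a \<in> ?P" "b \<in> ?P"
    then obtain m n where mn: "a \<in> sec M m" "b \<in> sec M n" by auto
    then have "a \<in> sec M (max m n)" "b \<in> sec M (max m n)"
      using mono[of m "max m n"] mono[of n "max m n"] by auto
    then show "a - b \<in> ?P" using sub by (blast intro: subgrp_diff)
  qed
  have "\<Gamma> \<subseteq> ?P"
  proof
    fix \<psi> assume \<psi>: "\<psi> \<in> \<Gamma>"
    show "\<psi> \<in> ?P"
    proof (rule ccontr)
      assume notin: "\<psi> \<notin> ?P"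
      have "\<exists>m. \<forall>l. of_int l * \<psi> \<in> ?P \<longrightarrow> of_int l * \<psi> \<in> sec M m"
      proof (cases "\<exists>k>0. of_nat k * \<psi> \<in> ?P")
        case False
        have "l = 0" if "of_int l * \<psi> \<in> ?P" for l
        proof (rule ccontr)
          assume "l \<noteq> 0"
          have "of_nat (nat \<bar>l\<bar>) * \<psi> \<in> ?P"
            using that subgrp_minus[OF P that] by (cases "l \<ge> 0") auto
          then show False using False \<open>l \<noteq> 0\<close> by (metis zero_less_nat_eq zero_less_abs_iff)
        qed
        then show ?thesis using subgrp_zero[OF sub[of 0]] by (intro exI[of _ 0]) fastforce
      next
        case True
        define k where "k = (LEAST k. k > 0 \<and> of_nat k * \<psi> \<in> ?P)"
        have k: "k > 0" "of_nat k * \<psi> \<in> ?P"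
          using LeastI_ex[OF True] unfolding k_def by auto
        then obtain m where m: "of_nat k * \<psi> \<in> sec M m" by auto
        have "of_int l * \<psi> \<in> sec M m" if l: "of_int l * \<psi> \<in> ?P" for l
        proof -
          have split: "of_int l * \<psi> = of_int (l div int k) * (of_nat k * \<psi>) + of_nat (nat (l mod int k)) * \<psi>"
          proof -
            have "of_int l = (of_int (l div int k * int k + l mod int k) :: 'a)" by simp
            also have "\<dots> = of_int (l div int k) * of_nat k + of_nat (nat (l mod int k))"
              using k(1) by (simp only: of_int_add of_int_mult) simp
            finally show ?thesis by (simp add: algebra_simps)
          qed
          then have "of_nat (nat (l mod int k)) * \<psi> \<in> ?P"
            using subgrp_diff[OF P l subgrp_of_int[OF P k(2), of "l div int k"]] by simp
          moreover have "nat (l mod int k) < k" using k(1) by (simp add: nat_less_iff)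
          ultimately have "nat (l mod int k) = 0"
            using not_less_Least[of "nat (l mod int k)" "\<lambda>k. k > 0 \<and> of_nat k * \<psi> \<in> ?P"]
            unfolding k_def by auto
          then show ?thesis using split subgrp_of_int[OF sub m, of "l div int k"] by simp
        qed
        then show ?thesis by auto
      qed
      then obtain m where m: "\<And>l. of_int l * \<psi> \<in> ?P \<Longrightarrow> of_int l * \<psi> \<in> sec M m" by auto
      define M' where "M' = M \<union> {(a + of_int l * \<psi>, n) | a l n. (a, n) \<in> M \<and> m \<le> n}"
      have lt: "sec M' n = sec M n" if "n < m" for n using that by (auto simp: M'_def sec_def)
      have ge: "sec M' n = {a + of_int l * \<psi> | a l. a \<in> sec M n}" if "m \<le> n" for n
      proof -
        have "a \<in> {a + of_int l * \<psi> | a l. a \<in> sec M n}" if "a \<in> sec M n" for a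
          using that by (intro CollectI exI[of _ a] exI[of _ 0]) auto
        then show ?thesis using \<open>m \<le> n\<close> by (auto simp: M'_def sec_def)
      qed
      have "good M'" unfolding good_def
      proof (intro allI conjI)
        fix n
        have supset: "sec M n \<subseteq> sec M' n" by (auto simp: M'_def sec_def)
        then show "C n \<subseteq> sec M' n" using Ms by blast
        show "subgrp (sec M' n)"
        proof (cases "m \<le> n")
          case True
          show ?thesis unfolding subgrp_def
          proof (intro conjI ballI)
            show "0 \<in> sec M' n" using supset sub by (auto simp: subgrp_zero)
            fix x y assume "x \<in> sec M' n" "y \<in> sec M' n"
            then obtain a l b k where "x = a + of_int l * \<psi>" "a \<in> sec M n" "y = b + of_int k * \<psi>" "b \<in> sec M n"
              unfolding ge[OF True] by auto
            then have "x - y = (a - b) + of_int (l - k) * \<psi>" "a - b \<in> sec M n"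
              using sub by (auto simp: algebra_simps intro: subgrp_diff)
            then show "x - y \<in> sec M' n" unfolding ge[OF True] by blast
          qed
        qed (use sub lt in auto)
        show "sec M' n \<subseteq> \<Gamma>"
        proof (cases "m \<le> n")
          case True
          then show ?thesis unfolding ge[OF True]
            using Ms(1) \<psi> by (auto intro!: subgrp_add[OF \<Gamma>] subgrp_of_int[OF \<Gamma>])
        qed (use lt Ms in auto)
        show "sec M' n \<subseteq> sec M' (Suc n)" using Ms(3)[of n] by (auto simp: M'_def sec_def)
        show "sec M' n \<inter> (\<Union>m. C m) \<subseteq> C n"
        proof (cases "m \<le> n")
          case True
          show ?thesis
          proof
            fix c assume c: "c \<in> sec M' n \<inter> (\<Union>m. C m)"
            then obtain a l where al: "c = a + of_int l * \<psi>" "a \<in> sec M n" unfolding ge[OF True] by auto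
            have "c \<in> ?P" "a \<in> ?P" using c Ms(2) al by blast+
            then have "of_int l * \<psi> \<in> ?P" using subgrp_diff[OF P, of c a] al(1) by simp
            then have "of_int l * \<psi> \<in> sec M n" using m mono[OF True] by blast
            then have "c \<in> sec M n" using al sub by (auto intro: subgrp_add)
            then show "c \<in> C n" using c Ms(4) by blast
          qed
        qed (use lt Ms in auto)
      qed
      moreover have "M \<subseteq> M'" by (auto simp: M'_def)
      ultimately have "M' = M" by (rule max)
      moreover have "\<psi> \<in> sec M' m" unfolding ge[OF order_refl]
        using sub[of m] by (intro CollectI exI[of _ 0] exI[of _ 1]) (auto simp: subgrp_zero)
      ultimately show False using notin by auto
    qed
  qed
  then have "?P = \<Gamma>" using Ms(1) by blast
  then show ?thesis using sub Ms by (intro exI[of _ "sec M"]) blast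
qed

section \<open>Characters continuous for a Bohr topology\<close>

definition additive_map :: "('h::ab_group_add \<Rightarrow> real) \<Rightarrow> bool" where
  "additive_map q \<longleftrightarrow> (\<forall>f g. q (f + g) = q f + q g)"

lemma additive_map_add: "additive_map q \<Longrightarrow> q (f + g) = q f + q g"
  by (simp add: additive_map_def)
lemma additive_map_zero: "additive_map q \<Longrightarrow> q 0 = 0"
  using additive_map_add[of q 0 0] by simp
lemma additive_map_diff: "additive_map q \<Longrightarrow> q (f - g) = q f - q g"
  using additive_map_add[of q "f - g" g] by simp

text \<open>
The basic neighbourhoods of 0 in the topology generated by the characters with exponents in D.
\<close>

definition bohr :: "('h \<Rightarrow> real) set \<Rightarrow> real \<Rightarrow> 'h set" where
  "bohr D \<epsilon> = {f. \<forall>q\<in>D. norm (ec (q f) - 1) < \<epsilon>}"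

lemma norm_ec_sq: "(norm (ec t - 1))\<^sup>2 = 2 - 2 * Re (ec t)"
proof -
  have "(Re (ec t))\<^sup>2 + (Im (ec t))\<^sup>2 = 1"
    using norm_ec[of t] by (simp add: cmod_power2[symmetric] del: norm_ec) 
  then show ?thesis unfolding cmod_power2 by (simp add: power2_eq_square algebra_simps)
qed

definition avg :: "'h::ab_group_add list \<Rightarrow> ('h \<Rightarrow> complex) \<Rightarrow> 'h \<Rightarrow> complex" where
  "avg L u z = (\<Sum>x\<leftarrow>L. u (z + x)) / of_nat (length L)"

text \<open>
Finite averages of translates replace an invariant mean: functions in this class have mean 0 for
every invariant mean, uniformly over all translates.
\<close>

definition averages_to_zero :: "('h::ab_group_add \<Rightarrow> complex) \<Rightarrow> bool" where
  "averages_to_zero u \<longleftrightarrow> (\<forall>\<eta>>0. \<exists>L. L \<noteq> [] \<and> (\<forall>z. norm (avg L u z) \<le> \<eta>))"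

lemma avg_Sum: "avg L u z = (\<Sum>i<length L. u (z + L ! i)) / of_nat (length L)"
  unfolding avg_def by (simp add: sum_list_sum_nth atLeast0LessThan)

lemma avg_add: "avg L (\<lambda>z. u z + v z) z = avg L u z + avg L v z"
  by (simp add: avg_Sum sum.distrib add_divide_distrib)
lemma avg_cmul: "avg L (\<lambda>z. c * u z) z = c * avg L u z"
  by (simp add: avg_Sum sum_distrib_left)
lemma avg_bound: "L \<noteq> [] \<Longrightarrow> (\<And>z. norm (u z) \<le> b) \<Longrightarrow> norm (avg L u z) \<le> b"
proof -
  assume L: "L \<noteq> []" and b: "\<And>z. norm (u z) \<le> b"
  have "norm (\<Sum>i<length L. u (z + L ! i)) \<le> (\<Sum>i<length L. b)" by (rule sum_norm_le) (rule b)
  then show ?thesis using L by (simp add: avg_Sum norm_divide field_simps)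
qed
lemma avg_commute: "avg L (avg M u) z = avg M (avg L u) z"
proof -
  have "avg L (avg M u) z = (\<Sum>i<length L. \<Sum>j<length M. u (z + L ! i + M ! j)) / (of_nat (length L) * of_nat (length M))"
    by (simp add: avg_Sum sum_divide_distrib[symmetric] mult.commute)
  also have "\<dots> = avg M (avg L u) z"
    by (subst sum.swap) (simp add: avg_Sum sum_divide_distrib[symmetric] add.commute add.left_commute)
  finally show ?thesis .
qed

lemma sum_list_product_concat:
  "(\<Sum>x\<leftarrow>concat (map (\<lambda>x. map (\<lambda>y. x + y) M) L). f x) = (\<Sum>x\<leftarrow>L. \<Sum>y\<leftarrow>M. f (x + y))"
  for f :: "'h::ab_group_add \<Rightarrow> complex"
  by (induction L) (auto simp: o_def)

lemma avg_avg: "avg L (avg M u) z = avg (concat (map (\<lambda>x. map (\<lambda>y. x + y) M) L)) u z"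
proof -
  have "length (concat (map (\<lambda>x. map (\<lambda>y. x + y) M) L)) = length L * length M"
    by (induction L) auto
  moreover have "(\<Sum>x\<leftarrow>L. (\<Sum>y\<leftarrow>M. u (z + x + y)) / of_nat (length M)) = (\<Sum>x\<leftarrow>L. \<Sum>y\<leftarrow>M. u (z + x + y)) / of_nat (length M)"
    by (induction L) (auto simp: add_divide_distrib)
  ultimately show ?thesis
    unfolding avg_def by (simp add: sum_list_product_concat[of _ M L] add.assoc mult.commute)
qed

text \<open>
Averaging operators commute and compose, so a list that works for u and a list that works for v
combine to one that works for both.
\<close>

lemma averages_to_zero_add:
  assumes "averages_to_zero u" "averages_to_zero v"
  shows "averages_to_zero (\<lambda>z. u z + v z)"
  unfolding averages_to_zero_def
proof (intro allI impI)
  fix \<eta> :: real assume "0 < \<eta>"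
  then obtain L M where L: "L \<noteq> []" "\<And>z. norm (avg L u z) \<le> \<eta>/2" and M: "M \<noteq> []" "\<And>z. norm (avg M v z) \<le> \<eta>/2"
    using assms unfolding averages_to_zero_def by (meson half_gt_zero)
  let ?K = "concat (map (\<lambda>x. map (\<lambda>y. x + y) M) L)"
  have "norm (avg ?K (\<lambda>z. u z + v z) z) \<le> \<eta>" for z
  proof -
    have "avg ?K (\<lambda>z. u z + v z) z = avg ?K u z + avg ?K v z" by (rule avg_add)
    also have "\<dots> = avg M (avg L u) z + avg L (avg M v) z"
      unfolding avg_avg[symmetric] by (simp add: avg_commute)
    also have "norm \<dots> \<le> norm (avg M (avg L u) z) + norm (avg L (avg M v) z)"
      by (rule norm_triangle_ineq)
    also have "\<dots> \<le> \<eta>/2 + \<eta>/2"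
      by (intro add_mono avg_bound[OF M(1) L(2)] avg_bound[OF L(1) M(2)])
    finally show ?thesis by simp
  qed
  moreover have "?K \<noteq> []" using L(1) M(1) by (cases L) auto
  ultimately show "\<exists>K. K \<noteq> [] \<and> (\<forall>z. norm (avg K (\<lambda>z. u z + v z) z) \<le> \<eta>)" by blast
qed

lemma averages_to_zero_cmul:
  assumes "averages_to_zero u" shows "averages_to_zero (\<lambda>z. c * u z)"
  unfolding averages_to_zero_def
proof (intro allI impI)
  fix \<eta> :: real assume "0 < \<eta>"
  then have "0 < \<eta> / (norm c + 1)" by (simp add: add_nonneg_pos)
  then obtain L where L: "L \<noteq> []" "\<And>z. norm (avg L u z) \<le> \<eta> / (norm c + 1)"
    using assms unfolding averages_to_zero_def by blast
  have "norm c * norm (avg L u z) \<le> \<eta>" for z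
  proof -
    have "norm c * norm (avg L u z) \<le> (norm c + 1) * (\<eta> / (norm c + 1))"
      by (intro mult_mono L) auto
    also have "\<dots> = \<eta>" by (smt (verit) norm_ge_zero nonzero_mult_div_cancel_left times_divide_eq_right)
    finally show ?thesis .
  qed
  then show "\<exists>L. L \<noteq> [] \<and> (\<forall>z. norm (avg L (\<lambda>z. c * u z) z) \<le> \<eta>)"
    using L(1) by (auto simp: avg_cmul norm_mult)
qed

lemma averages_to_zero_0: "averages_to_zero (\<lambda>z. 0)"
  unfolding averages_to_zero_def by (auto simp: avg_def intro!: exI[of _ "[0]"])

lemma averages_to_zero_sum:
  assumes "\<And>i. i \<in> I \<Longrightarrow> averages_to_zero (u i)"
  shows "averages_to_zero (\<lambda>z. \<Sum>i\<in>I. u i z)"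
  using assms
  by (induction I rule: infinite_finite_induct)
    (auto simp: averages_to_zero_0 intro!: averages_to_zero_add)

text \<open>
The average of a nontrivial character over an arithmetic progression is a geometric sum.
\<close>

lemma character_averages_to_zero:
  assumes q: "additive_map q" and x: "q x \<notin> \<int>"
  shows "averages_to_zero (\<lambda>z. ec (q z))"
  unfolding averages_to_zero_def
proof (intro allI impI)
  fix \<eta> :: real assume eta: "0 < \<eta>"
  define w where "w = ec (q x)"
  have w: "w \<noteq> 1" "norm w = 1" using x by (auto simp: w_def ec_eq_1_iff)
  obtain n :: nat where n: "2 / (\<eta> * norm (w - 1)) < real n" using reals_Archimedean2 by blast
  have pos: "0 < \<eta> * norm (w - 1)" using eta w by simp
  have n0: "n > 0" using n pos by (cases n) (auto simp: divide_less_0_iff)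
  define mult where "mult i = ((\<lambda>y. y + x) ^^ i) 0" for i :: nat
  have qm: "q (mult i) = real i * q x" for i
    by (induction i) (auto simp: mult_def additive_map_zero[OF q] additive_map_add[OF q] algebra_simps)
  define L where "L = map mult [0..<n]"
  have "norm (avg L (\<lambda>z. ec (q z)) z) \<le> \<eta>" for z
  proof -
    have "(\<Sum>i<n. ec (q (z + mult i))) = ec (q z) * (\<Sum>i<n. w ^ i)"
      by (simp add: additive_map_add[OF q] qm ec_add w_def ec_power sum_distrib_left)
    also have "\<dots> = ec (q z) * ((w ^ n - 1) / (w - 1))" using w(1) by (simp add: geometric_sum)
    finally have "avg L (\<lambda>z. ec (q z)) z = ec (q z) * ((w ^ n - 1) / (w - 1)) / of_nat n"
      by (simp add: avg_Sum L_def)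
    then have "norm (avg L (\<lambda>z. ec (q z)) z) = norm (w ^ n - 1) / norm (w - 1) / real n"
      by (simp add: norm_mult norm_divide)
    also have "\<dots> \<le> 2 / norm (w - 1) / real n"
    proof -
      have "norm (w ^ n - 1) \<le> 2" using norm_triangle_ineq4[of "w ^ n" 1] w by (simp add: norm_power)
      then show ?thesis by (intro divide_right_mono) auto
    qed
    also have "\<dots> \<le> \<eta>"
    proof -
      have "2 < real n * (\<eta> * norm (w - 1))" using n pos by (simp add: pos_divide_less_eq)
      then show ?thesis using n0 w(1) by (simp add: pos_divide_le_eq algebra_simps)
    qed
    finally show ?thesis .
  qed
  then show "\<exists>L. L \<noteq> [] \<and> (\<forall>z. norm (avg L (\<lambda>z. ec (q z)) z) \<le> \<eta>)"
    using n0 by (intro exI[of _ L]) (auto simp: L_def)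
qed

text \<open>
Let P be the average of (1 + cos (2 \<pi> \<delta>)) / 2 over \<delta> in D. Its powers are
trigonometric polynomials with frequencies in \<Delta>, so if q is not in \<Delta>, the product of
P^m with the character of q contains only nontrivial characters and averages to zero. But for
large m the powers P^m are concentrated where all characters of D are close to 1, where by
assumption the real part of the character of q is at least 1/2. Finite nets show that this region
has positive density, so the averages are bounded away from 0.
\<close>

lemma character_in_subgroup:
  fixes \<Delta> :: "('h::ab_group_add \<Rightarrow> real) set"
  assumes \<Delta>: "subgrp \<Delta>" "\<And>q. q \<in> \<Delta> \<Longrightarrow> additive_map q"
    and integral: "\<And>q. additive_map q \<Longrightarrow> (\<And>f. q f \<in> \<int>) \<Longrightarrow> q \<in> \<Delta>"
    and D: "finite D" "D \<subseteq> \<Delta>"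
    and nets: "\<And>\<epsilon>. 0 < \<epsilon> \<Longrightarrow> \<exists>X. finite X \<and> (\<forall>f. \<exists>x\<in>X. f - x \<in> bohr D \<epsilon>)"
    and q: "additive_map q" and \<epsilon>: "0 < \<epsilon>" and dom: "\<And>f. f \<in> bohr D \<epsilon> \<Longrightarrow> norm (ec (q f) - 1) < 1"
  shows "q \<in> \<Delta>"
proof (rule ccontr)
  assume notin: "q \<notin> \<Delta>"
  \<comment> \<open>Adding the zero map makes the set of exponents nonempty and leaves the neighbourhoods unchanged.\<close>
  define D' where "D' = insert 0 D"
  define k where "k = card D'"
  have D': "finite D'" "D' \<subseteq> \<Delta>" "D' \<noteq> {}" using D \<Delta>(1) by (auto simp: D'_def subgrp_zero)
  then have k: "0 < k" by (simp add: k_def card_gt_0_iff)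
  have bohr_eq: "bohr D' e = bohr D e" if "e > 0" for e using that by (auto simp: bohr_def D'_def)
  define P where "P z = (\<Sum>\<delta>\<in>D'. (1 + Re (ec (\<delta> z))) / 2) / k" for z
  have null: "averages_to_zero (\<lambda>z. of_real (P z ^ m) * ec (p z))" if "additive_map p" "p \<notin> \<Delta>" for m p
    using that
  proof (induction m arbitrary: p)
    case 0
    then obtain x where "p x \<notin> \<int>" using integral by blast
    then show ?case using character_averages_to_zero 0 by simp
  next
    case (Suc m)
    have shift: "p + \<delta> \<notin> \<Delta> \<and> p - \<delta> \<notin> \<Delta> \<and> additive_map (p + \<delta>) \<and> additive_map (p - \<delta>)" if "\<delta> \<in> D'" for \<delta>
    proof -
      have d: "\<delta> \<in> \<Delta>" "additive_map \<delta>" using that D' \<Delta>(2) by auto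
      have "p + \<delta> \<notin> \<Delta>" using subgrp_diff[OF \<Delta>(1) _ d(1), of "p + \<delta>"] Suc.prems by auto
      moreover have "p - \<delta> \<notin> \<Delta>" using subgrp_add[OF \<Delta>(1) _ d(1), of "p - \<delta>"] Suc.prems by auto
      ultimately show ?thesis using d(2) Suc.prems(1) by (auto simp: additive_map_def)
    qed
    have term_eq: "complex_of_real ((1 + Re (ec (\<delta> z))) / 2) * ec (p z)
      = (2 * ec (p z) + ec ((p + \<delta>) z) + ec ((p - \<delta>) z)) / 4" for \<delta> z
    proof -
      have "complex_of_real (2 * Re (ec (\<delta> z))) = ec (\<delta> z) + ec (- \<delta> z)"
        unfolding cnj_ec[symmetric] by (rule complex_add_cnj[symmetric])
      then have *: "complex_of_real (Re (ec (\<delta> z))) = (ec (\<delta> z) + ec (- \<delta> z)) / 2" by (simp add: mult.commute)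
      have **: "ec ((p + \<delta>) z) = ec (p z) * ec (\<delta> z)" "ec ((p - \<delta>) z) = ec (p z) * ec (- \<delta> z)"
        by (simp_all add: ec_add[symmetric])
      show ?thesis unfolding ** of_real_divide of_real_add * by (simp add: field_simps)
    qed
    have "(\<lambda>z. of_real (P z ^ Suc m) * ec (p z)) =
      (\<lambda>z. \<Sum>\<delta>\<in>D'. 1 / of_nat (4 * k) * (2 * (of_real (P z ^ m) * ec (p z))
         + (of_real (P z ^ m) * ec ((p + \<delta>) z) + of_real (P z ^ m) * ec ((p - \<delta>) z))))"
      (is "?lhs = ?rhs")
    proof
      fix z
      have sum_eq: "of_real (real k * P z) * ec (p z)
          = (\<Sum>\<delta>\<in>D'. (2 * ec (p z) + ec ((p + \<delta>) z) + ec ((p - \<delta>) z)) / 4)"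
      proof -
        have "real k * P z = (\<Sum>\<delta>\<in>D'. (1 + Re (ec (\<delta> z))) / 2)" using k by (simp add: P_def)
        then show ?thesis by (simp only: of_real_sum sum_distrib_right term_eq)
      qed
      have "of_real (P z ^ Suc m) * ec (p z) = of_real (P z ^ m) / of_nat k * (of_real (real k * P z) * ec (p z))"
        using k by simp
      also have "\<dots> = (\<Sum>\<delta>\<in>D'. of_real (P z ^ m) / of_nat k * ((2 * ec (p z) + ec ((p + \<delta>) z) + ec ((p - \<delta>) z)) / 4))"
        unfolding sum_eq by (rule sum_distrib_left)
      also have "\<dots> = (\<Sum>\<delta>\<in>D'. 1 / of_nat (4 * k) * (2 * (of_real (P z ^ m) * ec (p z))
         + (of_real (P z ^ m) * ec ((p + \<delta>) z) + of_real (P z ^ m) * ec ((p - \<delta>) z))))"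
      proof (rule sum.cong[OF refl])
        have arith: "w / K * ((2 * x + y + v) / 4) = 1 / (4 * K) * (2 * (w * x) + (w * y + w * v))"
          for w K x y v :: complex by (simp add: algebra_simps add_divide_distrib)
        show "of_real (P z ^ m) / of_nat k * ((2 * ec (p z) + ec ((p + \<delta>) z) + ec ((p - \<delta>) z)) / 4)
          = 1 / of_nat (4 * k) * (2 * (of_real (P z ^ m) * ec (p z))
         + (of_real (P z ^ m) * ec ((p + \<delta>) z) + of_real (P z ^ m) * ec ((p - \<delta>) z)))" for \<delta>
          unfolding arith by simp
      qed
      finally show "of_real (P z ^ Suc m) * ec (p z) = (\<Sum>\<delta>\<in>D'. 1 / of_nat (4 * k) * (2 * (of_real (P z ^ m) * ec (p z))
         + (of_real (P z ^ m) * ec ((p + \<delta>) z) + of_real (P z ^ m) * ec ((p - \<delta>) z))))" .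
    qed
    moreover have "averages_to_zero ?rhs"
    proof (intro averages_to_zero_sum averages_to_zero_cmul averages_to_zero_add)
      show "averages_to_zero (\<lambda>z. of_real (P z ^ m) * ec (p z))" using Suc by blast
      fix \<delta> assume "\<delta> \<in> D'"
      note s = shift[OF this]
      show "averages_to_zero (\<lambda>z. of_real (P z ^ m) * ec ((p + \<delta>) z))"
        using Suc.IH[of "p + \<delta>"] s by blast
      show "averages_to_zero (\<lambda>z. of_real (P z ^ m) * ec ((p - \<delta>) z))"
        using Suc.IH[of "p - \<delta>"] s by blast
    qed
    ultimately show ?case by (simp only:)
  qed
  \<comment> \<open>P is at most \<beta> outside the neighbourhood with radius e, and at least \<alpha> > \<beta> inside the one
    with radius e'.\<close>
  define e where "e = min \<epsilon> 1"
  have e: "0 < e" "e \<le> 1" "e \<le> \<epsilon>" using \<epsilon> by (auto simp: e_def)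
  define \<beta> where "\<beta> = 1 - e\<^sup>2 / (4 * k)"
  define \<alpha> where "\<alpha> = 1 - e\<^sup>2 / (8 * k)"
  have e2: "0 < e\<^sup>2 / k" "e\<^sup>2 / k \<le> 1"
  proof -
    show "0 < e\<^sup>2 / k" using e k by simp
    have "e\<^sup>2 \<le> 1" using e by (simp add: power_le_one)
    then show "e\<^sup>2 / k \<le> 1" using k by (simp add: divide_le_eq)
  qed
  have ab: "0 < \<beta>" "\<beta> < \<alpha>"
  proof -
    have "e\<^sup>2 / (4 * k) = (e\<^sup>2 / k) / 4" "e\<^sup>2 / (8 * k) = (e\<^sup>2 / k) / 8" by auto
    then show "0 < \<beta>" "\<beta> < \<alpha>" using e2 unfolding \<alpha>_def \<beta>_def by linarith+
  qed
  have cos_eq: "(1 + Re (ec t)) / 2 = 1 - (norm (ec t - 1))\<^sup>2 / 4" for t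
    unfolding norm_ec_sq by (simp add: field_simps)
  have Re_le: "\<bar>Re (ec t)\<bar> \<le> 1" for t using abs_Re_le_cmod[of "ec t"] by simp
  have term01: "0 \<le> (1 + Re (ec t)) / 2" "(1 + Re (ec t)) / 2 \<le> 1" for t
    using Re_le[of t] by (auto simp: abs_le_iff)
  have P0: "0 \<le> P z" for z unfolding P_def by (intro divide_nonneg_nonneg sum_nonneg term01) auto
  have P_out: "P z \<le> \<beta>" if z: "z \<notin> bohr D e" for z
  proof -
    obtain \<delta> where d: "\<delta> \<in> D'" "e \<le> norm (ec (\<delta> z) - 1)"
      using z unfolding bohr_eq[OF e(1), symmetric] by (auto simp: bohr_def not_less)
    have "e\<^sup>2 \<le> (norm (ec (\<delta> z) - 1))\<^sup>2" using d(2) e by (intro power_mono) auto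
    then have 1: "(1 + Re (ec (\<delta> z))) / 2 \<le> 1 - e\<^sup>2 / 4" unfolding cos_eq by simp
    have "(\<Sum>\<delta>\<in>D'. (1 + Re (ec (\<delta> z))) / 2) = (1 + Re (ec (\<delta> z))) / 2 + (\<Sum>\<delta>\<in>D'-{\<delta>}. (1 + Re (ec (\<delta> z))) / 2)"
      by (rule sum.remove[OF D'(1) d(1)])
    also have "\<dots> \<le> (1 - e\<^sup>2 / 4) + (\<Sum>\<delta>\<in>D'-{\<delta>}. 1)"
      by (intro add_mono 1 sum_mono term01)
    also have "\<dots> = real k - e\<^sup>2 / 4" using d(1) D'(1) k by (simp add: k_def of_nat_diff)
    finally have "P z \<le> (real k - e\<^sup>2 / 4) / k" unfolding P_def using k by (simp add: divide_right_mono)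
    also have "\<dots> = \<beta>" using k by (simp add: \<beta>_def field_simps)
    finally show ?thesis .
  qed
  define e' where "e' = e / sqrt (2 * k)"
  have e': "0 < e'" using e k by (simp add: e'_def)
  have e'2: "e'\<^sup>2 = e\<^sup>2 / (2 * k)" by (simp add: e'_def power_divide)
  have P_in: "\<alpha> \<le> P z" if "z \<in> bohr D e'" for z
  proof -
    have "1 - e'\<^sup>2 / 4 \<le> (1 + Re (ec (\<delta> z))) / 2" if "\<delta> \<in> D'" for \<delta>
    proof -
      have "norm (ec (\<delta> z) - 1) \<le> e'"
        using that \<open>z \<in> bohr D e'\<close> unfolding bohr_eq[OF e', symmetric] by (auto simp: bohr_def less_imp_le)
      then have "(norm (ec (\<delta> z) - 1))\<^sup>2 \<le> e'\<^sup>2" by (intro power_mono) auto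
      then show ?thesis unfolding cos_eq by simp
    qed
    then have "(\<Sum>\<delta>\<in>D'. 1 - e'\<^sup>2 / 4) \<le> (\<Sum>\<delta>\<in>D'. (1 + Re (ec (\<delta> z))) / 2)" by (rule sum_mono)
    then have "(1 - e'\<^sup>2 / 4) * real k \<le> (\<Sum>\<delta>\<in>D'. (1 + Re (ec (\<delta> z))) / 2)" by (simp add: k_def mult.commute)
    then have "1 - e'\<^sup>2 / 4 \<le> P z" unfolding P_def using k by (simp only: pos_le_divide_eq of_nat_0_less_iff)
    moreover have "1 - e'\<^sup>2 / 4 = \<alpha>" by (simp add: \<alpha>_def e'2)
    ultimately show ?thesis by simp
  qed
  obtain X where X: "finite X" "\<And>f. \<exists>x\<in>X. f - x \<in> bohr D e'" using nets[OF e'] by auto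
  define r where "r = real (card X)"
  have "X \<noteq> {}" using X(2) by auto
  then have r: "0 < r" using X(1) by (simp add: r_def card_gt_0_iff)
  have "(\<lambda>m. (\<beta>/\<alpha>) ^ m) \<longlonglongrightarrow> 0" by (rule LIMSEQ_realpow_zero) (use ab in auto)
  then have "\<forall>\<^sub>F m in sequentially. (\<beta>/\<alpha>) ^ m < 1 / (3 * r)"
    using r by (intro order_tendstoD(2)) auto
  then obtain m where "(\<beta>/\<alpha>) ^ m < 1 / (3 * r)" by (meson eventually_sequentially order_refl)
  then have m: "3 * r * \<beta> ^ m < \<alpha> ^ m"
    using ab r by (simp add: power_divide field_simps)
  define \<eta> where "\<eta> = (\<alpha> ^ m / 2 - r * (3/2) * \<beta> ^ m) / (2 * r)"
  have eta: "0 < \<eta>" using m r by (simp add: \<eta>_def)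
  define u where "u z = of_real (P z ^ m) * ec (q z)" for z
  obtain L where L: "L \<noteq> []" "\<And>z. norm (avg L u z) \<le> \<eta>"
    using null[OF q notin, of m] eta unfolding averages_to_zero_def u_def by blast
  have low: "P z ^ m / 2 - (3/2) * \<beta> ^ m \<le> Re (u z)" for z
  proof (cases "z \<in> bohr D e")
    case True
    then have "norm (ec (q z) - 1) < 1" using e by (intro dom) (auto simp: bohr_def)
    then have "(norm (ec (q z) - 1))\<^sup>2 < 1" by (simp add: power_less_one_iff)
    then have "1/2 \<le> Re (ec (q z))" unfolding norm_ec_sq by simp
    then have "P z ^ m * (1/2) \<le> P z ^ m * Re (ec (q z))" by (rule mult_left_mono) (simp add: P0)
    moreover have "0 \<le> \<beta> ^ m" using ab by simp
    ultimately show ?thesis by (simp add: u_def)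
  next
    case False
    have "P z ^ m \<le> \<beta> ^ m" using P_out[OF False] P0 by (intro power_mono)
    moreover have "P z ^ m * (- 1) \<le> P z ^ m * Re (ec (q z))"
      by (rule mult_left_mono) (use Re_le[of "q z"] P0 in auto)
    ultimately show ?thesis by (simp add: u_def)
  qed
  have row: "\<alpha> ^ m / 2 - r * (3/2) * \<beta> ^ m \<le> (\<Sum>x\<in>X. Re (u (- x + y)))" for y
  proof -
    obtain x where x: "x \<in> X" "y - x \<in> bohr D e'" using X(2) by blast
    have "\<alpha> ^ m \<le> P (- x + y) ^ m" using P_in[OF x(2)] ab by (intro power_mono) auto
    also have "\<dots> \<le> (\<Sum>x\<in>X. P (- x + y) ^ m)" using x(1) X(1) P0 by (intro member_le_sum) auto
    finally have "\<alpha> ^ m / 2 - r * (3/2) * \<beta> ^ m \<le> (\<Sum>x\<in>X. P (- x + y) ^ m / 2 - (3/2) * \<beta> ^ m)"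
      by (simp add: sum_subtractf sum_divide_distrib[symmetric] r_def)
    also have "\<dots> \<le> (\<Sum>x\<in>X. Re (u (- x + y)))" by (intro sum_mono low)
    finally show ?thesis .
  qed
  define c where "c = \<alpha> ^ m / 2 - r * (3/2) * \<beta> ^ m"
  have S: "(\<Sum>x\<in>X. Re (avg L u (- x))) = (\<Sum>i<length L. \<Sum>x\<in>X. Re (u (- x + L ! i))) / length L"
    by (subst sum.swap) (simp add: avg_Sum sum_divide_distrib)
  have "(\<Sum>i<length L. c) \<le> (\<Sum>i<length L. \<Sum>x\<in>X. Re (u (- x + L ! i)))"
    unfolding c_def by (intro sum_mono row)
  also have "\<dots> = (\<Sum>x\<in>X. Re (avg L u (- x))) * length L"
    unfolding S using L(1) by simp
  finally have "c * length L \<le> (\<Sum>x\<in>X. Re (avg L u (- x))) * length L"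
    by (simp only: sum_constant card_lessThan mult.commute)
  then have "c \<le> (\<Sum>x\<in>X. Re (avg L u (- x)))"
    by (rule mult_right_le_imp_le) (use L(1) in simp)
  also have "\<dots> \<le> (\<Sum>x\<in>X. \<eta>)"
    by (intro sum_mono order_trans[OF complex_Re_le_cmod L(2)])
  also have "\<dots> = r * \<eta>" by (simp add: r_def)
  also have "\<dots> = c / 2" unfolding \<eta>_def c_def[symmetric] using r by simp
  finally have "c \<le> 0" by simp
  then show False using m unfolding c_def by linarith
qed

section \<open>Group topologies and minimality\<close>

context comm_group begin

text \<open>
The axioms for a base of neighbourhoods of the identity of a group topology on an abelian group.
\<close>

definition filter_base :: "'a set set \<Rightarrow> bool" where
  "filter_base \<B> \<longleftrightarrow> \<B> \<noteq> {} \<and> (\<forall>B\<in>\<B>. B \<subseteq> carrier G \<and> \<one> \<in> B)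
     \<and> (\<forall>A\<in>\<B>. \<forall>B\<in>\<B>. \<exists>C\<in>\<B>. C \<subseteq> A \<inter> B)
     \<and> (\<forall>B\<in>\<B>. \<exists>C\<in>\<B>. \<forall>x\<in>C. \<forall>y\<in>C. x \<otimes> inv y \<in> B)"

definition base_topology :: "'a set set \<Rightarrow> 'a topology" where
  "base_topology \<B> = topology (\<lambda>U. U \<subseteq> carrier G \<and> (\<forall>x\<in>U. \<exists>B\<in>\<B>. \<forall>b\<in>B. x \<otimes> b \<in> U))"

lemma inv_mult_cancel_left: "x \<in> carrier G \<Longrightarrow> y \<in> carrier G \<Longrightarrow> x \<otimes> (inv x \<otimes> y) = y"
  by (simp add: m_assoc[symmetric])
lemma inv_mult_cancel_left': "x \<in> carrier G \<Longrightarrow> y \<in> carrier G \<Longrightarrow> inv x \<otimes> (x \<otimes> y) = y"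
  by (simp add: m_assoc[symmetric])

lemma mult_swap_middle:
  "\<lbrakk>a \<in> carrier G; b \<in> carrier G; c \<in> carrier G; d \<in> carrier G\<rbrakk>
    \<Longrightarrow> (a \<otimes> b) \<otimes> (c \<otimes> d) = (a \<otimes> c) \<otimes> (b \<otimes> d)"
  by (simp add: m_ac)

context
  fixes \<B> assumes base: "filter_base \<B>"
begin

abbreviation (input) "\<tau> \<equiv> base_topology \<B>"

lemma base_carrier: "B \<in> \<B> \<Longrightarrow> b \<in> B \<Longrightarrow> b \<in> carrier G"
  using base unfolding filter_base_def by blast
lemma base_one: "B \<in> \<B> \<Longrightarrow> \<one> \<in> B"
  using base unfolding filter_base_def by blast
lemma base_Int: "A \<in> \<B> \<Longrightarrow> B \<in> \<B> \<Longrightarrow> \<exists>C\<in>\<B>. C \<subseteq> A \<inter> B"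
  using base unfolding filter_base_def by blast
lemma base_diff: "B \<in> \<B> \<Longrightarrow> \<exists>C\<in>\<B>. \<forall>x\<in>C. \<forall>y\<in>C. x \<otimes> inv y \<in> B"
  using base unfolding filter_base_def by blast
lemma base_ne: "\<exists>B. B \<in> \<B>"
  using base unfolding filter_base_def by blast

lemma base_inv: assumes "B \<in> \<B>" shows "\<exists>C\<in>\<B>. \<forall>x\<in>C. inv x \<in> B"
proof -
  obtain C where C: "C \<in> \<B>" "\<And>x y. x \<in> C \<Longrightarrow> y \<in> C \<Longrightarrow> x \<otimes> inv y \<in> B" using base_diff[OF assms] by blast
  have "inv y \<in> B" if "y \<in> C" for y
    using C(2)[OF base_one[OF C(1)] that] base_carrier[OF C(1) that] by simp
  then show ?thesis using C(1) by blast
qed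

lemma base_mult: assumes "B \<in> \<B>" shows "\<exists>C\<in>\<B>. \<forall>x\<in>C. \<forall>y\<in>C. x \<otimes> y \<in> B"
proof -
  obtain C where C: "C \<in> \<B>" "\<And>x y. x \<in> C \<Longrightarrow> y \<in> C \<Longrightarrow> x \<otimes> inv y \<in> B" using base_diff[OF assms] by blast
  obtain D where D: "D \<in> \<B>" "\<And>x. x \<in> D \<Longrightarrow> inv x \<in> C" using base_inv[OF C(1)] by blast
  obtain E where E: "E \<in> \<B>" "E \<subseteq> C \<inter> D" using base_Int[OF C(1) D(1)] by blast
  have "x \<otimes> y \<in> B" if "x \<in> E" "y \<in> E" for x y
    using C(2)[of x "inv y"] D(2)[of y] that E base_carrier[OF E(1) that(2)] by auto
  then show ?thesis using E(1) by blast
qed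

lemma openin_base_topology:
  "openin \<tau> U \<longleftrightarrow> U \<subseteq> carrier G \<and> (\<forall>x\<in>U. \<exists>B\<in>\<B>. \<forall>b\<in>B. x \<otimes> b \<in> U)"
proof -
  have "istopology (\<lambda>U. U \<subseteq> carrier G \<and> (\<forall>x\<in>U. \<exists>B\<in>\<B>. \<forall>b\<in>B. x \<otimes> b \<in> U))"
    unfolding istopology_def
  proof (intro conjI allI impI; (elim conjE)?)
    fix U V assume U: "\<forall>x\<in>U. \<exists>B\<in>\<B>. \<forall>b\<in>B. x \<otimes> b \<in> U" and V: "\<forall>x\<in>V. \<exists>B\<in>\<B>. \<forall>b\<in>B. x \<otimes> b \<in> V"
    show "\<forall>x\<in>U \<inter> V. \<exists>B\<in>\<B>. \<forall>b\<in>B. x \<otimes> b \<in> U \<inter> V"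
    proof
      fix x assume "x \<in> U \<inter> V"
      then obtain A B where "A \<in> \<B>" "B \<in> \<B>" "\<forall>b\<in>A. x \<otimes> b \<in> U" "\<forall>b\<in>B. x \<otimes> b \<in> V" using U V by blast
      then show "\<exists>B\<in>\<B>. \<forall>b\<in>B. x \<otimes> b \<in> U \<inter> V" using base_Int[of A B] by blast
    qed
  next
    fix \<K> assume "\<forall>K\<in>\<K>. K \<subseteq> carrier G \<and> (\<forall>x\<in>K. \<exists>B\<in>\<B>. \<forall>b\<in>B. x \<otimes> b \<in> K)"
    then show "\<forall>x\<in>\<Union>\<K>. \<exists>B\<in>\<B>. \<forall>b\<in>B. x \<otimes> b \<in> \<Union>\<K>"
      by (meson UnionE UnionI)
  qed auto
  then show ?thesis unfolding base_topology_def by (simp add: topology_inverse')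
qed

lemma topspace_base_topology: "topspace \<tau> = carrier G"
proof -
  have "openin \<tau> (carrier G)"
    unfolding openin_base_topology using base_ne base_carrier by blast
  then show ?thesis
    by (meson openin_base_topology openin_subset openin_topspace subset_antisym)
qed

text \<open>
The translate of B by x need not be open. Its interior is taken instead.
\<close>

lemma base_topology_nbhd:
  assumes x: "x \<in> carrier G" and B: "B \<in> \<B>"
  shows "\<exists>U. openin \<tau> U \<and> x \<in> U \<and> (\<forall>y\<in>U. inv x \<otimes> y \<in> B)"
proof -
  define U where "U = {y\<in>carrier G. \<exists>C\<in>\<B>. \<forall>c\<in>C. inv x \<otimes> y \<otimes> c \<in> B}"
  have "openin \<tau> U"
    unfolding openin_base_topology
  proof (intro conjI ballI)
    show "U \<subseteq> carrier G" by (auto simp: U_def)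
    fix y assume "y \<in> U"
    then obtain C where y: "y \<in> carrier G" and C: "C \<in> \<B>" "\<And>c. c \<in> C \<Longrightarrow> inv x \<otimes> y \<otimes> c \<in> B"
      by (auto simp: U_def)
    obtain D where D: "D \<in> \<B>" "\<And>a b. a \<in> D \<Longrightarrow> b \<in> D \<Longrightarrow> a \<otimes> b \<in> C" using base_mult[OF C(1)] by blast
    have "y \<otimes> a \<in> U" if "a \<in> D" for a
    proof -
      have a: "a \<in> carrier G" using that D(1) base_carrier by blast
      have "inv x \<otimes> (y \<otimes> a) \<otimes> b \<in> B" if "b \<in> D" for b
        using C(2)[OF D(2)[OF \<open>a \<in> D\<close> that]] base_carrier[OF D(1) that] a x y by (simp add: m_assoc)
      then show ?thesis using D(1) a y by (auto simp: U_def)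
    qed
    then show "\<exists>C\<in>\<B>. \<forall>c\<in>C. y \<otimes> c \<in> U" using D(1) by blast
  qed
  moreover have "x \<in> U" using x B base_carrier[OF B] by (auto simp: U_def intro!: bexI[of _ B])
  moreover have "inv x \<otimes> y \<in> B" if "y \<in> U" for y
    using that base_one x by (fastforce simp: U_def)
  ultimately show ?thesis by blast
qed

lemma group_topology_base_topology: "group_topology G \<tau>"
  unfolding group_topology_def
proof (intro conjI)
  show "group G" by (rule is_group)
  show "topspace \<tau> = carrier G" by (rule topspace_base_topology)
  show "continuous_map (prod_topology \<tau> \<tau>) \<tau> (\<lambda>(x, y). x \<otimes> y)"
    unfolding continuous_map_def
  proof (intro conjI allI impI)
    show "(\<lambda>(x, y). x \<otimes> y) \<in> topspace (prod_topology \<tau> \<tau>) \<rightarrow> topspace \<tau>"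
      by (auto simp: topspace_base_topology)
    fix U assume U: "openin \<tau> U"
    show "openin (prod_topology \<tau> \<tau>) {p \<in> topspace (prod_topology \<tau> \<tau>). (case p of (x, y) \<Rightarrow> x \<otimes> y) \<in> U}"
      (is "openin _ ?P")
      unfolding openin_prod_topology_alt
    proof (intro allI impI)
      fix x y assume "(x, y) \<in> ?P"
      then have xy: "x \<in> carrier G" "y \<in> carrier G" "x \<otimes> y \<in> U" by (auto simp: topspace_base_topology)
      then obtain B where B: "B \<in> \<B>" "\<And>b. b \<in> B \<Longrightarrow> x \<otimes> y \<otimes> b \<in> U"
        using U unfolding openin_base_topology by blast
      obtain C where C: "C \<in> \<B>" "\<And>a b. a \<in> C \<Longrightarrow> b \<in> C \<Longrightarrow> a \<otimes> b \<in> B" using base_mult[OF B(1)] by blast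
      obtain V where V: "openin \<tau> V" "x \<in> V" "\<And>v. v \<in> V \<Longrightarrow> inv x \<otimes> v \<in> C"
        using base_topology_nbhd[OF xy(1) C(1)] by blast
      obtain W where W: "openin \<tau> W" "y \<in> W" "\<And>w. w \<in> W \<Longrightarrow> inv y \<otimes> w \<in> C"
        using base_topology_nbhd[OF xy(2) C(1)] by blast
      have sub: "V \<subseteq> carrier G" "W \<subseteq> carrier G" using V(1) W(1) unfolding openin_base_topology by auto
      have "v \<otimes> w \<in> U" if "v \<in> V" "w \<in> W" for v w
      proof -
        have "v \<in> carrier G" "w \<in> carrier G" using that sub by auto
        then have "x \<otimes> y \<otimes> ((inv x \<otimes> v) \<otimes> (inv y \<otimes> w)) = v \<otimes> w"
          using xy by (simp add: m_ac inv_mult_cancel_left)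
        then show ?thesis using B(2)[OF C(2)[OF V(3)[OF that(1)] W(3)[OF that(2)]]] by simp
      qed
      then show "\<exists>V W. openin \<tau> V \<and> openin \<tau> W \<and> x \<in> V \<and> y \<in> W \<and>
        V \<times> W \<subseteq> ?P"
        using V W sub by (intro exI[of _ V] exI[of _ W]) (auto simp: topspace_base_topology)
    qed
  qed
  show "continuous_map \<tau> \<tau> (\<lambda>x. inv x)"
    unfolding continuous_map_def
  proof (intro conjI allI impI)
    show "(\<lambda>x. inv x) \<in> topspace \<tau> \<rightarrow> topspace \<tau>"
      by (auto simp: topspace_base_topology)
    fix U assume U: "openin \<tau> U"
    show "openin \<tau> {x \<in> topspace \<tau>. inv x \<in> U}"
      unfolding openin_base_topology topspace_base_topology
    proof (intro conjI ballI)
      fix x assume "x \<in> {x \<in> carrier G. inv x \<in> U}"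
      then have x: "x \<in> carrier G" "inv x \<in> U" by auto
      obtain B where B: "B \<in> \<B>" "\<And>b. b \<in> B \<Longrightarrow> inv x \<otimes> b \<in> U"
        using U x unfolding openin_base_topology by blast
      obtain C where C: "C \<in> \<B>" "\<And>c. c \<in> C \<Longrightarrow> inv c \<in> B" using base_inv[OF B(1)] by blast
      have "x \<otimes> c \<in> {x \<in> carrier G. inv x \<in> U}" if "c \<in> C" for c
        using B(2)[OF C(2)[OF that]] base_carrier[OF C(1) that] x by (simp add: inv_mult)
      then show "\<exists>B\<in>\<B>. \<forall>b\<in>B. x \<otimes> b \<in> {x \<in> carrier G. inv x \<in> U}" using C(1) by blast
    qed auto
  qed
qed

lemma Hausdorff_base_topology:
  assumes sep: "\<And>g. g \<in> carrier G \<Longrightarrow> g \<noteq> \<one> \<Longrightarrow> \<exists>B\<in>\<B>. g \<notin> B"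
  shows "Hausdorff_group_topology G \<tau>"
  unfolding Hausdorff_group_topology_def
proof (intro conjI group_topology_base_topology)
  show "Hausdorff_space \<tau>"
    unfolding Hausdorff_space_def topspace_base_topology
  proof (intro allI impI; elim conjE)
    fix x y assume xy: "x \<in> carrier G" "y \<in> carrier G" "x \<noteq> y"
    have "inv x \<otimes> y \<noteq> \<one>" using xy by (metis inv_mult_cancel_left r_one)
    then obtain B where B: "B \<in> \<B>" "inv x \<otimes> y \<notin> B" using sep[of "inv x \<otimes> y"] xy by auto
    obtain C where C: "C \<in> \<B>" "\<And>a b. a \<in> C \<Longrightarrow> b \<in> C \<Longrightarrow> a \<otimes> inv b \<in> B" using base_diff[OF B(1)] by blast
    obtain V where V: "openin \<tau> V" "x \<in> V" "\<And>v. v \<in> V \<Longrightarrow> inv x \<otimes> v \<in> C"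
      using base_topology_nbhd[OF xy(1) C(1)] by blast
    obtain W where W: "openin \<tau> W" "y \<in> W" "\<And>w. w \<in> W \<Longrightarrow> inv y \<otimes> w \<in> C"
      using base_topology_nbhd[OF xy(2) C(1)] by blast
    have "disjnt V W"
    proof (unfold disjnt_iff, intro allI notI; elim conjE)
      fix z assume z: "z \<in> V" "z \<in> W"
      have zc: "z \<in> carrier G" using z V(1) unfolding openin_base_topology by auto
      have "(inv x \<otimes> z) \<otimes> inv (inv y \<otimes> z) = (inv x \<otimes> z) \<otimes> (y \<otimes> inv z)"
        using xy zc by (simp add: inv_mult)
      also have "\<dots> = inv x \<otimes> y"
        using xy zc mult_swap_middle[of "inv x" z y "inv z"] by simp
      finally have "inv x \<otimes> y \<in> B" using C(2)[OF V(3)[OF z(1)] W(3)[OF z(2)]] by simp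
      then show False using B(2) by simp
    qed
    then show "\<exists>U V. openin \<tau> U \<and> openin \<tau> V \<and> x \<in> U \<and> y \<in> V \<and> disjnt U V"
      using V W by blast
  qed
qed

end
end

locale minimal_abelian_group = comm_group G for G :: "('a, 'b) monoid_scheme" (structure) +
  fixes T :: "'a topology"
  assumes minimal: "minimal_group_topology G T"
begin

definition nb :: "'a set \<Rightarrow> bool" where "nb U \<longleftrightarrow> openin T U \<and> \<one> \<in> U"

lemma group_topology_T: "group_topology G T" and Hausdorff_T: "Hausdorff_space T"
  using minimal by (auto simp: minimal_group_topology_def Hausdorff_group_topology_def)
lemma topspace_T: "topspace T = carrier G"
  using group_topology_T by (simp add: group_topology_def)
lemma nb_carrier: "nb U \<Longrightarrow> x \<in> U \<Longrightarrow> x \<in> carrier G"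
  unfolding nb_def using openin_subset topspace_T by blast
lemma nb_one: "nb U \<Longrightarrow> \<one> \<in> U" by (simp add: nb_def)
lemma nb_Int: "nb U \<Longrightarrow> nb V \<Longrightarrow> nb (U \<inter> V)" by (simp add: nb_def openin_Int)
lemma nb_UNIV: "nb (carrier G)" using topspace_T by (metis nb_def openin_topspace one_closed)

lemma nb_sep: assumes "g \<in> carrier G" "g \<noteq> \<one>" shows "\<exists>U. nb U \<and> g \<notin> U"
proof -
  obtain U V where "openin T U" "openin T V" "\<one> \<in> U" "g \<in> V" "disjnt U V"
    using Hausdorff_T assms topspace_T unfolding Hausdorff_space_def by (metis one_closed)
  then show ?thesis by (auto simp: nb_def disjnt_iff)
qed

lemma nb_diff: assumes "nb U" shows "\<exists>V. nb V \<and> (\<forall>x\<in>V. \<forall>y\<in>V. x \<otimes> inv y \<in> U)"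
proof -
  have "openin (prod_topology T T) {p \<in> topspace (prod_topology T T). (case p of (x, y) \<Rightarrow> x \<otimes> y) \<in> U}"
    (is "openin _ ?P")
    using group_topology_T assms unfolding group_topology_def nb_def by (intro openin_continuous_map_preimage) auto
  moreover have "(\<one>, \<one>) \<in> ?P"
    using assms topspace_T by (simp add: nb_one)
  ultimately obtain A B where AB: "openin T A" "openin T B" "\<one> \<in> A" "\<one> \<in> B"
    "A \<times> B \<subseteq> ?P"
    unfolding openin_prod_topology_alt by meson
  have "openin T {x \<in> topspace T. inv x \<in> B}"
    using group_topology_T AB(2) unfolding group_topology_def by (intro openin_continuous_map_preimage) auto
  then have "nb (A \<inter> {x \<in> topspace T. inv x \<in> B})"
    using AB topspace_T by (simp add: nb_def openin_Int)
  then show ?thesis using AB(5) by (intro exI[of _ "A \<inter> {x \<in> topspace T. inv x \<in> B}"]) auto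
qed

lemma nb_symmetric_triple:
  assumes U: "nb U"
  shows "\<exists>V. nb V \<and> V \<subseteq> U \<and> (\<forall>x\<in>V. inv x \<in> V) \<and> (\<forall>x\<in>V. \<forall>y\<in>V. \<forall>z\<in>V. x \<otimes> y \<otimes> z \<in> U)"
proof -
  obtain V where V: "nb V" "\<And>x y. x \<in> V \<Longrightarrow> y \<in> V \<Longrightarrow> x \<otimes> inv y \<in> U" using nb_diff[OF U] by blast
  obtain W where W: "nb W" "\<And>x y. x \<in> W \<Longrightarrow> y \<in> W \<Longrightarrow> x \<otimes> inv y \<in> V" using nb_diff[OF V(1)] by blast
  have WV: "x \<in> V" if "x \<in> W" for x using W(2)[OF that nb_one[OF W(1)]] nb_carrier[OF W(1) that] by simp
  have VU: "x \<in> U" if "x \<in> V" for x using V(2)[OF that nb_one[OF V(1)]] nb_carrier[OF V(1) that] by simp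
  have "openin T {x \<in> topspace T. inv x \<in> W}"
    using group_topology_T W(1) unfolding group_topology_def nb_def by (intro openin_continuous_map_preimage) auto
  then have nbS: "nb (W \<inter> {x \<in> topspace T. inv x \<in> W})" (is "nb ?S")
    using W topspace_T by (simp add: nb_def openin_Int)
  have "x \<otimes> y \<otimes> z \<in> U" if "x \<in> ?S" "y \<in> ?S" "z \<in> ?S" for x y z
  proof -
    have c: "x \<in> carrier G" "y \<in> carrier G" "z \<in> carrier G" using that topspace_T by auto
    have "x \<otimes> inv (inv y) \<in> V" by (rule W(2)) (use that in auto)
    moreover have "inv z \<in> V" by (rule WV) (use that in auto)
    ultimately have "x \<otimes> inv (inv y) \<otimes> inv (inv z) \<in> U" by (rule V(2))
    then show ?thesis using c by simp
  qed
  moreover have "inv x \<in> ?S" if "x \<in> ?S" for x using that topspace_T by auto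
  moreover have "?S \<subseteq> U" using WV VU by auto
  ultimately show ?thesis using nbS by blast
qed

text \<open>
The sequence V is a base for a first countable group topology, coarser than the given one, in
which each nontrivial x n is separated from the identity.
\<close>

lemma ex_neighbourhood_sequence:
  assumes U: "nb U" and xc: "\<And>n. x n \<in> carrier G"
  shows "\<exists>V. V 0 = U \<and> (\<forall>n. nb (V n)) \<and> (\<forall>n. x n \<noteq> \<one> \<longrightarrow> x n \<notin> V (Suc n))
    \<and> (\<forall>a n. a \<in> V (Suc n) \<longrightarrow> inv a \<in> V (Suc n))
    \<and> (\<forall>a b c n. a \<in> V (Suc n) \<longrightarrow> b \<in> V (Suc n) \<longrightarrow> c \<in> V (Suc n) \<longrightarrow> a \<otimes> b \<otimes> c \<in> V n)
    \<and> (\<forall>m n. m \<le> n \<longrightarrow> V n \<subseteq> V m)"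
proof -
  define good where "good n U V \<longleftrightarrow> nb V \<and> V \<subseteq> U \<and> (x n \<noteq> \<one> \<longrightarrow> x n \<notin> V) \<and> (\<forall>a\<in>V. inv a \<in> V)
    \<and> (\<forall>a\<in>V. \<forall>b\<in>V. \<forall>c\<in>V. a \<otimes> b \<otimes> c \<in> U)" for n U V
  have ex_good: "\<exists>V. good n U V" if U: "nb U" for n U
  proof -
    have "\<exists>W. nb W \<and> (x n \<noteq> \<one> \<longrightarrow> x n \<notin> W)"
    proof (cases "x n = \<one>")
      case True
      then show ?thesis using nb_UNIV by blast
    next
      case False
      then show ?thesis using nb_sep[OF xc[of n] False] by blast
    qed
    then obtain W where W: "nb W" "x n \<noteq> \<one> \<longrightarrow> x n \<notin> W" by blast
    obtain V where V: "nb V \<and> V \<subseteq> U \<inter> W \<and> (\<forall>a\<in>V. inv a \<in> V)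
        \<and> (\<forall>a\<in>V. \<forall>b\<in>V. \<forall>c\<in>V. a \<otimes> b \<otimes> c \<in> U \<inter> W)"
      using nb_symmetric_triple[OF nb_Int[OF U W(1)]] by (rule exE)
    then have "x n \<noteq> \<one> \<longrightarrow> x n \<notin> V" using W(2) by blast
    then have "good n U V" using V unfolding good_def by simp
    then show ?thesis by (rule exI)
  qed
  define shrink where "shrink n U = (SOME V. good n U V)" for n U
  define V where "V = rec_nat U shrink"
  have V0: "V 0 = U" and VS: "\<And>n. V (Suc n) = shrink n (V n)" by (simp_all add: V_def)
  have step: "good n (V n) (V (Suc n))" if "nb (V n)" for n
    unfolding VS shrink_def using someI_ex[OF ex_good[OF that]] .
  have nbV: "nb (V n)" for n
  proof (induction n)
    case (Suc n)
    then show ?case using step[of n] by (simp add: good_def)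
  qed (simp add: V0 U)
  have goodV: "good n (V n) (V (Suc n))" for n by (rule step[OF nbV])
  have dec1: "V (Suc n) \<subseteq> V n" for n using goodV[of n] by (simp add: good_def)
  have dec: "V n \<subseteq> V m" if "m \<le> n" for m n using dec1 that by (rule lift_Suc_antimono_le[of V])
  show ?thesis
    using V0 nbV dec goodV unfolding good_def by (intro exI[of _ V] conjI allI impI) simp_all
qed

lemma open_translate: assumes U: "openin T U" and a: "a \<in> carrier G" shows "openin T {x \<in> carrier G. a \<otimes> x \<in> U}"
proof -
  have "continuous_map T (prod_topology T T) (\<lambda>x. (a, x))"
    using a topspace_T by (intro continuous_map_pairedI) auto
  from continuous_map_compose[OF this, of T "\<lambda>(x, y). x \<otimes> y"] group_topology_T
  have "continuous_map T T (\<lambda>x. a \<otimes> x)" unfolding group_topology_def by (simp add: o_def)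
  from openin_continuous_map_preimage[OF this U] show ?thesis by (simp add: topspace_T)
qed

end

text \<open>
A base of neighbourhoods of 0 for a group topology on H that need not be Hausdorff.
\<close>

definition subset_base :: "'h::ab_group_add set set \<Rightarrow> bool" where
  "subset_base \<S> \<longleftrightarrow> \<S> \<noteq> {} \<and> (\<forall>S\<in>\<S>. 0 \<in> S) \<and> (\<forall>S\<in>\<S>. \<forall>S'\<in>\<S>. \<exists>S''\<in>\<S>. S'' \<subseteq> S \<inter> S')
    \<and> (\<forall>S\<in>\<S>. \<exists>S'\<in>\<S>. \<forall>a\<in>S'. \<forall>b\<in>S'. a - b \<in> S)"

locale hom_into_minimal = minimal_abelian_group +
  fixes \<iota> :: "'h::ab_group_add \<Rightarrow> 'a"
  assumes \<iota>_closed [simp]: "\<iota> f \<in> carrier G" and \<iota>_add: "\<iota> (f + g) = \<iota> f \<otimes> \<iota> g"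
begin

lemma \<iota>_zero [simp]: "\<iota> 0 = \<one>"
  using \<iota>_add[of 0 0] by (metis add.left_neutral \<iota>_closed l_cancel_one')
lemma \<iota>_minus: "\<iota> (- f) = inv (\<iota> f)"
  using \<iota>_add[of f "-f"] by (metis ab_group_add_class.ab_left_minus add.commute inv_equality \<iota>_closed \<iota>_zero \<iota>_add)
lemma \<iota>_diff: "\<iota> (f - g) = \<iota> f \<otimes> inv (\<iota> g)"
  using \<iota>_add[of f "-g"] by (simp add: \<iota>_minus)

lemma quotient_translates:
  assumes "g \<in> carrier G"
  shows "(inv (\<iota> h) \<otimes> g) \<otimes> inv (inv (\<iota> w) \<otimes> g) = \<iota> (w - h)"
proof -
  have "(inv (\<iota> h) \<otimes> g) \<otimes> inv (inv (\<iota> w) \<otimes> g) = (inv (\<iota> h) \<otimes> g) \<otimes> (\<iota> w \<otimes> inv g)"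
    using assms by (simp add: inv_mult)
  also have "\<dots> = \<iota> (w - h)"
    using mult_swap_middle[of "inv (\<iota> h)" g "\<iota> w" "inv g"] assms by (simp add: \<iota>_diff m_comm)
  finally show ?thesis .
qed

text \<open>
The products of \<iota>(S) and U are a base for a coarser group topology. The assumption sep says that
this topology is Hausdorff, so it is the minimal topology itself.
\<close>

lemma minimality:
  assumes base: "subset_base \<S>"
    and sep: "\<And>g. g \<in> carrier G \<Longrightarrow> g \<noteq> \<one> \<Longrightarrow> \<exists>S\<in>\<S>. \<exists>U. nb U \<and> (\<forall>s\<in>S. inv (\<iota> s) \<otimes> g \<notin> U)"
    and U: "nb U"
  shows "\<exists>S\<in>\<S>. \<forall>s\<in>S. \<iota> s \<in> U"
proof -
  define N where "N S U = {\<iota> s \<otimes> u | s u. s \<in> S \<and> u \<in> U}" for S U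
  define \<B> where "\<B> = {N S U | S U. S \<in> \<S> \<and> nb U}"
  have bI: "N S U \<in> \<B>" if "S \<in> \<S>" "nb U" for S U using that by (auto simp: \<B>_def)
  have zero: "0 \<in> S" if "S \<in> \<S>" for S using base that by (auto simp: subset_base_def)
  have fb: "filter_base \<B>" unfolding filter_base_def
  proof (intro conjI ballI)
    show "\<B> \<noteq> {}" using base nb_UNIV by (auto simp: \<B>_def subset_base_def)
    fix B assume "B \<in> \<B>"
    then obtain S U where B: "B = N S U" "S \<in> \<S>" "nb U" by (auto simp: \<B>_def)
    show "B \<subseteq> carrier G" unfolding B N_def using nb_carrier[OF B(3)] by auto
    show "\<one> \<in> B" unfolding B N_def using zero[OF B(2)] nb_one[OF B(3)]
      by (intro CollectI exI[of _ 0] exI[of _ \<one>]) auto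
    obtain S' where S': "S' \<in> \<S>" "\<And>a b. a \<in> S' \<Longrightarrow> b \<in> S' \<Longrightarrow> a - b \<in> S"
      using base B(2) unfolding subset_base_def by meson
    obtain V where V: "nb V" "\<And>a b. a \<in> V \<Longrightarrow> b \<in> V \<Longrightarrow> a \<otimes> inv b \<in> U" using nb_diff[OF B(3)] by blast
    have "x \<otimes> inv y \<in> B" if xy: "x \<in> N S' V" "y \<in> N S' V" for x y
    proof -
      obtain s u t v where st: "x = \<iota> s \<otimes> u" "y = \<iota> t \<otimes> v" "s \<in> S'" "t \<in> S'" "u \<in> V" "v \<in> V"
        using xy by (auto simp: N_def)
      have "x \<otimes> inv y = \<iota> (s - t) \<otimes> (u \<otimes> inv v)"
        using st nb_carrier[OF V(1)] by (simp add: \<iota>_diff inv_mult m_ac)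
      then show ?thesis unfolding B N_def using S'(2) V(2) st by blast
    qed
    then show "\<exists>C\<in>\<B>. \<forall>x\<in>C. \<forall>y\<in>C. x \<otimes> inv y \<in> B" using bI[OF S'(1) V(1)] by blast
  next
    fix A B assume "A \<in> \<B>" "B \<in> \<B>"
    then obtain S U S' U' where AB: "A = N S U" "S \<in> \<S>" "nb U" "B = N S' U'" "S' \<in> \<S>" "nb U'" by (auto simp: \<B>_def)
    obtain S'' where "S'' \<in> \<S>" "S'' \<subseteq> S \<inter> S'" using base AB unfolding subset_base_def by meson
    then show "\<exists>C\<in>\<B>. C \<subseteq> A \<inter> B" using bI[of S'' "U \<inter> U'"] nb_Int[OF AB(3,6)]
      unfolding AB(1,4) by (intro bexI[of _ "N S'' (U \<inter> U')"]) (auto simp: N_def)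
  qed
  have "Hausdorff_group_topology G (base_topology \<B>)"
  proof (rule Hausdorff_base_topology[OF fb])
    fix g assume g: "g \<in> carrier G" "g \<noteq> \<one>"
    obtain S U where SU: "S \<in> \<S>" "nb U" "\<And>s. s \<in> S \<Longrightarrow> inv (\<iota> s) \<otimes> g \<notin> U" using sep[OF g] by blast
    have "g \<notin> N S U"
    proof
      assume "g \<in> N S U"
      then obtain s u where su: "s \<in> S" "u \<in> U" "g = \<iota> s \<otimes> u" by (auto simp: N_def)
      then show False using SU(3)[OF su(1)] nb_carrier[OF SU(2) su(2)] by (simp add: inv_mult_cancel_left')
    qed
    then show "\<exists>B\<in>\<B>. g \<notin> B" using bI[OF SU(1,2)] by blast
  qed
  moreover have "openin T O'" if O: "openin (base_topology \<B>) O'" for O'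
  proof (subst openin_subopen, intro ballI)
    fix x assume x: "x \<in> O'"
    have xc: "x \<in> carrier G" using O x unfolding openin_base_topology[OF fb] by auto
    obtain B where B: "B \<in> \<B>" "\<And>b. b \<in> B \<Longrightarrow> x \<otimes> b \<in> O'" using O x unfolding openin_base_topology[OF fb] by blast
    then obtain S U where SU: "B = N S U" "S \<in> \<S>" "nb U" by (auto simp: \<B>_def)
    let ?V = "{y \<in> carrier G. inv x \<otimes> y \<in> U}"
    have "openin T ?V" using SU(3) xc by (intro open_translate) (auto simp: nb_def)
    moreover have "x \<in> ?V" using xc nb_one[OF SU(3)] by simp
    moreover have "y \<in> O'" if "y \<in> ?V" for y
    proof -
      have "\<iota> 0 \<otimes> (inv x \<otimes> y) \<in> B" unfolding SU N_def using zero[OF SU(2)] that by blast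
      from B(2)[OF this] show ?thesis using that xc by (simp add: inv_mult_cancel_left)
    qed
    ultimately show "\<exists>V. openin T V \<and> x \<in> V \<and> V \<subseteq> O'" by blast
  qed
  ultimately have "base_topology \<B> = T" using minimal unfolding minimal_group_topology_def by auto
  then have "openin (base_topology \<B>) U" "\<one> \<in> U" using U by (auto simp: nb_def)
  then obtain B where B: "B \<in> \<B>" "\<And>b. b \<in> B \<Longrightarrow> \<one> \<otimes> b \<in> U" unfolding openin_base_topology[OF fb] by blast
  then obtain S V where SV: "B = N S V" "S \<in> \<S>" "nb V" by (auto simp: \<B>_def)
  have "\<iota> s \<in> U" if "s \<in> S" for s
  proof -
    have "\<iota> s \<otimes> \<one> \<in> B" unfolding SV N_def using that nb_one[OF SV(3)] by blast
    from B(2)[OF this] show ?thesis by simp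
  qed
  then show ?thesis using SV(2) by blast
qed

end

section \<open>Total boundedness of multiples\<close>

text \<open>
If finitely many translates of the difference set of S j do not cover the group, some h moves all
translates of S j in the covering off themselves. Shifting the remaining sets by h therefore
covers what S j covered, and S j can be dropped.
\<close>

lemma ex_difference_set_covering:
  fixes S :: "'i \<Rightarrow> 'h::ab_group_add set"
  assumes "finite I" "finite F" "\<And>a. \<exists>i\<in>I. \<exists>x\<in>F. a - x \<in> S i"
  shows "\<exists>i\<in>I. \<exists>Y. finite Y \<and> (\<forall>a. \<exists>y\<in>Y. \<exists>s\<in>S i. \<exists>s'\<in>S i. a - y = s - s')"
  using assms
proof (induction I arbitrary: F)
  case (insert j I)
  show ?case
  proof (cases "\<exists>Y. finite Y \<and> (\<forall>a. \<exists>y\<in>Y. \<exists>s\<in>S j. \<exists>s'\<in>S j. a - y = s - s')")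
    case False
    let ?Y = "(\<lambda>(x, y). x - y) ` (F \<times> F)"
    have "finite ?Y" using insert.prems(1) by auto
    then obtain h where h: "\<And>y s s'. y \<in> ?Y \<Longrightarrow> s \<in> S j \<Longrightarrow> s' \<in> S j \<Longrightarrow> h - y \<noteq> s - s'"
      using False by meson
    have cov: "\<exists>i\<in>I. \<exists>x\<in>F \<union> (\<lambda>x. x - h) ` F. a - x \<in> S i" for a
    proof -
      obtain i x where ix: "i \<in> insert j I" "x \<in> F" "a - x \<in> S i" using insert.prems(2) by blast
      obtain k y where ky: "k \<in> insert j I" "y \<in> F" "a + h - y \<in> S k" using insert.prems(2) by blast
      show ?thesis
      proof (cases "i \<in> I")
        case True then show ?thesis using ix by blast
      next
        case iF: False
        then have ij: "i = j" using ix by auto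
        show ?thesis
        proof (cases "k \<in> I")
          case True
          have "a - (y - h) \<in> S k" using ky(3) by (simp add: algebra_simps)
          then show ?thesis using True ky(2) by blast
        next
          case False
          then have "k = j" using ky by auto
          then have "h - (y - x) \<noteq> (a + h - y) - (a - x)"
            using h[of "y - x" "a + h - y" "a - x"] ix ky ij by force
          then show ?thesis by simp
        qed
      qed
    qed
    have "finite (F \<union> (\<lambda>x. x - h) ` F)" using insert.prems(1) by auto
    from insert.IH[OF this cov] show ?thesis by blast
  qed blast
qed auto

lemma countable_int_poly: "countable (UNIV :: int poly set)"
proof -
  have "(UNIV :: int poly set) \<subseteq> range Poly" using Poly_coeffs by (metis rangeI subsetI)
  moreover have "countable (range (Poly :: int list \<Rightarrow> int poly))" by (rule countable_image) simp
  ultimately show ?thesis using countable_subset by blast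
qed

locale poly_into_minimal = hom_into_minimal G T \<iota>
  for G :: "('a, 'b) monoid_scheme" (structure) and T and \<iota> :: "int poly \<Rightarrow> 'a"
begin

text \<open>
Combinations of the sequence a with coefficients bounded by q. If q tends to infinity, almost all
members of a belong to this set. The coefficients are extended by zero so that combinations of
different lengths can be subtracted.
\<close>

definition slow_sums :: "(nat \<Rightarrow> int poly) \<Rightarrow> (nat \<Rightarrow> nat) \<Rightarrow> int poly set" where
  "slow_sums a q = {s. \<exists>n c. (\<forall>i. \<bar>c i\<bar> \<le> int (q i)) \<and> (\<forall>i\<ge>n. c i = 0) \<and> s = (\<Sum>i<n. smult (c i) (a i))}"

definition to_infinity :: "(nat \<Rightarrow> nat) \<Rightarrow> bool" where
  "to_infinity q \<longleftrightarrow> (\<forall>K. \<exists>N. \<forall>i\<ge>N. K \<le> q i)"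

lemma subset_base_slow_sums: "subset_base {slow_sums a q | q. to_infinity q}"
  unfolding subset_base_def
proof (intro conjI ballI)
  have "to_infinity id" by (auto simp: to_infinity_def)
  then show "{slow_sums a q | q. to_infinity q} \<noteq> {}" by blast
  fix S assume "S \<in> {slow_sums a q | q. to_infinity q}"
  then obtain q where q: "S = slow_sums a q" "to_infinity q" by blast
  show "0 \<in> S" unfolding q slow_sums_def by (intro CollectI exI[of _ 0] exI[of _ "\<lambda>_. 0"]) auto
  have half: "to_infinity (\<lambda>i. q i div 2)" unfolding to_infinity_def
  proof
    fix K
    obtain N where "\<forall>i\<ge>N. 2 * K \<le> q i" using q(2) unfolding to_infinity_def by blast
    then show "\<exists>N. \<forall>i\<ge>N. K \<le> q i div 2" by (intro exI[of _ N]) (auto simp: less_eq_div_iff_mult_less_eq mult.commute)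
  qed
  have "s - t \<in> S" if st: "s \<in> slow_sums a (\<lambda>i. q i div 2)" "t \<in> slow_sums a (\<lambda>i. q i div 2)" for s t
  proof -
    obtain n c m d where c: "\<And>i. \<bar>c i\<bar> \<le> int (q i div 2)" "\<And>i. n \<le> i \<Longrightarrow> c i = 0" "s = (\<Sum>i<n. smult (c i) (a i))"
      and d: "\<And>i. \<bar>d i\<bar> \<le> int (q i div 2)" "\<And>i. m \<le> i \<Longrightarrow> d i = 0" "t = (\<Sum>i<m. smult (d i) (a i))"
      using st unfolding slow_sums_def by blast
    have "s = (\<Sum>i<max n m. smult (c i) (a i))" unfolding c(3)
      by (rule sum.mono_neutral_left) (auto simp: c(2))
    moreover have "t = (\<Sum>i<max n m. smult (d i) (a i))" unfolding d(3)
      by (rule sum.mono_neutral_left) (auto simp: d(2))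
    ultimately have "s - t = (\<Sum>i<max n m. smult (c i - d i) (a i))"
      by (simp add: sum_subtractf smult_diff_left)
    moreover have "\<bar>c i - d i\<bar> \<le> int (q i)" for i using c(1)[of i] d(1)[of i] by linarith
    ultimately show ?thesis unfolding q slow_sums_def
      by (intro CollectI exI[of _ "max n m"] exI[of _ "\<lambda>i. c i - d i"]) (auto simp: c(2) d(2))
  qed
  then show "\<exists>S'\<in>{slow_sums a q | q. to_infinity q}. \<forall>s\<in>S'. \<forall>t\<in>S'. s - t \<in> S" using half by blast
next
  fix S S' assume "S \<in> {slow_sums a q | q. to_infinity q}" "S' \<in> {slow_sums a q | q. to_infinity q}"
  then obtain q q' where q: "S = slow_sums a q" "to_infinity q" "S' = slow_sums a q'" "to_infinity q'" by blast
  have "to_infinity (\<lambda>i. min (q i) (q' i))" unfolding to_infinity_def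
  proof
    fix K
    obtain N N' where "\<forall>i\<ge>N. K \<le> q i" "\<forall>i\<ge>N'. K \<le> q' i" using q unfolding to_infinity_def by blast
    then show "\<exists>N. \<forall>i\<ge>N. K \<le> min (q i) (q' i)" by (intro exI[of _ "max N N'"]) auto
  qed
  moreover have "slow_sums a (\<lambda>i. min (q i) (q' i)) \<subseteq> S \<inter> S'"
    unfolding q slow_sums_def by (auto 4 4 simp: of_nat_min)
  ultimately show "\<exists>S''\<in>{slow_sums a q | q. to_infinity q}. S'' \<subseteq> S \<inter> S'" by blast
qed

text \<open>
Multiples that are trivial on the whole image are harmless in combinations of a sequence; C is the set
of the other coefficients. If c times the image is not totally bounded for any c in C, then by
ex_difference_set_covering every finite set of targets can be avoided simultaneously by all multiples
c a with c in C and |c| \<le> m. A sequence chosen in this way meets the hypothesis of minimality,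
since every point of the closure of the image is close to the image of one of the countably many
polynomials h j, but it does not tend to the identity.
\<close>

lemma multiple_precompact:
  assumes U: "nb U" and nontriv: "\<exists>f. \<iota> f \<noteq> \<one>"
  shows "\<exists>c. (\<exists>f. \<iota> (smult c f) \<noteq> \<one>) \<and> (\<exists>X. finite X \<and> (\<forall>f. \<exists>x\<in>X. \<iota> (smult c f - x) \<in> U))"
proof (rule ccontr)
  assume contra: "\<not> ?thesis"
  define C where "C = {c. \<exists>f. \<iota> (smult c f) \<noteq> \<one>}"
  have nocov: "\<exists>f. \<forall>x\<in>X. \<iota> (smult c f - x) \<notin> U" if "c \<in> C" "finite X" for c X
    using contra that unfolding C_def by blast
  have oneC: "1 \<in> C" and zeroC: "0 \<notin> C" using nontriv by (auto simp: C_def)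
  obtain V where V: "nb V" "\<And>x y. x \<in> V \<Longrightarrow> y \<in> V \<Longrightarrow> x \<otimes> inv y \<in> U" using nb_diff[OF U] by blast
  obtain W where W: "nb W" "\<And>x y. x \<in> W \<Longrightarrow> y \<in> W \<Longrightarrow> x \<otimes> inv y \<in> V" using nb_diff[OF V(1)] by blast
  define far where "far m Y a \<longleftrightarrow> (\<forall>c\<in>C. \<bar>c\<bar> \<le> int m \<longrightarrow> (\<forall>y\<in>Y. \<iota> (smult c a - y) \<notin> W))" for m Y a
  have ex_far: "\<exists>a. far m Y a" if Y: "finite Y" for m Y
  proof (rule ccontr)
    assume "\<nexists>a. far m Y a"
    then have near: "\<exists>c\<in>C. \<bar>c\<bar> \<le> int m \<and> (\<exists>y\<in>Y. \<iota> (smult c a - y) \<in> W)" for a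
      unfolding far_def by blast
    define I where "I = {c\<in>C. \<bar>c\<bar> \<le> int m}"
    have "I \<subseteq> {- int m..int m}" by (auto simp: I_def)
    then have finI: "finite I" by (rule finite_subset) simp
    define p where "p = (\<lambda>(c, y). SOME a. \<iota> (smult c a - y) \<in> W)"
    define S where "S c = {a. \<iota> (smult c a) \<in> V}" for c
    have "\<exists>c\<in>I. \<exists>x\<in>p ` (I \<times> Y). a - x \<in> S c" for a
    proof -
      obtain c y where cy: "c \<in> I" "y \<in> Y" "\<iota> (smult c a - y) \<in> W" using near[of a] by (auto simp: I_def)
      then have "\<iota> (smult c (p (c, y)) - y) \<in> W" unfolding p_def by (auto intro: someI)
      then have "\<iota> (smult c a - y) \<otimes> inv (\<iota> (smult c (p (c, y)) - y)) \<in> V" by (intro W(2) cy)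
      then have "\<iota> ((smult c a - y) - (smult c (p (c, y)) - y)) \<in> V" by (simp only: \<iota>_diff)
      then have "\<iota> (smult c (a - p (c, y))) \<in> V" by (simp add: smult_diff_right)
      then show ?thesis using cy by (auto simp: S_def intro!: bexI[of _ c] bexI[of _ "(c, y)"])
    qed
    from ex_difference_set_covering[OF finI _ this] Y finI
    obtain c Z where c: "c \<in> I" "finite Z" and Z: "\<And>a. \<exists>z\<in>Z. \<exists>s\<in>S c. \<exists>s'\<in>S c. a - z = s - s'" by (auto 4 4)
    obtain f where f: "\<And>x. x \<in> smult c ` Z \<Longrightarrow> \<iota> (smult c f - x) \<notin> U"
      using nocov[of c "smult c ` Z"] c by (auto simp: I_def)
    obtain z s s' where zs: "z \<in> Z" "s \<in> S c" "s' \<in> S c" "f - z = s - s'" using Z by blast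
    have "\<iota> (smult c s) \<otimes> inv (\<iota> (smult c s')) \<in> U" using zs by (intro V(2)) (auto simp: S_def)
    then have "\<iota> (smult c (s - s')) \<in> U" by (simp only: \<iota>_diff smult_diff_right)
    then have "\<iota> (smult c f - smult c z) \<in> U" unfolding zs(4)[symmetric] by (simp add: smult_diff_right)
    then show False using f zs(1) by blast
  qed
  obtain h :: "nat \<Rightarrow> int poly" where h: "range h = UNIV"
    using countable_int_poly by (metis UNIV_not_empty range_from_nat_into)
  define targets where "targets m E = insert 0 {h j - e | j e. j \<le> m \<and> e \<in> E}" for m :: nat and E
  define pick where "pick m E = (SOME a. far m (targets m E) a)" for m E
  \<comment> \<open>E m consists of the combinations of the first m terms in which the i-th coefficient is at most i.\<close>
  define E where "E = rec_nat {0} (\<lambda>m E. (\<lambda>(e, c). e + smult c (pick m E)) ` (E \<times> {- int m..int m}))"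
  define a where "a m = pick m (E m)" for m
  have E0: "E 0 = {0}" and ES: "E (Suc m) = (\<lambda>(e, c). e + smult c (a m)) ` (E m \<times> {- int m..int m})" for m
    by (simp_all add: E_def a_def)
  have finE: "finite (E m)" for m by (induction m) (auto simp: E0 ES)
  have "far m (targets m (E m)) (a m)" for m
  proof -
    have "{h j - e | j e. j \<le> m \<and> e \<in> E m} = (\<lambda>(j, e). h j - e) ` ({..m} \<times> E m)" by auto
    then have "finite (targets m (E m))" using finE by (simp add: targets_def)
    from ex_far[OF this] show ?thesis unfolding a_def pick_def by (rule someI_ex)
  qed
  then have far: "\<iota> (smult c (a m) - y) \<notin> W" if "c \<in> C" "\<bar>c\<bar> \<le> int m" "y \<in> targets m (E m)" for c m y
    using that unfolding far_def by blast
  define qq where "qq j i = (if i < j then 0 else i)" for j i :: nat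
  have qq: "to_infinity (qq j)" for j unfolding to_infinity_def
  proof
    fix K show "\<exists>N. \<forall>i\<ge>N. K \<le> qq j i" by (intro exI[of _ "max K j"]) (auto simp: qq_def)
  qed
  \<comment> \<open>The last term with a coefficient in C keeps the whole sum away from h j.\<close>
  have partial: "(\<Sum>i<n. smult (c i) (a i)) \<in> E n \<and>
    (\<iota> (\<Sum>i<n. smult (c i) (a i)) = \<one> \<or> \<iota> ((\<Sum>i<n. smult (c i) (a i)) - h j) \<notin> W)"
    if c: "\<And>i. \<bar>c i\<bar> \<le> int (qq j i)" for n c j
  proof (induction n)
    case (Suc n)
    let ?s = "\<Sum>i<n. smult (c i) (a i)"
    have cn: "\<bar>c n\<bar> \<le> int n" using c[of n] by (auto simp: qq_def split: if_splits)
    have "?s + smult (c n) (a n) \<in> E (Suc n)"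
      unfolding ES using Suc cn by (intro image_eqI[of _ _ "(?s, c n)"]) (auto simp: abs_le_iff)
    moreover have "\<iota> (?s + smult (c n) (a n)) = \<one> \<or> \<iota> (?s + smult (c n) (a n) - h j) \<notin> W"
    proof (cases "c n \<in> C")
      case True
      then have "c n \<noteq> 0" using zeroC by auto
      then have "j \<le> n" using c[of n] by (auto simp: qq_def split: if_splits)
      then have "h j - ?s \<in> targets n (E n)" using Suc by (auto simp: targets_def)
      from far[OF True cn this] have "\<iota> (smult (c n) (a n) - (h j - ?s)) \<notin> W" .
      then show ?thesis by (simp add: algebra_simps)
    next
      case False
      then have "\<iota> (smult (c n) (a n)) = \<one>" by (auto simp: C_def)
      then have "\<iota> (?s + smult (c n) (a n)) = \<iota> ?s" "\<iota> (?s + smult (c n) (a n) - h j) = \<iota> (?s - h j)"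
        by (simp_all add: \<iota>_add \<iota>_diff)
      then show ?thesis using Suc by simp
    qed
    ultimately show ?case by simp
  qed (simp add: E0)
  have dich: "\<iota> s = \<one> \<or> \<iota> (s - h j) \<notin> W" if "s \<in> slow_sums a (qq j)" for s j
    using that partial unfolding slow_sums_def by blast
  have "\<exists>S\<in>{slow_sums a q | q. to_infinity q}. \<forall>s\<in>S. \<iota> s \<in> W"
  proof (rule minimality[OF subset_base_slow_sums _ W(1)])
    fix g assume g: "g \<in> carrier G" "g \<noteq> \<one>"
    obtain V' where V': "nb V'" "\<And>x y. x \<in> V' \<Longrightarrow> y \<in> V' \<Longrightarrow> x \<otimes> inv y \<in> W" using nb_diff[OF W(1)] by blast
    obtain Ug where Ug: "nb Ug" "g \<notin> Ug" using nb_sep[OF g] by blast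
    \<comment> \<open>A point in the closure of the image is close to some h j. For the other points any of the sets works.\<close>
    show "\<exists>S\<in>{slow_sums a q | q. to_infinity q}. \<exists>U. nb U \<and> (\<forall>s\<in>S. inv (\<iota> s) \<otimes> g \<notin> U)"
    proof (cases "\<exists>j. inv (\<iota> (h j)) \<otimes> g \<in> V'")
      case True
      then obtain j where j: "inv (\<iota> (h j)) \<otimes> g \<in> V'" by blast
      have "inv (\<iota> s) \<otimes> g \<notin> V' \<inter> Ug" if s: "s \<in> slow_sums a (qq j)" for s
      proof
        assume mem: "inv (\<iota> s) \<otimes> g \<in> V' \<inter> Ug"
        then have "\<iota> s \<noteq> \<one>" using Ug g by auto
        then have "\<iota> (s - h j) \<notin> W" using dich[OF s] by blast
        moreover have "(inv (\<iota> (h j)) \<otimes> g) \<otimes> inv (inv (\<iota> s) \<otimes> g) \<in> W" using j mem by (intro V'(2)) auto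
        ultimately show False by (simp add: quotient_translates[OF g(1)])
      qed
      then show ?thesis using nb_Int[OF V'(1) Ug(1)] qq by blast
    next
      case False
      have "inv (\<iota> s) \<otimes> g \<notin> V'" for s using False h by (metis UNIV_I imageE)
      then show ?thesis using V'(1) qq by blast
    qed
  qed
  then obtain q where q: "to_infinity q" "\<And>s. s \<in> slow_sums a q \<Longrightarrow> \<iota> s \<in> W" by blast
  obtain N where N: "\<And>i. N \<le> i \<Longrightarrow> 1 \<le> q i" using q(1) unfolding to_infinity_def by blast
  let ?m = "Suc N"
  have "a ?m \<in> slow_sums a q" unfolding slow_sums_def
    using N[of ?m]
    by (intro CollectI exI[of _ "Suc ?m"] exI[of _ "\<lambda>i. if i = ?m then 1 else 0"])
       (auto simp: sum.neutral)
  then have "\<iota> (a ?m) \<in> W" by (rule q(2))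
  moreover have "\<iota> (smult 1 (a ?m) - 0) \<notin> W" using oneC by (intro far) (auto simp: targets_def)
  ultimately show False by simp
qed

end

section \<open>Null sequences from continuous characters\<close>

lemma lin_additive: "additive_map (lin \<theta>)"
  by (simp add: additive_map_def lin_add)

lemma bohr_mono: "D \<subseteq> D' \<Longrightarrow> \<delta> \<le> \<epsilon> \<Longrightarrow> bohr D' \<delta> \<subseteq> bohr D \<epsilon>"
  by (fastforce simp: bohr_def)

definition bohr_base :: "('h \<Rightarrow> real) set \<Rightarrow> 'h set set" where
  "bohr_base \<Delta> = {bohr D \<epsilon> | D \<epsilon>. finite D \<and> D \<subseteq> \<Delta> \<and> 0 < \<epsilon>}"

lemma bohr_baseI: "\<lbrakk>finite D; D \<subseteq> \<Delta>; 0 < \<epsilon>\<rbrakk> \<Longrightarrow> bohr D \<epsilon> \<in> bohr_base \<Delta>"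
  unfolding bohr_base_def by blast

text \<open>
The characters that are continuous for the topology generated by D.
\<close>

definition induced_characters :: "('h::ab_group_add \<Rightarrow> real) set \<Rightarrow> ('h \<Rightarrow> real) set" where
  "induced_characters D = {q. additive_map q \<and> (\<forall>\<epsilon>>0. \<exists>\<delta>>0. \<forall>f\<in>bohr D \<delta>. norm (ec (q f) - 1) < \<epsilon>)}"

lemma induced_characters_mono: "D \<subseteq> D' \<Longrightarrow> induced_characters D \<subseteq> induced_characters D'"
  unfolding induced_characters_def using bohr_mono[of D D'] by blast

lemma induced_characters_superset: "q \<in> D \<Longrightarrow> additive_map q \<Longrightarrow> q \<in> induced_characters D"
  unfolding induced_characters_def by (auto simp: bohr_def)

lemma integral_induced: "additive_map q \<Longrightarrow> (\<And>f. q f \<in> \<int>) \<Longrightarrow> q \<in> induced_characters D"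
  unfolding induced_characters_def by (auto simp: ec_eq_1_iff[THEN iffD2] intro!: exI[of _ 1])

lemma additive_map_diff_fun: "additive_map p \<Longrightarrow> additive_map q \<Longrightarrow> additive_map (p - q)"
  by (simp add: additive_map_def)

lemma subgrp_induced_characters: "subgrp (induced_characters D)"
  unfolding subgrp_def
proof (intro conjI ballI)
  show "0 \<in> induced_characters D" by (rule integral_induced) (auto simp: additive_map_def)
  fix p q assume pq: "p \<in> induced_characters D" "q \<in> induced_characters D"
  then have add: "additive_map p" "additive_map q" by (auto simp: induced_characters_def)
  show "p - q \<in> induced_characters D" unfolding induced_characters_def
  proof (intro CollectI conjI allI impI)
    show "additive_map (p - q)" using add by (rule additive_map_diff_fun)
    fix \<epsilon> :: real assume "0 < \<epsilon>"
    then have "0 < \<epsilon>/2" by simp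
    then have "\<exists>\<delta>>0. \<forall>f\<in>bohr D \<delta>. norm (ec (p f) - 1) < \<epsilon>/2"
      "\<exists>\<delta>>0. \<forall>f\<in>bohr D \<delta>. norm (ec (q f) - 1) < \<epsilon>/2"
      using pq unfolding induced_characters_def by blast+
    then obtain d d' where d: "0 < d" "\<And>f. f \<in> bohr D d \<Longrightarrow> norm (ec (p f) - 1) < \<epsilon>/2"
      "0 < d'" "\<And>f. f \<in> bohr D d' \<Longrightarrow> norm (ec (q f) - 1) < \<epsilon>/2"
      by blast
    have "norm (ec ((p - q) f) - 1) < \<epsilon>" if f: "f \<in> bohr D (min d d')" for f
    proof -
      have "f \<in> bohr D d" "f \<in> bohr D d'" using f by (auto simp: bohr_def)
      then show ?thesis using d(2,4)[of f] norm_ec_diff[of "p f" "q f"] by simp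
    qed
    then show "\<exists>\<delta>>0. \<forall>f\<in>bohr D \<delta>. norm (ec ((p - q) f) - 1) < \<epsilon>"
      using d(1,3) by (intro exI[of _ "min d d'"]) auto
  qed
qed

definition (in minimal_abelian_group) null_sequence :: "(nat \<Rightarrow> 'a) \<Rightarrow> bool" where
  "null_sequence y \<longleftrightarrow> (\<forall>n. y n \<in> carrier G \<and> y n \<noteq> \<one>) \<and> (\<forall>U. nb U \<longrightarrow> (\<exists>N. \<forall>n\<ge>N. y n \<in> U))"

context poly_into_minimal begin

definition precompact_image :: bool where
  "precompact_image \<longleftrightarrow> (\<forall>U. nb U \<longrightarrow> (\<exists>X. finite X \<and> (\<forall>f. \<exists>x\<in>X. \<iota> (f - x) \<in> U)))"

text \<open>
Exponents of the continuous characters. Maps with integer values represent the trivial character.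
\<close>

definition cont_characters :: "(int poly \<Rightarrow> real) set" where
  "cont_characters = {q. additive_map q \<and> (\<forall>\<epsilon>>0. \<exists>U. nb U \<and> (\<forall>f. \<iota> f \<in> U \<longrightarrow> norm (ec (q f) - 1) < \<epsilon>))}"

text \<open>
The point g need not lie in the image of \<iota>. If it lies in the closure of the image, it is
approximated by \<iota> h with h outside v 0, and the character that separates h from 0 also
separates all w with \<iota> w close to g, because the constant \<kappa> does not depend on h.
\<close>

lemma cont_characters_separate:
  assumes pc: precompact_image and g: "g \<in> carrier G" "g \<noteq> \<one>"
  shows "\<exists>q\<in>cont_characters. \<exists>\<epsilon>>0. \<exists>U. nb U \<and> (\<forall>w. norm (ec (q w) - 1) < \<epsilon> \<longrightarrow> inv (\<iota> w) \<otimes> g \<notin> U)"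
proof -
  obtain Ug where Ug: "nb Ug" "g \<notin> Ug" using nb_sep[OF g] by blast
  obtain W where W0: "W 0 = Ug" and nbW: "\<And>n. nb (W n)"
    and symW: "\<And>a n. a \<in> W (Suc n) \<Longrightarrow> inv a \<in> W (Suc n)"
    and tripleW: "\<And>a b c n. \<lbrakk>a \<in> W (Suc n); b \<in> W (Suc n); c \<in> W (Suc n)\<rbrakk> \<Longrightarrow> a \<otimes> b \<otimes> c \<in> W n"
    and decW: "\<And>m n. m \<le> n \<Longrightarrow> W n \<subseteq> W m"
    using ex_neighbourhood_sequence[of Ug "\<lambda>_. \<one>", OF Ug(1) one_closed] by metis
  define V where "V n = W (Suc n)" for n
  have nbV: "nb (V n)" for n by (simp add: V_def nbW)
  have symV: "inv x \<in> V n" if "x \<in> V n" for x n using that symW by (simp add: V_def)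
  have triple0: "x \<otimes> y \<otimes> z \<in> Ug" if "x \<in> V 0" "y \<in> V 0" "z \<in> V 0" for x y z
    using tripleW[of x 0 y z] that by (simp add: V_def W0)
  have tripleS: "x \<otimes> y \<otimes> z \<in> V n" if "x \<in> V (Suc n)" "y \<in> V (Suc n)" "z \<in> V (Suc n)" for x y z n
    using tripleW that by (simp add: V_def)
  define v where "v n = {f. \<iota> f \<in> V n}" for n
  have "\<exists>\<rho>. bounded_pseudonorm \<rho> \<and> (\<forall>n. \<forall>x\<in>v n. \<rho> x \<le> (1/2) ^ n) \<and> (\<forall>x. \<rho> x < 1 \<longrightarrow> x \<in> v 0)"
  proof (rule birkhoff_kakutani_pseudonorm)
    fix n show "0 \<in> v n" using nb_one[OF nbV] by (simp add: v_def)
    fix x show "x \<in> v n \<Longrightarrow> - x \<in> v n" using symV by (simp add: v_def \<iota>_minus)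
    fix y z show "\<lbrakk>x \<in> v (Suc n); y \<in> v (Suc n); z \<in> v (Suc n)\<rbrakk> \<Longrightarrow> x + y + z \<in> v n"
      using tripleS by (simp add: v_def \<iota>_add)
  qed
  then obtain \<rho> where rho: "bounded_pseudonorm \<rho>" "\<And>n x. x \<in> v n \<Longrightarrow> \<rho> x \<le> (1/2) ^ n"
    "\<And>x. \<rho> x < 1 \<Longrightarrow> x \<in> v 0" by blast
  interpret bounded_pseudonorm \<rho> by (rule rho(1))
  interpret poly_pseudonorm \<rho>
  proof
    fix \<eta> :: real assume "0 < \<eta>"
    then obtain n where n: "(1/2) ^ n < \<eta>" using real_arch_pow_inv[of \<eta> "1/2"] by auto
    obtain X where X: "finite X" "\<And>f. \<exists>x\<in>X. \<iota> (f - x) \<in> V n"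
      using pc nbV[of n] unfolding precompact_image_def by blast
    have "\<exists>x\<in>X. \<rho> (f - x) \<le> \<eta>" for f
    proof -
      obtain x where "x \<in> X" "f - x \<in> v n" using X(2)[of f] by (auto simp: v_def)
      then show ?thesis using rho(2)[of "f - x" n] n by (intro bexI[of _ x]) auto
    qed
    then show "\<exists>X. finite X \<and> (\<forall>f. \<exists>x\<in>X. \<rho> (f - x) \<le> \<eta>)" using X(1) by blast
  qed
  obtain \<kappa> where k0: "\<kappa> > 0" and sep: "\<And>h. \<rho> h = 1 \<Longrightarrow>
    \<exists>\<theta>. (\<forall>f. \<kappa> * norm (ec (lin \<theta> f) - 1) \<le> 2 * \<rho> f) \<and> \<kappa> \<le> norm (ec (lin \<theta> h) - 1)"
    using separating_character by blast
  \<comment> \<open>On v m the character that separates h differs from 1 by less than half of \<kappa>.\<close>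
  have "0 < \<kappa> * (\<kappa> / 2) / 2" using k0 by simp
  then obtain m where "(1/2) ^ m < \<kappa> * (\<kappa> / 2) / 2"
    using real_arch_pow_inv[of "\<kappa> * (\<kappa> / 2) / 2" "1/2"] by auto
  then have m: "2 * (1/2) ^ m < \<kappa> * (\<kappa> / 2)" by simp
  show ?thesis
  proof (cases "\<exists>h. inv (\<iota> h) \<otimes> g \<in> V (Suc m)")
    case True
    then obtain h where h: "inv (\<iota> h) \<otimes> g \<in> V (Suc m)" by blast
    have "V (Suc m) \<subseteq> V 0" unfolding V_def by (rule decW) simp
    have "h \<notin> v 0"
    proof
      assume "h \<in> v 0"
      then have "\<iota> h \<otimes> (inv (\<iota> h) \<otimes> g) \<otimes> \<one> \<in> Ug"
        using h \<open>V (Suc m) \<subseteq> V 0\<close> nb_one[OF nbV[of 0]] by (intro triple0) (auto simp: v_def)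
      then show False using Ug(2) g by (simp add: inv_mult_cancel_left)
    qed
    then have "\<rho> h = 1" using rho(3)[of h] rho_le_1[of h] by linarith
    then obtain \<theta> where \<theta>: "\<And>f. \<kappa> * norm (ec (lin \<theta> f) - 1) \<le> 2 * \<rho> f" "\<kappa> \<le> norm (ec (lin \<theta> h) - 1)"
      using sep by blast
    have "lin \<theta> \<in> cont_characters" unfolding cont_characters_def
    proof (intro CollectI conjI allI impI lin_additive)
      fix \<epsilon> :: real assume e: "0 < \<epsilon>"
      then obtain n where n: "(1/2) ^ n < \<kappa> * \<epsilon> / 2" using real_arch_pow_inv[of "\<kappa> * \<epsilon> / 2" "1/2"] k0 by auto
      have "norm (ec (lin \<theta> f) - 1) < \<epsilon>" if "\<iota> f \<in> V n" for f
      proof -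
        have "\<kappa> * norm (ec (lin \<theta> f) - 1) < \<kappa> * \<epsilon>"
          using \<theta>(1)[of f] rho(2)[of f n] that n by (simp add: v_def)
        then show ?thesis using k0 by simp
      qed
      then show "\<exists>U. nb U \<and> (\<forall>f. \<iota> f \<in> U \<longrightarrow> norm (ec (lin \<theta> f) - 1) < \<epsilon>)" using nbV by blast
    qed
    moreover have "inv (\<iota> w) \<otimes> g \<notin> V (Suc m)" if w: "norm (ec (lin \<theta> w) - 1) < \<kappa> / 2" for w
    proof
      assume mem: "inv (\<iota> w) \<otimes> g \<in> V (Suc m)"
      have "(inv (\<iota> h) \<otimes> g) \<otimes> inv (inv (\<iota> w) \<otimes> g) \<otimes> \<one> \<in> V m"
        by (intro tripleS h symV[OF mem] nb_one[OF nbV])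
      then have "w - h \<in> v m" by (simp add: quotient_translates[OF g(1)] v_def)
      then have "\<kappa> * norm (ec (lin \<theta> (w - h)) - 1) < \<kappa> * (\<kappa> / 2)"
        using \<theta>(1)[of "w - h"] rho(2)[of "w - h" m] m by linarith
      then have "norm (ec (lin \<theta> (w - h)) - 1) < \<kappa> / 2" using k0 by simp
      moreover have "lin \<theta> h = lin \<theta> w - lin \<theta> (w - h)"
        using additive_map_diff[OF lin_additive, of \<theta> w "w - h"] by simp
      ultimately show False using norm_ec_diff[of "lin \<theta> w" "lin \<theta> (w - h)"] \<theta>(2) w by simp
    qed
    moreover have "0 < \<kappa> / 2" using k0 by simp
    ultimately show ?thesis using nbV[of "Suc m"] by blast
  next
    case False
    have "0 \<in> cont_characters" using nb_UNIV by (auto simp: cont_characters_def additive_map_def)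
    moreover have "(0::real) < 1" by simp
    ultimately show ?thesis using False nbV[of "Suc m"] by blast
  qed
qed

lemma bohr_is_nbhd:
  assumes "finite D" "D \<subseteq> cont_characters" "0 < \<epsilon>"
  shows "\<exists>U. nb U \<and> (\<forall>f. \<iota> f \<in> U \<longrightarrow> f \<in> bohr D \<epsilon>)"
  using assms(1,2)
proof (induction D)
  case empty
  then show ?case using nb_UNIV by (auto simp: bohr_def)
next
  case (insert q D)
  obtain U where U: "nb U" "\<And>f. \<iota> f \<in> U \<Longrightarrow> f \<in> bohr D \<epsilon>" using insert by auto
  obtain V where V: "nb V" "\<And>f. \<iota> f \<in> V \<Longrightarrow> norm (ec (q f) - 1) < \<epsilon>"
    using insert.prems assms(3) unfolding cont_characters_def by blast
  show ?case using nb_Int[OF U(1) V(1)] U(2) V(2) by (intro exI[of _ "U \<inter> V"]) (auto simp: bohr_def)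
qed

lemma induced_subset_cont:
  assumes "finite D" "D \<subseteq> cont_characters"
  shows "induced_characters D \<subseteq> cont_characters"
proof
  fix q assume q: "q \<in> induced_characters D"
  show "q \<in> cont_characters" unfolding cont_characters_def
  proof (intro CollectI conjI allI impI)
    show "additive_map q" using q by (simp add: induced_characters_def)
    fix \<epsilon> :: real assume "0 < \<epsilon>"
    then obtain \<delta> where "0 < \<delta>" "\<And>f. f \<in> bohr D \<delta> \<Longrightarrow> norm (ec (q f) - 1) < \<epsilon>"
      using q unfolding induced_characters_def by blast
    then show "\<exists>U. nb U \<and> (\<forall>f. \<iota> f \<in> U \<longrightarrow> norm (ec (q f) - 1) < \<epsilon>)"
      using bohr_is_nbhd[OF assms] by meson
  qed
qed

lemma subgrp_cont_characters: "subgrp cont_characters"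
  unfolding subgrp_def
proof (intro conjI ballI)
  show "0 \<in> cont_characters" using nb_UNIV by (auto simp: cont_characters_def additive_map_def)
  fix p q assume "p \<in> cont_characters" "q \<in> cont_characters"
  then have "p \<in> induced_characters {p, q}" "q \<in> induced_characters {p, q}" "{p, q} \<subseteq> cont_characters"
    by (auto intro!: induced_characters_superset simp: cont_characters_def)
  then show "p - q \<in> cont_characters"
    using subgrp_diff[OF subgrp_induced_characters] induced_subset_cont[of "{p, q}"] by blast
qed

lemma subset_base_bohr: "subset_base (bohr_base \<Delta>)"
  if \<Delta>: "\<And>q. q \<in> \<Delta> \<Longrightarrow> additive_map q"
  unfolding subset_base_def
proof (intro conjI ballI)
  have "bohr {} 1 \<in> bohr_base \<Delta>"
    by (intro bohr_baseI) auto
  then show "bohr_base \<Delta> \<noteq> {}" by blast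
  fix S assume "S \<in> bohr_base \<Delta>"
  then obtain D \<epsilon> where S: "S = bohr D \<epsilon>" "finite D" "D \<subseteq> \<Delta>" "0 < \<epsilon>"
    unfolding bohr_base_def by blast
  show "0 \<in> S" using S \<Delta> by (auto simp: bohr_def additive_map_zero)
  have "a - b \<in> S" if "a \<in> bohr D (\<epsilon>/2)" "b \<in> bohr D (\<epsilon>/2)" for a b
    unfolding S bohr_def
  proof (intro CollectI ballI)
    fix q assume q: "q \<in> D"
    then have "norm (ec (q a) - 1) < \<epsilon>/2" "norm (ec (q b) - 1) < \<epsilon>/2" using that by (auto simp: bohr_def)
    moreover have "q (a - b) = q a - q b" using q S \<Delta> by (auto intro: additive_map_diff)
    ultimately show "norm (ec (q (a - b)) - 1) < \<epsilon>" using norm_ec_diff[of "q a" "q b"] by simp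
  qed
  moreover have "0 < \<epsilon>/2" using S by simp
  ultimately show "\<exists>S'\<in>bohr_base \<Delta>. \<forall>a\<in>S'. \<forall>b\<in>S'. a - b \<in> S"
    using bohr_baseI[OF S(2,3)] by blast
next
  fix S S' assume "S \<in> bohr_base \<Delta>"
    "S' \<in> bohr_base \<Delta>"
  then obtain D \<epsilon> D' \<epsilon>' where S: "S = bohr D \<epsilon>" "finite D" "D \<subseteq> \<Delta>" "0 < \<epsilon>"
    and S': "S' = bohr D' \<epsilon>'" "finite D'" "D' \<subseteq> \<Delta>" "0 < \<epsilon>'"
    unfolding bohr_base_def by blast
  have "bohr (D \<union> D') (min \<epsilon> \<epsilon>') \<subseteq> S \<inter> S'"
    unfolding S(1) S'(1) by (intro Int_greatest bohr_mono) auto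
  moreover have "bohr (D \<union> D') (min \<epsilon> \<epsilon>') \<in> bohr_base \<Delta>"
    using S S' by (intro bohr_baseI) auto
  ultimately show "\<exists>S''\<in>bohr_base \<Delta>. S'' \<subseteq> S \<inter> S'" by blast
qed

text \<open>
The minimality principle for the topology generated by a set of continuous characters.
\<close>

lemma minimality_bohr:
  assumes \<Delta>: "\<Delta> \<subseteq> cont_characters"
    and sep: "\<And>g. g \<in> carrier G \<Longrightarrow> g \<noteq> \<one> \<Longrightarrow>
      \<exists>D \<epsilon> U. finite D \<and> D \<subseteq> \<Delta> \<and> 0 < \<epsilon> \<and> nb U \<and> (\<forall>s\<in>bohr D \<epsilon>. inv (\<iota> s) \<otimes> g \<notin> U)"
    and U: "nb U"
  shows "\<exists>D \<epsilon>. finite D \<and> D \<subseteq> \<Delta> \<and> 0 < \<epsilon> \<and> (\<forall>s\<in>bohr D \<epsilon>. \<iota> s \<in> U)"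
proof -
  have "\<exists>S\<in>bohr_base \<Delta>. \<forall>s\<in>S. \<iota> s \<in> U"
  proof (rule minimality[OF subset_base_bohr _ U])
    show "\<And>q. q \<in> \<Delta> \<Longrightarrow> additive_map q" using \<Delta> by (auto simp: cont_characters_def)
    fix g assume "g \<in> carrier G" "g \<noteq> \<one>"
    from sep[OF this] show "\<exists>S\<in>bohr_base \<Delta>. \<exists>U. nb U \<and> (\<forall>s\<in>S. inv (\<iota> s) \<otimes> g \<notin> U)"
      unfolding bohr_base_def by blast
  qed
  then show ?thesis unfolding bohr_base_def by blast
qed

text \<open>
If finitely many characters generate the topology of the image, it is first countable. Otherwise
choose continuous characters c n that are not continuous for the topology generated by their
predecessors and extend the resulting chain of subgroups to one that exhausts all continuous
characters. Since c n is not in \<Lambda> n, minimality supplies the point y n.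
\<close>

theorem ex_null_sequence_precompact:
  assumes pc: precompact_image and inf: "infinite (range \<iota>)"
  shows "\<exists>y. null_sequence y"
proof -
  have generate: "\<exists>D \<epsilon>. finite D \<and> D \<subseteq> cont_characters \<and> 0 < \<epsilon> \<and> (\<forall>s\<in>bohr D \<epsilon>. \<iota> s \<in> U)" if "nb U" for U
  proof (rule minimality_bohr[OF order_refl _ that])
    fix g assume g: "g \<in> carrier G" "g \<noteq> \<one>"
    obtain q \<epsilon> U where "q \<in> cont_characters" "0 < \<epsilon>" "nb U" "\<And>w. norm (ec (q w) - 1) < \<epsilon> \<Longrightarrow> inv (\<iota> w) \<otimes> g \<notin> U"
      using cont_characters_separate[OF pc g] by blast
    then show "\<exists>D \<epsilon> U. finite D \<and> D \<subseteq> cont_characters \<and> 0 < \<epsilon> \<and> nb U \<and> (\<forall>s\<in>bohr D \<epsilon>. inv (\<iota> s) \<otimes> g \<notin> U)"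
      by (intro exI[of _ "{q}"] exI[of _ \<epsilon>] exI[of _ U]) (auto simp: bohr_def)
  qed
  show ?thesis
  proof (cases "\<exists>D. finite D \<and> D \<subseteq> cont_characters \<and> cont_characters \<subseteq> induced_characters D")
    case True
    then obtain D where D: "finite D" "D \<subseteq> cont_characters" "cont_characters \<subseteq> induced_characters D" by blast
    have "\<exists>s\<in>bohr D (1 / Suc n). \<iota> s \<noteq> \<one>" for n
    proof (rule ccontr)
      assume triv: "\<not> ?thesis"
      obtain U where U: "nb U" "\<And>f. \<iota> f \<in> U \<Longrightarrow> f \<in> bohr D (1 / Suc n)"
        using bohr_is_nbhd[OF D(1,2), of "1 / Suc n"] by auto
      obtain X where X: "finite X" "\<And>f. \<exists>x\<in>X. \<iota> (f - x) \<in> U" using pc U(1) unfolding precompact_image_def by blast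
      have "\<iota> f \<in> \<iota> ` X" for f
      proof -
        obtain x where x: "x \<in> X" "\<iota> (f - x) \<in> U" using X(2) by blast
        then have "\<iota> (f - x) = \<one>" using U(2) triv by blast
        then have "\<iota> f = \<iota> x" using \<iota>_add[of "f - x" x] by simp
        then show ?thesis using x by blast
      qed
      then have "range \<iota> \<subseteq> \<iota> ` X" by blast
      then show False using inf X(1) finite_subset by blast
    qed
    then obtain s where s: "\<And>n. s n \<in> bohr D (1 / Suc n)" "\<And>n. \<iota> (s n) \<noteq> \<one>" by metis
    have "\<exists>N. \<forall>n\<ge>N. \<iota> (s n) \<in> U" if U: "nb U" for U
    proof -
      obtain D' \<epsilon> where D': "finite D'" "D' \<subseteq> cont_characters" "0 < \<epsilon>" "\<And>s. s \<in> bohr D' \<epsilon> \<Longrightarrow> \<iota> s \<in> U"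
        using generate[OF U] by blast
      have "\<exists>\<delta>>0. bohr D \<delta> \<subseteq> bohr D' \<epsilon>" using D'(1,2)
      proof (induction D')
        case empty show ?case by (intro exI[of _ 1]) (auto simp: bohr_def)
      next
        case (insert q D')
        then obtain \<delta> where \<delta>: "0 < \<delta>" "bohr D \<delta> \<subseteq> bohr D' \<epsilon>" by blast
        have "q \<in> induced_characters D" using insert.prems D(3) by blast
        then obtain \<delta>' where \<delta>': "0 < \<delta>'" "\<And>f. f \<in> bohr D \<delta>' \<Longrightarrow> norm (ec (q f) - 1) < \<epsilon>"
          using D'(3) unfolding induced_characters_def by blast
        have "bohr D (min \<delta> \<delta>') \<subseteq> bohr D \<delta>" "bohr D (min \<delta> \<delta>') \<subseteq> bohr D \<delta>'" by (rule bohr_mono; simp)+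
        then have "bohr D (min \<delta> \<delta>') \<subseteq> bohr (insert q D') \<epsilon>" using \<delta>(2) \<delta>'(2) by (fastforce simp: bohr_def)
        then show ?case using \<delta>(1) \<delta>'(1) by (intro exI[of _ "min \<delta> \<delta>'"]) auto
      qed
      then obtain \<delta> where \<delta>: "0 < \<delta>" "bohr D \<delta> \<subseteq> bohr D' \<epsilon>" by blast
      obtain N where N: "inverse (real (Suc N)) < \<delta>" using reals_Archimedean[OF \<delta>(1)] by blast
      have "\<iota> (s n) \<in> U" if "N \<le> n" for n
      proof -
        have "1 / Suc n \<le> inverse (real (Suc N))" using that by (simp add: field_simps)
        then have "bohr D (1 / Suc n) \<subseteq> bohr D \<delta>" using N by (intro bohr_mono) auto
        then show ?thesis using s(1) \<delta>(2) D'(4) by blast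
      qed
      then show ?thesis by blast
    qed
    then have "null_sequence (\<lambda>n. \<iota> (s n))" using s(2) by (auto simp: null_sequence_def)
    then show ?thesis by blast
  next
    case False
    define new where "new D = (SOME q. q \<in> cont_characters \<and> q \<notin> induced_characters D)" for D
    define D where "D n = ((\<lambda>E. insert (new E) E) ^^ n) {}" for n
    have D0: "D 0 = {}" and DS: "\<And>n. D (Suc n) = insert (new (D n)) (D n)"
      unfolding D_def by simp_all
    have new: "new D \<in> cont_characters \<and> new D \<notin> induced_characters D" if "finite D" "D \<subseteq> cont_characters" for D
    proof -
      have "\<not> cont_characters \<subseteq> induced_characters D" using False that by blast
      then have ex: "\<exists>q. q \<in> cont_characters \<and> q \<notin> induced_characters D" by (simp only: subset_iff not_all not_imp)
      show ?thesis using someI_ex[OF ex] unfolding new_def .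
    qed
    have D: "finite (D n) \<and> D n \<subseteq> cont_characters" for n
    proof (induction n)
      case (Suc n)
      then show ?case using new[of "D n"] by (simp add: DS)
    qed (simp add: D0)
    define c where "c n = new (D n)" for n
    have c: "c n \<in> cont_characters" "c n \<notin> induced_characters (D n)" "c n \<in> induced_characters (D (Suc n))" for n
    proof -
      show 1: "c n \<in> cont_characters" and "c n \<notin> induced_characters (D n)"
        using new[of "D n"] D[of n] unfolding c_def by simp_all
      have "additive_map (c n)" using 1 by (simp add: cont_characters_def)
      moreover have "c n \<in> D (Suc n)" by (simp add: DS c_def)
      ultimately show "c n \<in> induced_characters (D (Suc n))"
        by (intro induced_characters_superset)
    qed
    define C where "C n = induced_characters (D n)" for n
    have C: "subgrp (C n)" "C n \<subseteq> cont_characters" "C n \<subseteq> C (Suc n)" for n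
    proof -
      show "subgrp (C n)" unfolding C_def by (rule subgrp_induced_characters)
      show "C n \<subseteq> cont_characters" unfolding C_def
        by (rule induced_subset_cont) (simp_all add: D)
      show "C n \<subseteq> C (Suc n)" unfolding C_def
        by (rule induced_characters_mono) (simp add: DS subset_insertI)
    qed
    obtain \<Lambda> where all: "\<forall>n. subgrp (\<Lambda> n) \<and> C n \<subseteq> \<Lambda> n \<and> \<Lambda> n \<subseteq> \<Lambda> (Suc n) \<and> \<Lambda> n \<inter> (\<Union>m. C m) \<subseteq> C n"
      and union: "(\<Union>n. \<Lambda> n) = cont_characters"
    proof -
      have "\<exists>\<Lambda>. (\<forall>n. subgrp (\<Lambda> n) \<and> C n \<subseteq> \<Lambda> n \<and> \<Lambda> n \<subseteq> \<Lambda> (Suc n) \<and> \<Lambda> n \<inter> (\<Union>m. C m) \<subseteq> C n)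
          \<and> (\<Union>n. \<Lambda> n) = cont_characters"
        by (rule extend_chain_of_subgroups[of cont_characters C, OF subgrp_cont_characters C])
      then show ?thesis using that by (elim exE conjE)
    qed
    have \<Lambda>: "subgrp (\<Lambda> n)" "induced_characters (D n) \<subseteq> \<Lambda> n" "\<Lambda> n \<subseteq> \<Lambda> (Suc n)" "\<Lambda> n \<inter> (\<Union>m. C m) \<subseteq> C n" for n
      using all unfolding C_def by simp_all
    have sub: "\<Lambda> n \<subseteq> cont_characters" for n unfolding union[symmetric] by (rule UN_upper) simp
    have cn: "c n \<notin> \<Lambda> n" for n
    proof
      assume "c n \<in> \<Lambda> n"
      moreover have "c n \<in> (\<Union>m. C m)" using c(3)[of n] unfolding C_def by (rule UN_I[OF UNIV_I])
      ultimately have "c n \<in> C n" using \<Lambda>(4)[of n] by (simp only: subset_iff Int_iff)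
      then show False using c(2)[of n] by (simp add: C_def)
    qed
    define approached where "approached n g \<longleftrightarrow> (\<forall>D \<epsilon> U. finite D \<and> D \<subseteq> \<Lambda> n \<and> 0 < \<epsilon> \<and> nb U
      \<longrightarrow> (\<exists>s\<in>bohr D \<epsilon>. inv (\<iota> s) \<otimes> g \<in> U))" for n g
    have ex: "\<exists>g. g \<in> carrier G \<and> g \<noteq> \<one> \<and> approached n g" for n
    proof (rule ccontr)
      assume contra: "\<not> ?thesis"
      obtain U where U: "nb U" "\<And>f. \<iota> f \<in> U \<Longrightarrow> norm (ec (c n f) - 1) < 1"
      proof -
        have "\<exists>U. nb U \<and> (\<forall>f. \<iota> f \<in> U \<longrightarrow> norm (ec (c n f) - 1) < 1)"
          using c(1)[of n] zero_less_one unfolding cont_characters_def by blast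
        then show ?thesis using that by blast
      qed
      have "\<exists>D \<epsilon>. finite D \<and> D \<subseteq> \<Lambda> n \<and> 0 < \<epsilon> \<and> (\<forall>s\<in>bohr D \<epsilon>. \<iota> s \<in> U)"
      proof (rule minimality_bohr[OF sub _ U(1)])
        fix g assume "g \<in> carrier G" "g \<noteq> \<one>"
        then have "\<not> approached n g" using contra by auto
        then obtain D \<epsilon> U where "finite D" "D \<subseteq> \<Lambda> n" "0 < \<epsilon>" "nb U" "\<not> (\<exists>s\<in>bohr D \<epsilon>. inv (\<iota> s) \<otimes> g \<in> U)"
          unfolding approached_def by auto
        then show "\<exists>D \<epsilon> U. finite D \<and> D \<subseteq> \<Lambda> n \<and> 0 < \<epsilon> \<and> nb U \<and> (\<forall>s\<in>bohr D \<epsilon>. inv (\<iota> s) \<otimes> g \<notin> U)"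
          by (intro exI[of _ D] exI[of _ \<epsilon>] exI[of _ U]) auto
      qed
      then obtain E \<epsilon> where E: "finite E" "E \<subseteq> \<Lambda> n" "0 < \<epsilon>" "\<And>s. s \<in> bohr E \<epsilon> \<Longrightarrow> \<iota> s \<in> U" by blast
      have "c n \<in> \<Lambda> n"
      proof (rule character_in_subgroup[OF \<Lambda>(1) _ _ E(1,2) _ _ E(3)])
        show "\<And>q. q \<in> \<Lambda> n \<Longrightarrow> additive_map q" using sub by (auto simp: cont_characters_def)
        show "q \<in> \<Lambda> n" if "additive_map q" "\<And>f. q f \<in> \<int>" for q
          using integral_induced[OF that] \<Lambda>(2) by blast
        show "\<exists>X. finite X \<and> (\<forall>f. \<exists>x\<in>X. f - x \<in> bohr E \<epsilon>)" if "0 < \<epsilon>" for \<epsilon>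
        proof -
          obtain U where U: "nb U" "\<And>f. \<iota> f \<in> U \<Longrightarrow> f \<in> bohr E \<epsilon>"
            using bohr_is_nbhd[OF E(1) _ \<open>0 < \<epsilon>\<close>] E(2) sub by blast
          obtain X where "finite X" "\<And>f. \<exists>x\<in>X. \<iota> (f - x) \<in> U"
            using pc U(1) unfolding precompact_image_def by blast
          then show ?thesis using U(2) by blast
        qed
        show "additive_map (c n)" using c(1) by (simp add: cont_characters_def)
        show "norm (ec (c n f) - 1) < 1" if "f \<in> bohr E \<epsilon>" for f using E(4)[OF that] U(2) by blast
      qed
      then show False using cn by blast
    qed
    obtain y where y: "\<And>n. y n \<in> carrier G" "\<And>n. y n \<noteq> \<one>" and y_near: "\<And>n. approached n (y n)"
      using ex by metis
    have near: "\<exists>s\<in>bohr D \<epsilon>. inv (\<iota> s) \<otimes> y n \<in> U"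
      if "finite D" "D \<subseteq> \<Lambda> n" "0 < \<epsilon>" "nb U" for n D \<epsilon> U
      using y_near[of n] that unfolding approached_def by simp
    have mono: "\<Lambda> m \<subseteq> \<Lambda> n" if "m \<le> n" for m n using \<Lambda>(3) that by (rule lift_Suc_mono_le[of \<Lambda>])
    have "\<exists>N. \<forall>n\<ge>N. y n \<in> U" if U: "nb U" for U
    proof -
      obtain V where V: "nb V" "\<And>a b c. a \<in> V \<Longrightarrow> b \<in> V \<Longrightarrow> c \<in> V \<Longrightarrow> a \<otimes> b \<otimes> c \<in> U"
        using nb_symmetric_triple[OF U] by blast
      obtain E \<epsilon> where E: "finite E" "E \<subseteq> cont_characters" "0 < \<epsilon>" "\<And>s. s \<in> bohr E \<epsilon> \<Longrightarrow> \<iota> s \<in> V"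
        using generate[OF V(1)] by blast
      have "\<exists>N. E \<subseteq> \<Lambda> N" using E(1,2)
      proof (induction E)
        case (insert q E)
        then obtain M N where "E \<subseteq> \<Lambda> N" "q \<in> \<Lambda> M" using union by blast
        then have "insert q E \<subseteq> \<Lambda> (max M N)" using mono[of M "max M N"] mono[of N "max M N"] by auto
        then show ?case by blast
      qed auto
      then obtain N where N: "E \<subseteq> \<Lambda> N" by blast
      have "y n \<in> U" if Nn: "N \<le> n" for n
      proof -
        have "E \<subseteq> \<Lambda> n" using N mono[OF Nn] by blast
        then obtain s where s: "s \<in> bohr E \<epsilon>" "inv (\<iota> s) \<otimes> y n \<in> V"
          using near[OF E(1) _ E(3) V(1), of n] by blast
        have "\<iota> s \<otimes> (inv (\<iota> s) \<otimes> y n) \<otimes> \<one> \<in> U" using E(4)[OF s(1)] s(2) nb_one[OF V(1)] by (intro V(2))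
        then show ?thesis using y(1) by (simp add: inv_mult_cancel_left)
      qed
      then show ?thesis by blast
    qed
    then have "null_sequence y" using y by (simp add: null_sequence_def)
    then show ?thesis by blast
  qed
qed

end

section \<open>Null sequences in minimal abelian groups\<close>

context poly_into_minimal begin

lemma \<iota>_smult: "\<iota> (smult c f) = \<iota> f [^] c"
proof -
  have nat: "\<iota> (smult (int n) f) = \<iota> f [^] n" for n
  proof (induction n)
    case (Suc n)
    have "smult (int (Suc n)) f = smult (int n) f + f" by (simp add: smult_add_left)
    then show ?case using Suc by (simp add: \<iota>_add)
  qed simp
  show ?thesis
  proof (cases "c \<ge> 0")
    case True
    then show ?thesis using nat[of "nat c"] by (simp add: int_pow_int[symmetric])
  next
    case False
    define n where "n = nat (- c)"
    have n: "c = - int n" using False by (simp add: n_def)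
    then show ?thesis using nat[of n] by (simp add: \<iota>_minus int_pow_neg int_pow_int)
  qed
qed

end

context minimal_abelian_group begin

text \<open>
A value taken infinitely often would lie in all neighbourhoods of the identity, so the range is
infinite.
\<close>

lemma null_sequence_converges:
  assumes y: "null_sequence y"
  shows "convergent_sequence_in T y \<and> nontrivial_sequence y"
proof
  have yc: "y n \<in> carrier G" "y n \<noteq> \<one>" for n using y by (auto simp: null_sequence_def)
  have lim: "\<exists>N. \<forall>n\<ge>N. y n \<in> U" if "nb U" for U using y that by (auto simp: null_sequence_def)
  have "finite (range y - U)" if U: "openin T U \<and> \<one> \<in> U" for U
  proof -
    obtain N where N: "\<And>n. N \<le> n \<Longrightarrow> y n \<in> U" using lim[of U] U by (auto simp: nb_def)
    have "n < N" if "y n \<notin> U" for n using N[of n] that by (cases "N \<le> n") auto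
    then have "range y - U \<subseteq> y ` {..<N}" by blast
    then show ?thesis by (rule finite_subset) simp
  qed
  then show "convergent_sequence_in T y"
    unfolding convergent_sequence_in_def topspace_T using yc by (auto intro!: bexI[of _ \<one>])
  have avoid: "\<exists>U. nb U \<and> (\<forall>v\<in>F. v \<notin> U)" if "finite F" "F \<subseteq> carrier G - {\<one>}" for F
    using that
  proof (induction F)
    case empty
    then show ?case using nb_UNIV by auto
  next
    case (insert v F)
    obtain U where "nb U" "\<forall>v\<in>F. v \<notin> U" using insert by auto
    moreover obtain V where "nb V" "v \<notin> V" using nb_sep[of v] insert.prems by auto
    ultimately show ?case using nb_Int[of U V] by (intro exI[of _ "U \<inter> V"]) auto
  qed
  show "nontrivial_sequence y" unfolding nontrivial_sequence_def
  proof
    assume "finite (range y)"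
    moreover have "range y \<subseteq> carrier G - {\<one>}" using yc by auto
    ultimately obtain U where U: "nb U" "\<forall>v\<in>range y. v \<notin> U" using avoid[of "range y"] by blast
    obtain N where "y N \<in> U" using lim[OF U(1)] by blast
    then show False using U(2) by blast
  qed
qed

text \<open>
The homomorphism from the free abelian group that sends the i-th monomial to x i.
\<close>

definition monomial_eval :: "(nat \<Rightarrow> 'a) \<Rightarrow> int poly \<Rightarrow> 'a" where
  "monomial_eval x f = (\<Otimes>i\<in>{..degree f}. x i [^] coeff f i)"

lemma monomial_eval_eq:
  assumes x: "\<And>i. x i \<in> carrier G" and "degree f \<le> n"
  shows "monomial_eval x f = (\<Otimes>i\<in>{..n}. x i [^] coeff f i)"
  unfolding monomial_eval_def
  by (rule finprod_mono_neutral_cong_left) (use assms in \<open>auto simp: coeff_eq_0\<close>)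

lemma monomial_eval_hom:
  assumes x: "\<And>i. x i \<in> carrier G"
  shows "poly_into_minimal G T (monomial_eval x)"
proof unfold_locales
  fix f g :: "int poly"
  show "monomial_eval x f \<in> carrier G" unfolding monomial_eval_def using x by (intro finprod_closed) auto
  let ?n = "max (degree f) (degree g)"
  have "monomial_eval x (f + g) = (\<Otimes>i\<in>{..?n}. x i [^] coeff (f + g) i)"
    by (rule monomial_eval_eq[of x "f + g" ?n, OF x]) (simp add: degree_add_le)
  also have "\<dots> = (\<Otimes>i\<in>{..?n}. x i [^] coeff f i \<otimes> x i [^] coeff g i)"
    by (rule finprod_cong') (simp_all add: x int_pow_mult Pi_def)
  also have "\<dots> = (\<Otimes>i\<in>{..?n}. x i [^] coeff f i) \<otimes> (\<Otimes>i\<in>{..?n}. x i [^] coeff g i)"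
    by (rule finprod_multf) (simp_all add: x Pi_def)
  also have "\<dots> = monomial_eval x f \<otimes> monomial_eval x g"
    using monomial_eval_eq[of x f ?n, OF x] monomial_eval_eq[of x g ?n, OF x] by simp
  finally show "monomial_eval x (f + g) = monomial_eval x f \<otimes> monomial_eval x g" .
qed

lemma monomial_eval_monom:
  assumes x: "\<And>i. x i \<in> carrier G"
  shows "monomial_eval x (monom 1 j) = x j"
proof -
  have "monomial_eval x (monom 1 j) = (\<Otimes>i\<in>{..j}. x i [^] coeff (monom 1 j :: int poly) i)"
    by (rule monomial_eval_eq[of x "monom 1 j" j, OF x degree_monom_le])
  also have "\<dots> = (\<Otimes>i\<in>{..j}. if j = i then x i else \<one>)"
    by (rule finprod_cong') (simp_all add: x Pi_def)
  also have "\<dots> = x j" by (rule finprod_singleton) (simp_all add: x Pi_def)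
  finally show ?thesis .
qed

definition torsion :: "nat \<Rightarrow> 'a set" where "torsion n = {x \<in> carrier G. x [^] n = \<one>}"

text \<open>
In a group of prime exponent p a nontrivial multiple c is prime to p, so c times the group is the
whole group.
\<close>

lemma ex_null_sequence_prime_torsion:
  assumes p: "prime (p::nat)" and inf: "infinite (torsion p)"
  shows "\<exists>y. null_sequence y"
proof -
  obtain x :: "nat \<Rightarrow> 'a" where x: "inj x" "range x \<subseteq> torsion p"
    using infinite_countable_subset[OF inf] by blast
  have xc: "x i \<in> carrier G" and xp: "x i [^] p = \<one>" for i using x(2) by (auto simp: torsion_def)
  interpret poly_into_minimal G T "monomial_eval x" by (rule monomial_eval_hom[OF xc])
  have kill: "monomial_eval x (smult (int p) f) = \<one>" for f
  proof -
    have "x i [^] (int p * k) = \<one>" for i k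
      using int_pow_pow[OF xc[of i], of "int p" k] xp[of i] by (simp add: int_pow_int)
    then have "(\<Otimes>i\<in>{..degree f}. x i [^] coeff (smult (int p) f) i) = \<one>"
      by (intro finprod_one_eqI) auto
    then show ?thesis using monomial_eval_eq[of x "smult (int p) f" "degree f", OF xc] by (simp add: degree_smult_le)
  qed
  have "range x \<subseteq> range (monomial_eval x)"
  proof (rule image_subsetI)
    fix i
    have "x i = monomial_eval x (monom 1 i)" by (rule monomial_eval_monom[OF xc, symmetric])
    then show "x i \<in> range (monomial_eval x)" by (rule range_eqI)
  qed
  then have inf': "infinite (range (monomial_eval x))"
    by (rule infinite_super) (rule range_inj_infinite[OF x(1)])
  have nontriv: "\<exists>f. monomial_eval x f \<noteq> \<one>"
  proof (rule ccontr)
    assume "\<not> ?thesis"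
    then have "range (monomial_eval x) \<subseteq> {\<one>}" by auto
    then have "finite (range (monomial_eval x))" by (rule finite_subset) simp
    then show False using inf' by simp
  qed
  have precompact_image unfolding precompact_image_def
  proof (intro allI impI)
    fix U assume U: "nb U"
    obtain c X g where c: "monomial_eval x (smult c g) \<noteq> \<one>" and X: "finite X"
      "\<And>f. \<exists>a\<in>X. monomial_eval x (smult c f - a) \<in> U"
      using multiple_precompact[OF U nontriv] by blast
    have "\<not> int p dvd c"
    proof
      assume "int p dvd c"
      then obtain k where "c = int p * k" by auto
      then have "smult c g = smult (int p) (smult k g)" by simp
      then show False using c kill[of "smult k g"] by simp
    qed
    moreover have "prime (int p)" using p by simp
    ultimately have "coprime (int p) c" by (rule prime_imp_coprime[rotated])
    then have "gcd c (int p) = 1" by (simp add: coprime_iff_gcd_eq_1 gcd.commute)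
    then obtain u v where uv: "u * c + v * int p = 1" using bezout_int[of c "int p"] by metis
    have "\<exists>a\<in>X. monomial_eval x (f - a) \<in> U" for f
    proof -
      obtain a where a: "a \<in> X" "monomial_eval x (smult c (smult u f) - a) \<in> U" using X(2) by blast
      have "f = smult (u * c + v * int p) f" using uv by simp
      also have "\<dots> = smult c (smult u f) + smult (int p) (smult v f)"
        by (simp add: smult_add_left mult.commute)
      finally have "f - a = (smult c (smult u f) - a) + smult (int p) (smult v f)" by simp
      then have "monomial_eval x (f - a) = monomial_eval x (smult c (smult u f) - a)"
        by (simp only: \<iota>_add kill r_one \<iota>_closed)
      then have "monomial_eval x (f - a) \<in> U" using a(2) by (simp only:)
      then show ?thesis using a(1) by blast
    qed
    then show "\<exists>X. finite X \<and> (\<forall>f. \<exists>a\<in>X. monomial_eval x (f - a) \<in> U)" using X(1) by blast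
  qed
  then show ?thesis using ex_null_sequence_precompact inf' by blast
qed

text \<open>
In an infinite cyclic group the multiples of c form a subgroup of finite index.
\<close>

lemma ex_null_sequence_infinite_order:
  assumes x: "x \<in> carrier G" and ord: "\<And>n. 0 < n \<Longrightarrow> x [^] (n::nat) \<noteq> \<one>"
  shows "\<exists>y. null_sequence y"
proof -
  define \<iota> where "\<iota> f = x [^] poly f 1" for f :: "int poly"
  interpret poly_into_minimal G T \<iota>
    by unfold_locales (use x in \<open>auto simp: \<iota>_def int_pow_mult\<close>)
  have inj: "inj (\<lambda>k::int. x [^] k)"
  proof (rule linorder_injI)
    fix k l :: int assume "k < l"
    then have "x [^] l = x [^] k \<otimes> x [^] nat (l - k)"
      using x int_pow_mult[of x k "l - k"] by (simp add: int_pow_int[symmetric])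
    moreover have "x [^] nat (l - k) \<noteq> \<one>" using \<open>k < l\<close> by (intro ord) simp
    ultimately show "x [^] k \<noteq> x [^] l" using x by (simp add: r_cancel_one')
  qed
  have "range (\<lambda>k::int. x [^] k) \<subseteq> range \<iota>"
  proof (rule image_subsetI)
    fix k :: int
    have "x [^] k = \<iota> [:k:]" by (simp add: \<iota>_def)
    then show "x [^] k \<in> range \<iota>" by (rule range_eqI)
  qed
  moreover have "infinite (range (\<lambda>k::int. x [^] k))"
    using finite_imageD[OF _ inj] infinite_UNIV_int by auto
  ultimately have inf: "infinite (range \<iota>)" by (rule infinite_super)
  have "\<iota> 1 \<noteq> \<one>" using ord[of 1] x by (simp add: \<iota>_def)
  have precompact_image unfolding precompact_image_def
  proof (intro allI impI)
    fix U assume U: "nb U"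
    obtain c X g where c: "\<iota> (smult c g) \<noteq> \<one>" and X: "finite X" "\<And>f. \<exists>a\<in>X. \<iota> (smult c f - a) \<in> U"
      using multiple_precompact[OF U] \<open>\<iota> 1 \<noteq> \<one>\<close> by blast
    have c0: "c \<noteq> 0" using c by auto
    let ?Y = "(\<lambda>(a, r). a + [:r:]) ` (X \<times> {- \<bar>c\<bar>..\<bar>c\<bar>})"
    have "\<exists>y\<in>?Y. \<iota> (f - y) \<in> U" for f
    proof -
      define k where "k = poly f 1"
      obtain a where a: "a \<in> X" "\<iota> (smult c [:k div c:] - a) \<in> U" using X(2) by blast
      have "\<bar>k mod c\<bar> < \<bar>c\<bar>" using c0 by (rule abs_mod_less)
      then have "a + [:k mod c:] \<in> ?Y" using a(1)
        by (intro image_eqI[of _ _ "(a, k mod c)"]) auto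
      moreover have "\<iota> (f - (a + [:k mod c:])) = \<iota> (smult c [:k div c:] - a)"
      proof -
        have "poly (f - (a + [:k mod c:])) 1 = k - k mod c - poly a 1" by (simp add: k_def)
        also have "k - k mod c = c * (k div c)" by (rule minus_mod_eq_mult_div)
        finally have "poly (f - (a + [:k mod c:])) 1 = poly (smult c [:k div c:] - a) 1" by simp
        then show ?thesis by (simp only: \<iota>_def)
      qed
      ultimately show ?thesis using a(2) by (intro bexI[of _ "a + [:k mod c:]"]) simp_all
    qed
    moreover have "finite ?Y" using X(1) by simp
    ultimately show "\<exists>X. finite X \<and> (\<forall>f. \<exists>a\<in>X. \<iota> (f - a) \<in> U)" by blast
  qed
  then show ?thesis using ex_null_sequence_precompact inf by blast
qed

lemma finite_power_fibre:
  assumes "finite (torsion m)"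
  shows "finite {x \<in> carrier G. x [^] m = y}"
proof (cases "\<exists>b. b \<in> carrier G \<and> b [^] m = y")
  case True
  then obtain b where b: "b \<in> carrier G" "b [^] m = y" by blast
  have "{x \<in> carrier G. x [^] m = y} \<subseteq> (\<lambda>k. k \<otimes> b) ` torsion m"
  proof
    fix x assume "x \<in> {x \<in> carrier G. x [^] m = y}"
    then have x: "x \<in> carrier G" "x [^] m = b [^] m" using b by auto
    have "(x \<otimes> inv b) [^] m = \<one>"
      using x b(1) by (simp add: pow_mult_distrib[OF m_comm] nat_pow_inv)
    then have "x \<otimes> inv b \<in> torsion m" using x b by (simp add: torsion_def)
    moreover have "x = (x \<otimes> inv b) \<otimes> b" using x b by (simp add: m_assoc)
    ultimately show "x \<in> (\<lambda>k. k \<otimes> b) ` torsion m" by blast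
  qed
  then show ?thesis using assms finite_surj by blast
next
  case False
  then have "{x \<in> carrier G. x [^] m = y} = {}" by blast
  then show ?thesis by (simp only: finite.emptyI)
qed

lemma finite_torsion:
  assumes fin: "\<And>p. prime p \<Longrightarrow> finite (torsion p)" and "0 < n"
  shows "finite (torsion n)"
  using \<open>0 < n\<close>
proof (induction n rule: less_induct)
  case (less n)
  show ?case
  proof (cases "n = 1")
    case True
    then have "torsion n \<subseteq> {\<one>}" by (auto simp: torsion_def)
    then show ?thesis by (rule finite_subset) simp
  next
    case False
    then obtain p m where pm: "prime p" "n = p * m" using prime_factor_nat[of n] by auto
    then have m: "0 < m" "m < n" using less.prems prime_gt_1_nat[of p] by (auto intro: Nat.gr0I)
    have sub: "(\<lambda>x. x [^] m) ` torsion n \<subseteq> torsion p"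
      by (auto simp: torsion_def pm(2) nat_pow_pow mult.commute)
    show ?thesis
    proof (rule ccontr)
      assume "infinite (torsion n)"
      then obtain y where "infinite ((\<lambda>x. x [^] m) -` {y} \<inter> torsion n)"
        using inf_img_fin_dom'[OF finite_subset[OF sub fin[OF pm(1)]]] by blast
      moreover have "(\<lambda>x. x [^] m) -` {y} \<inter> torsion n \<subseteq> {x \<in> carrier G. x [^] m = y}"
        by (auto simp: torsion_def)
      ultimately show False
        using finite_power_fibre[OF less.IH[OF m(2,1)], of y] finite_subset by blast
    qed
  qed
qed

text \<open>
The neighbourhoods V n avoid the elements of G one after another, so by minimality they form a
base. If some V n were trivial, a nonzero multiple of G would be finite, and G would be finite since
the multiplication has finite fibres.
\<close>

lemma ex_null_sequence_countable:
  assumes cnt: "countable (carrier G)" and inf: "infinite (carrier G)"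
    and fin: "\<And>n. 0 < n \<Longrightarrow> finite (torsion n)"
  shows "\<exists>y. null_sequence y"
proof -
  define x where "x = from_nat_into (carrier G)"
  have rx: "range x = carrier G" unfolding x_def by (rule range_from_nat_into) (use cnt in auto)
  have xc: "x i \<in> carrier G" for i unfolding rx[symmetric] by (rule rangeI)
  interpret poly_into_minimal G T "monomial_eval x" by (rule monomial_eval_hom[OF xc])
  have surj: "\<exists>f. monomial_eval x f = g" if g: "g \<in> carrier G" for g
  proof -
    have "g \<in> range x" using g rx by simp
    then obtain i where "g = x i" by (rule rangeE)
    then show ?thesis using monomial_eval_monom[of x i, OF xc] by blast
  qed
  obtain V where V0: "V 0 = carrier G" and nbV: "\<And>n. nb (V n)"
    and avoid: "\<And>n. x n \<noteq> \<one> \<Longrightarrow> x n \<notin> V (Suc n)"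
    and sym: "\<And>a n. a \<in> V (Suc n) \<Longrightarrow> inv a \<in> V (Suc n)"
    and triple: "\<And>a b c n. \<lbrakk>a \<in> V (Suc n); b \<in> V (Suc n); c \<in> V (Suc n)\<rbrakk> \<Longrightarrow> a \<otimes> b \<otimes> c \<in> V n"
    and dec: "\<And>m n. m \<le> n \<Longrightarrow> V n \<subseteq> V m"
    using ex_neighbourhood_sequence[of "carrier G" x, OF nb_UNIV xc] by metis
  define v where "v n = {f. monomial_eval x f \<in> V n}" for n
  have base: "subset_base (range v)" unfolding subset_base_def
  proof (intro conjI ballI)
    show "range v \<noteq> {}" by simp
    fix S assume "S \<in> range v"
    then obtain n where n: "S = v n" by blast
    show "0 \<in> S" unfolding n v_def using nb_one[OF nbV[of n]] by simp
    have "a - b \<in> S" if "a \<in> v (Suc n)" "b \<in> v (Suc n)" for a b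
    proof -
      have "inv (monomial_eval x b) \<in> V (Suc n)" using that(2) by (intro sym) (simp add: v_def)
      then have "monomial_eval x a \<otimes> inv (monomial_eval x b) \<otimes> \<one> \<in> V n"
        using that(1) nb_one[OF nbV] by (intro triple) (auto simp: v_def)
      then show ?thesis unfolding n v_def by (simp add: \<iota>_diff)
    qed
    then show "\<exists>S'\<in>range v. \<forall>a\<in>S'. \<forall>b\<in>S'. a - b \<in> S" by blast
  next
    fix S S' assume "S \<in> range v" "S' \<in> range v"
    then obtain m n where "S = v m" "S' = v n" by blast
    then have "v (max m n) \<subseteq> S \<inter> S'" using dec[of m "max m n"] dec[of n "max m n"] by (auto simp: v_def)
    then show "\<exists>S''\<in>range v. S'' \<subseteq> S \<inter> S'" by blast
  qed
  have small: "\<exists>n. V n \<subseteq> U" if U: "nb U" for U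
  proof -
    have "\<exists>S\<in>range v. \<forall>s\<in>S. monomial_eval x s \<in> U"
    proof (rule minimality[OF base _ U])
      fix g assume g: "g \<in> carrier G" "g \<noteq> \<one>"
      then obtain n where n: "g = x n" using rx by blast
      have "inv (monomial_eval x s) \<otimes> g \<notin> V (Suc (Suc n))" if s: "s \<in> v (Suc (Suc n))" for s
      proof
        assume "inv (monomial_eval x s) \<otimes> g \<in> V (Suc (Suc n))"
        then have "monomial_eval x s \<otimes> (inv (monomial_eval x s) \<otimes> g) \<otimes> \<one> \<in> V (Suc n)"
          using s nb_one[OF nbV] by (intro triple) (auto simp: v_def)
        then have "g \<in> V (Suc n)" using g by (simp add: inv_mult_cancel_left)
        then show False using avoid[of n] g n by simp
      qed
      then show "\<exists>S\<in>range v. \<exists>U. nb U \<and> (\<forall>s\<in>S. inv (monomial_eval x s) \<otimes> g \<notin> U)" using nbV by blast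
    qed
    then obtain n where n: "\<And>s. s \<in> v n \<Longrightarrow> monomial_eval x s \<in> U" by blast
    have "V n \<subseteq> U"
    proof
      fix g assume g: "g \<in> V n"
      obtain f where "monomial_eval x f = g" using surj nb_carrier[OF nbV g] by blast
      then show "g \<in> U" using n[of f] g by (simp add: v_def)
    qed
    then show ?thesis by blast
  qed
  have "\<exists>g\<in>V n. g \<noteq> \<one>" for n
  proof (rule ccontr)
    assume triv: "\<not> ?thesis"
    have "\<exists>g\<in>carrier G. g \<noteq> \<one>"
    proof (rule ccontr)
      assume "\<not> ?thesis"
      then have "carrier G \<subseteq> {\<one>}" by auto
      then have "finite (carrier G)" by (rule finite_subset) simp
      then show False using inf by simp
    qed
    then obtain g where "g \<in> carrier G" "g \<noteq> \<one>" by blast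
    then have "\<exists>f. monomial_eval x f \<noteq> \<one>" using surj[of g] by auto
    from multiple_precompact[OF nbV[of n] this]
    obtain c X f where c: "monomial_eval x (smult c f) \<noteq> \<one>" and X: "finite X"
      "\<And>f. \<exists>a\<in>X. monomial_eval x (smult c f - a) \<in> V n" by blast
    have c0: "c \<noteq> 0" using c by auto
    define m where "m = nat \<bar>c\<bar>"
    have m: "0 < m" using c0 by (simp add: m_def)
    let ?Y = "monomial_eval x ` X"
    have "(\<lambda>g. g [^] m) ` carrier G \<subseteq> ?Y \<union> (\<lambda>y. inv y) ` ?Y"
    proof
      fix h assume "h \<in> (\<lambda>g. g [^] m) ` carrier G"
      then obtain g where g: "g \<in> carrier G" "h = g [^] m" by blast
      obtain f where f: "monomial_eval x f = g" using surj[OF g(1)] by blast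
      obtain a where a: "a \<in> X" "monomial_eval x (smult c f - a) \<in> V n" using X(2) by blast
      then have "monomial_eval x (smult c f - a) = \<one>" using triv by blast
      then have "monomial_eval x (smult c f) = monomial_eval x a"
        using \<iota>_add[of "smult c f - a" a] by simp
      then have gc: "g [^] c = monomial_eval x a" using f by (simp add: \<iota>_smult)
      show "h \<in> ?Y \<union> (\<lambda>y. inv y) ` ?Y"
      proof (cases "c \<ge> 0")
        case True
        then have "h = g [^] c" using g by (simp add: m_def int_pow_int[symmetric])
        then show ?thesis using gc a(1) by auto
      next
        case False
        then have "h = g [^] (- c)" using g by (simp add: m_def int_pow_int[symmetric])
        then have "h = inv (g [^] c)" using g by (simp add: int_pow_neg)
        then show ?thesis using gc a(1) by auto
      qed
    qed
    then have fin_image: "finite ((\<lambda>g. g [^] m) ` carrier G)" by (rule finite_subset) (use X(1) in simp)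
    obtain y where "infinite ((\<lambda>g. g [^] m) -` {y} \<inter> carrier G)"
      using inf_img_fin_dom'[OF fin_image inf] by blast
    moreover have "(\<lambda>g. g [^] m) -` {y} \<inter> carrier G = {g \<in> carrier G. g [^] m = y}" by auto
    ultimately show False using finite_power_fibre[OF fin[OF m], of y] by simp
  qed
  then have "\<forall>n. \<exists>g. g \<in> V n \<and> g \<noteq> \<one>" by blast
  then obtain y where "\<forall>n. y n \<in> V n \<and> y n \<noteq> \<one>" by (rule choice[THEN exE])
  then have y: "y n \<in> V n" "y n \<noteq> \<one>" for n by auto
  have "null_sequence y" unfolding null_sequence_def
  proof (intro conjI allI impI)
    fix n show "y n \<in> carrier G" using nb_carrier[OF nbV y(1)] .
    show "y n \<noteq> \<one>" by (rule y(2))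
  next
    fix U assume "nb U"
    then obtain n where "V n \<subseteq> U" using small by blast
    then have "y m \<in> U" if "n \<le> m" for m using dec[OF that] y(1)[of m] by auto
    then show "\<exists>N. \<forall>n\<ge>N. y n \<in> U" by blast
  qed
  then show ?thesis by blast
qed

theorem ex_null_sequence:
  assumes inf: "infinite (carrier G)"
  shows "\<exists>y. null_sequence y"
proof (cases "\<exists>p::nat. prime p \<and> infinite (torsion p)")
  case True
  then show ?thesis using ex_null_sequence_prime_torsion by blast
next
  case False
  then have fin: "finite (torsion n)" if "0 < n" for n using finite_torsion that by blast
  show ?thesis
  proof (cases "\<exists>x\<in>carrier G. \<forall>n::nat. 0 < n \<longrightarrow> x [^] n \<noteq> \<one>")
    case True
    then show ?thesis using ex_null_sequence_infinite_order by blast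
  next
    case False
    then have "carrier G \<subseteq> (\<Union>n\<in>{0<..}. torsion n)" by (auto simp: torsion_def)
    moreover have "countable (\<Union>n\<in>{0<..}. torsion n)"
      by (rule countable_UN) (auto intro: countable_finite fin)
    ultimately have "countable (carrier G)" using countable_subset by blast
    then show ?thesis using ex_null_sequence_countable inf fin by blast
  qed
qed

end

theorem theorem1p3:
  fixes G :: "('a, 'b) monoid_scheme" and T :: "'a topology"
  assumes "comm_group G"
    and "infinite (carrier G)"
    and "minimal_group_topology G T"
  shows "\<exists>s. convergent_sequence_in T s \<and> nontrivial_sequence s"
proof -
  interpret comm_group G by (rule assms(1))
  interpret minimal_abelian_group G T by unfold_locales (rule assms(3))
  show ?thesis using ex_null_sequence[OF assms(2)] null_sequence_converges by blast
qed

end
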